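(* For the Server Cloud Scheduling problem restricted to fully parallel task graphs there is an FPTAS with respect to the cost objective (minimize cost subject to makespan at most a given deadline $d$) and an FPTAS with respect to the makespan objective (minimize makespan subject to cost at most a given budget $b$).
   Context: Server Cloud Scheduling: the input is a directed acyclic task graph $G=(\mathcal{J},E)$ with exactly one source $s$ and one sink $t$; each job $j\in\mathcal{J}$ has a server processing time $p_s(j)\in\mathbb{N}_0$ and a cloud processing time $p_c(j)\in\mathbb{N}_0$, where $p_s(s)=p_s(t)=0$ and $p_c(s)=p_c(t)=\infty$; each edge $(i,j)\in E$ has a communication delay $c(i,j)\in\mathbb{N}_0$. There is one server machine (processing at most one job at a time) and unboundedly many cloud machines. A schedule is a partition $\mathcal{J}=\mathcal{J}_s\cup\mathcal{J}_c$ together with completion times $C:\mathcal{J}\to\mathbb{N}_0$; let $p_\pi(j)=p_s(j)$ if $j\in\mathcal{J}_s$ and $p_\pi(j)=p_c(j)$ if $j\in\mathcal{J}_c$. It is valid if (a) for distinct $i,j\in\mathcal{J}_s$: $C(i)\le C(j)-p_\pi(j)$ or $C(i)-p_\pi(i)\ge C(j)$; (b) for every edge $(i,j)$ with $i,j$ on the same side: $C(i)\le C(j)-p_\pi(j)$, and for every edge with $i,j$ on different sides: $C(i)+c(i,j)\le C(j)-p_\pi(j)$. The makespan is $C(t)$ and the cost is $\sum_{j\in\mathcal{J}_c}p_c(j)$. A task graph is fully parallel if every job $j\notin\{s,t\}$ has exactly two incident edges, namely $(s,j)$ and $(j,t)$. *)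

theory Defs
  imports Complex_Main "HOL-Library.Log_Nat"
begin

text \<open>An instance: job set J, edge set E, source s, sink t, server times ps,
  cloud times pc, communication delays c.  The convention p_c(s) = p_c(t) = infinity
  is encoded by requiring s and t to lie on the server side (a job with infinite
  cloud time can never be completed on the cloud).  A schedule is the server set Js
  (the cloud set is J - Js) together with completion times C.\<close>

definition ptime :: "('j \<Rightarrow> nat) \<Rightarrow> ('j \<Rightarrow> nat) \<Rightarrow> 'j set \<Rightarrow> 'j \<Rightarrow> nat" where
  "ptime ps pc Js j = (if j \<in> Js then ps j else pc j)"

definition valid_schedule ::
  "'j set \<Rightarrow> ('j \<times> 'j) set \<Rightarrow> 'j \<Rightarrow> 'j \<Rightarrow> ('j \<Rightarrow> nat) \<Rightarrow> ('j \<Rightarrow> nat)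
   \<Rightarrow> ('j \<times> 'j \<Rightarrow> nat) \<Rightarrow> 'j set \<Rightarrow> ('j \<Rightarrow> nat) \<Rightarrow> bool" where
  "valid_schedule J E s t ps pc c Js C \<longleftrightarrow>
     Js \<subseteq> J \<and> s \<in> Js \<and> t \<in> Js \<and>
     (\<forall>i\<in>Js. \<forall>j\<in>Js. i \<noteq> j \<longrightarrow>
         int (C i) \<le> int (C j) - int (ptime ps pc Js j) \<or>
         int (C i) - int (ptime ps pc Js i) \<ge> int (C j)) \<and>
     (\<forall>(i, j)\<in>E. (i \<in> Js \<longleftrightarrow> j \<in> Js) \<longrightarrow>
         int (C i) \<le> int (C j) - int (ptime ps pc Js j)) \<and>
     (\<forall>(i, j)\<in>E. \<not> (i \<in> Js \<longleftrightarrow> j \<in> Js) \<longrightarrow>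
         int (C i) + int (c (i, j)) \<le> int (C j) - int (ptime ps pc Js j))"

definition sched_cost :: "'j set \<Rightarrow> ('j \<Rightarrow> nat) \<Rightarrow> 'j set \<Rightarrow> nat" where
  "sched_cost J pc Js = (\<Sum>j\<in>J - Js. pc j)"

definition makespan :: "'j \<Rightarrow> ('j \<Rightarrow> nat) \<Rightarrow> nat" where
  "makespan t C = C t"

text \<open>A fully parallel instance with n inner jobs is given by a list xs of length n
  of tuples (p_s(j), p_c(j), c(s,j), c(j,t)) for the inner jobs j = 1..n.
  Jobs are 0..n+1, with source 0 and sink n+1; the edges are (0,j) and (j,n+1).\<close>

type_synonym fp_inst = "(nat \<times> nat \<times> nat \<times> nat) list"

definition fp_jobs :: "fp_inst \<Rightarrow> nat set" where
  "fp_jobs xs = {0..Suc (length xs)}"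

definition fp_edges :: "fp_inst \<Rightarrow> (nat \<times> nat) set" where
  "fp_edges xs = {(0, j) | j. 1 \<le> j \<and> j \<le> length xs}
               \<union> {(j, Suc (length xs)) | j. 1 \<le> j \<and> j \<le> length xs}"

definition fp_inner :: "fp_inst \<Rightarrow> nat \<Rightarrow> bool" where
  "fp_inner xs j \<longleftrightarrow> 1 \<le> j \<and> j \<le> length xs"

definition fp_ps :: "fp_inst \<Rightarrow> nat \<Rightarrow> nat" where
  "fp_ps xs j = (if fp_inner xs j then (case xs ! (j - 1) of (a, b, ci, co) \<Rightarrow> a) else 0)"

definition fp_pc :: "fp_inst \<Rightarrow> nat \<Rightarrow> nat" where
  "fp_pc xs j = (if fp_inner xs j then (case xs ! (j - 1) of (a, b, ci, co) \<Rightarrow> b) else 0)"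

definition fp_c :: "fp_inst \<Rightarrow> nat \<times> nat \<Rightarrow> nat" where
  "fp_c xs e = (case e of (i, j) \<Rightarrow>
      if i = 0 \<and> fp_inner xs j then (case xs ! (j - 1) of (a, b, ci, co) \<Rightarrow> ci)
      else if fp_inner xs i \<and> j = Suc (length xs) then (case xs ! (i - 1) of (a, b, ci, co) \<Rightarrow> co)
      else 0)"

definition fp_valid :: "fp_inst \<Rightarrow> nat set \<Rightarrow> (nat \<Rightarrow> nat) \<Rightarrow> bool" where
  "fp_valid xs Js C = valid_schedule (fp_jobs xs) (fp_edges xs) 0 (Suc (length xs))
                        (fp_ps xs) (fp_pc xs) (fp_c xs) Js C"

definition fp_cost :: "fp_inst \<Rightarrow> nat set \<Rightarrow> nat" where
  "fp_cost xs Js = sched_cost (fp_jobs xs) (fp_pc xs) Js"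

definition fp_makespan :: "fp_inst \<Rightarrow> (nat \<Rightarrow> nat) \<Rightarrow> nat" where
  "fp_makespan xs C = makespan (Suc (length xs)) C"

text \<open>A random access machine with unbounded memory (registers indexed by nat), constant
  loading, addition, truncated subtraction, indirect load/store and conditional jump.
  Every step is charged the total bit length of all addresses/values it touches
  (logarithmic cost criterion), so that running time is polynomially equivalent to
  Turing machine time.\<close>

datatype instr =
    LoadC nat nat
  | Add nat nat nat
  | Sub nat nat nat
  | LoadI nat nat
  | StoreI nat nat
  | Jz nat nat
  | Halt

type_synonym conf = "nat \<times> (nat \<Rightarrow> nat)"

definition bitlen :: "nat \<Rightarrow> nat" where
  "bitlen x = floorlog 2 x + 1"

definition ram_step :: "instr list \<Rightarrow> conf \<Rightarrow> (nat \<times> conf) option" where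
  "ram_step P cf = (case cf of (pc, m) \<Rightarrow>
     if length P \<le> pc then None else
     (case P ! pc of
        LoadC r c \<Rightarrow> Some (bitlen r + bitlen c, (Suc pc, m(r := c)))
      | Add r a b \<Rightarrow> Some (bitlen r + bitlen a + bitlen b + bitlen (m a) + bitlen (m b),
                          (Suc pc, m(r := m a + m b)))
      | Sub r a b \<Rightarrow> Some (bitlen r + bitlen a + bitlen b + bitlen (m a) + bitlen (m b),
                          (Suc pc, m(r := m a - m b)))
      | LoadI r a \<Rightarrow> Some (bitlen r + bitlen a + bitlen (m a) + bitlen (m (m a)),
                          (Suc pc, m(r := m (m a))))
      | StoreI a b \<Rightarrow> Some (bitlen a + bitlen (m a) + bitlen b + bitlen (m b),
                          (Suc pc, m(m a := m b)))
      | Jz r l \<Rightarrow> Some (bitlen r + bitlen (m r) + bitlen l,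
                          (if m r = 0 then l else Suc pc, m))
      | Halt \<Rightarrow> None))"

fun ram_run :: "instr list \<Rightarrow> nat \<Rightarrow> conf \<Rightarrow> nat \<times> conf" where
  "ram_run P 0 cf = (0, cf)"
| "ram_run P (Suc k) cf = (case ram_step P cf of
      None \<Rightarrow> (0, cf)
    | Some (t, cf') \<Rightarrow> (case ram_run P k cf' of (t', cf'') \<Rightarrow> (t + t', cf'')))"

definition ram_init :: "nat list \<Rightarrow> conf" where
  "ram_init xs = (0, \<lambda>i. if i = 0 then length xs else if i \<le> length xs then xs ! (i - 1) else 0)"

definition ram_output :: "conf \<Rightarrow> nat list" where
  "ram_output cf = (case cf of (pc, m) \<Rightarrow> map (\<lambda>i. m (Suc i)) [0..<m 0])"

definition ram_computes :: "instr list \<Rightarrow> nat list \<Rightarrow> nat \<Rightarrow> nat list \<Rightarrow> bool" where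
  "ram_computes P xs T ys \<longleftrightarrow>
     (\<exists>k. case ram_run P k (ram_init xs) of (t, cf) \<Rightarrow>
            ram_step P cf = None \<and> t \<le> T \<and> ram_output cf = ys)"

definition input_size :: "nat list \<Rightarrow> nat" where
  "input_size xs = sum_list (map bitlen xs)"

definition enc_fp :: "fp_inst \<Rightarrow> nat list" where
  "enc_fp xs = length xs # concat (map (\<lambda>(a, b, ci, co). [a, b, ci, co]) xs)"

definition dec_ok :: "fp_inst \<Rightarrow> nat list \<Rightarrow> bool" where
  "dec_ok xs ys \<longleftrightarrow> length ys = 2 * (length xs + 2)"

definition dec_server :: "fp_inst \<Rightarrow> nat list \<Rightarrow> nat set" where
  "dec_server xs ys = {j. j \<le> Suc (length xs) \<and> ys ! (2 * j) = 0}"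

definition dec_compl :: "nat list \<Rightarrow> nat \<Rightarrow> nat" where
  "dec_compl ys j = ys ! (2 * j + 1)"

definition fptas_cost :: "instr list \<Rightarrow> nat \<Rightarrow> bool" where
  "fptas_cost P k \<longleftrightarrow>
   (\<forall>xs d p q. 0 < p \<longrightarrow> 0 < q \<longrightarrow>
     (let inp = enc_fp xs @ [d, p, q] in
      \<exists>ys T. ram_computes P inp T ys \<and>
        T \<le> k * (input_size inp + q div p + 1) ^ k \<and>
        (if (\<exists>Js C. fp_valid xs Js C \<and> fp_makespan xs C \<le> d)
         then dec_ok xs ys \<and>
              fp_valid xs (dec_server xs ys) (dec_compl ys) \<and>
              fp_makespan xs (dec_compl ys) \<le> d \<and>
              (\<forall>Js C. fp_valid xs Js C \<and> fp_makespan xs C \<le> d \<longrightarrow>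
                 real (fp_cost xs (dec_server xs ys))
                   \<le> (1 + real p / real q) * real (fp_cost xs Js))
         else ys = [])))"

text \<open>Makespan objective: input is the instance, a budget b, and eps = p/q.
  The output is a valid schedule of cost at most b whose makespan is at most (1+eps)
  times the makespan of every valid schedule of cost at most b (such schedules always
  exist: put everything on the server).\<close>

definition fptas_makespan :: "instr list \<Rightarrow> nat \<Rightarrow> bool" where
  "fptas_makespan P k \<longleftrightarrow>
   (\<forall>xs b p q. 0 < p \<longrightarrow> 0 < q \<longrightarrow>
     (let inp = enc_fp xs @ [b, p, q] in
      \<exists>ys T. ram_computes P inp T ys \<and>
        T \<le> k * (input_size inp + q div p + 1) ^ k \<and>
        dec_ok xs ys \<and>
        fp_valid xs (dec_server xs ys) (dec_compl ys) \<and>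
        fp_cost xs (dec_server xs ys) \<le> b \<and>
        (\<forall>Js C. fp_valid xs Js C \<and> fp_cost xs Js \<le> b \<longrightarrow>
           real (fp_makespan xs (dec_compl ys))
             \<le> (1 + real p / real q) * real (fp_makespan xs C))))"

end

theory Submission
  imports Defs
begin

text \<open>
  Write \<open>w j\<close> for \<open>c(s,j) + p\<^sub>c(j) + c(j,t)\<close>. A set \<open>K\<close> of cloud jobs can be scheduled with makespan
  exactly the maximum of the total server time of the other jobs and of \<open>w j\<close> for \<open>j\<close> in \<open>K\<close>, so both
  problems are minimum knapsack problems: every job goes to one of two sides, one side pays an
  objective \<open>U j\<close>, the other one uses \<open>V j\<close> units of a bounded resource. For every threshold \<open>M\<close>
  among finitely many candidates, all sides that would force an optimum above \<open>M\<close> are forbidden, the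
  values \<open>U j\<close> are rounded to multiples of \<open>(M + 1) / R\<close> with \<open>R = 2 n (q div p + 1)\<close>, and a
  dynamic program over the rounded objective finds the least resource use. The candidate equal to
  the largest value in an optimal solution yields the approximation ratio.

  On the machine, numbers at most double in one step, so a polynomial number of steps already
  implies polynomial logarithmic cost. Hence it suffices to count the steps of a compiled
  program in a small language all of whose loops have limits that are known in advance; the
  only exception is one division by repeated subtraction, which takes about \<open>q div p\<close> steps.
\<close>

section \<open>Steps of the machine\<close>

text \<open>One program, run on per-item data \<open>U\<close>, \<open>V\<close>, \<open>L\<close>,
  \<open>B\<close>, serves both objectives. The threshold \<open>M\<close> has a double role: it
  caps every \<open>U j\<close> on the objective side, which keeps rounding errors small, and for
  the makespan it also caps \<open>w j\<close> for every cloud job. This is why a solution is valued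
  by \<open>max (sum U X) M\<close>. The right \<open>M\<close> is a value that an optimal solution
  really incurs, hence at most the optimum, so an additive error \<open>M / N0\<close> with
  \<open>N0 = q div p + 1 > q / p\<close> is a relative error below \<open>p / q\<close>. Times,
  delays and bounds can be exponential in the input length, so none of them may govern a loop; only
  \<open>n\<close>, \<open>R\<close>, \<open>S\<close> and the quotient \<open>q div p\<close> do.
  As the machine cannot multiply, rounding is done by \<open>R\<close> additions with carry. A set
  of jobs is kept as a bit mask in one number: long numbers are harmless under logarithmic cost, and
  adding a job to a set is a single addition.\<close>

inductive reach :: "instr list \<Rightarrow> nat \<Rightarrow> conf \<Rightarrow> conf \<Rightarrow> bool" for P where
  reach_refl: "reach P 0 cf cf"
| reach_step: "ram_step P cf = Some (t, cf') \<Longrightarrow> reach P k cf' cf'' \<Longrightarrow> reach P (Suc k) cf cf''"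

lemma reach_trans:
  "reach P k cf cf' \<Longrightarrow> reach P l cf' cf'' \<Longrightarrow> reach P (k + l) cf cf''"
  by (induction rule: reach.induct) (auto intro: reach_step)

lemma reach_trans':
  "reach P k cf cf' \<Longrightarrow> reach P l cf' cf'' \<Longrightarrow> n = k + l \<Longrightarrow> reach P n cf cf''"
  using reach_trans by blast

lemma reach_one: "ram_step P cf = Some (t, cf') \<Longrightarrow> reach P 1 cf cf'"
  using reach_step[OF _ reach_refl] by fastforce

lemma ram_run_reach:
  "reach P k cf cf' \<Longrightarrow> snd (ram_run P k cf) = cf'"
  by (induction rule: reach.induct) (auto split: prod.splits)

section \<open>Logarithmic cost from the number of steps\<close>

lemma bitlen_le: "x < 2 ^ L \<Longrightarrow> bitlen x \<le> L + 1"
  unfolding bitlen_def using floorlog_leI[of x 2 L] by (cases "x = 0") (auto simp: floorlog_def)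

lemma less_two_power_bitlen: "x < 2 ^ bitlen x"
proof (cases "x = 0")
  case False
  then have "x < 2 ^ floorlog 2 x" using floorlog_bounds[of x 2] by simp
  also have "\<dots> \<le> 2 ^ bitlen x" unfolding bitlen_def by (intro power_increasing) auto
  finally show ?thesis .
qed (simp add: bitlen_def)

fun operands :: "instr \<Rightarrow> nat list" where
  "operands (LoadC r c) = [r, c]"
| "operands (Add r a b) = [r, a, b]"
| "operands (Sub r a b) = [r, a, b]"
| "operands (LoadI r a) = [r, a]"
| "operands (StoreI a b) = [a, b]"
| "operands (Jz r l) = [r, l]"
| "operands Halt = []"

text \<open>Addresses and constants in the program text are charged too, and constants enter the
  memory, so they need the same bit bound as the memory contents.\<close>

definition operand_bound :: "instr list \<Rightarrow> nat \<Rightarrow> bool" where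
  "operand_bound P L \<longleftrightarrow> (\<forall>ins \<in> set P. \<forall>x \<in> set (operands ins). x < 2 ^ L)"

lemma operand_bound_mono: "operand_bound P L \<Longrightarrow> L \<le> L' \<Longrightarrow> operand_bound P L'"
  unfolding operand_bound_def
  by (meson less_le_trans one_le_numeral power_increasing)

lemma operand_bound_ex: "\<exists>L. operand_bound P L"
proof -
  define L where "L = sum_list (concat (map operands P))"
  have "x < 2 ^ L" if "ins \<in> set P" "x \<in> set (operands ins)" for ins x
  proof -
    have "x \<le> L" unfolding L_def by (rule member_le_sum_list) (use that in auto)
    also have "L < 2 ^ L" by simp
    finally show ?thesis .
  qed
  then show ?thesis unfolding operand_bound_def by blast
qed

text \<open>No instruction is charged for more than five numbers, and only an addition can exceed
  the old bound, at most doubling it.\<close>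

lemma ram_step_cost:
  assumes "operand_bound P L" "\<And>i. m i < 2 ^ L" "ram_step P (pc, m) = Some (t, (pc', m'))"
  shows "t \<le> 5 * (L + 1)" "\<And>i. m' i < 2 ^ Suc L"
proof -
  have pc: "pc < length P" using assms(3) by (auto simp: ram_step_def split: if_splits)
  then have "\<forall>x \<in> set (operands (P ! pc)). x < 2 ^ L"
    using assms(1) nth_mem unfolding operand_bound_def by blast
  then have ops: "\<And>x. x \<in> set (operands (P ! pc)) \<Longrightarrow> bitlen x \<le> L + 1 \<and> x < 2 ^ L"
    using bitlen_le by blast
  have m: "bitlen (m i) \<le> L + 1" for i using bitlen_le assms(2) by blast
  show "t \<le> 5 * (L + 1)"
  proof (cases "P ! pc")
    case (LoadI r a)
    then show ?thesis using assms(3) pc ops[of r] ops[of a] m[of a] m[of "m a"] by (auto simp: ram_step_def)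
  next
    case (StoreI a b)
    then show ?thesis using assms(3) pc ops[of a] ops[of b] m[of a] m[of b] by (auto simp: ram_step_def)
  next
    case (Add r a b)
    then show ?thesis using assms(3) pc ops[of r] ops[of a] ops[of b] m[of a] m[of b]
      by (auto simp: ram_step_def)
  next
    case (Sub r a b)
    then show ?thesis using assms(3) pc ops[of r] ops[of a] ops[of b] m[of a] m[of b]
      by (auto simp: ram_step_def)
  next
    case (LoadC r c)
    then show ?thesis using assms(3) pc ops[of r] ops[of c] by (auto simp: ram_step_def)
  next
    case (Jz r l)
    then show ?thesis using assms(3) pc ops[of r] ops[of l] m[of r] by (auto simp: ram_step_def)
  next
    case Halt
    then show ?thesis using assms(3) pc by (auto simp: ram_step_def)
  qed
  have m2: "m i < 2 * 2 ^ L" "m i + m j < 2 * 2 ^ L" "m i - m j < 2 * 2 ^ L" for i j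
    using assms(2)[of i] assms(2)[of j] by linarith+
  have c2: "c < 2 * 2 ^ L" if "c \<in> set (operands (P ! pc))" for c
    using ops[OF that] by linarith
  show "m' i < 2 ^ Suc L" for i
    using assms(3) pc m2 c2 unfolding ram_step_def
    by (cases "P ! pc") auto
qed

text \<open>After \<open>j\<close> steps all values are below \<open>2 ^ (L + j)\<close>, so each of
  the \<open>k\<close> steps costs at most \<open>5 * (L + k + 1)\<close>. Hence polynomially many
  steps have polynomial cost, and everything below only counts steps.\<close>

lemma ram_run_cost:
  assumes "operand_bound P L" "\<And>i. m i < 2 ^ L"
  shows "fst (ram_run P k (pc, m)) \<le> k * (5 * (L + k + 1))"
  using assms
proof (induction k arbitrary: L pc m)
  case (Suc k)
  show ?case
  proof (cases "ram_step P (pc, m)")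
    case (Some r)
    obtain t pc' m' where r: "r = (t, (pc', m'))" by (cases r) auto
    note step = ram_step_cost[OF Suc.prems Some[unfolded r]]
    have "operand_bound P (Suc L)"
      using Suc.prems(1) by (rule operand_bound_mono) simp
    from Suc.IH[OF this step(2)]
    have "fst (ram_run P k (pc', m')) \<le> k * (5 * (Suc L + k + 1))" .
    then have "t + fst (ram_run P k (pc', m')) \<le> 5 * (L + 1) + k * (5 * (Suc L + k + 1))"
      using step(1) by linarith
    also have "\<dots> \<le> Suc k * (5 * (L + Suc k + 1))" by (simp add: algebra_simps)
    finally show ?thesis using Some r by (auto split: prod.splits)
  qed simp
qed simp

lemma length_le_input_size: "length xs \<le> input_size xs"
  unfolding input_size_def by (induction xs) (auto simp: bitlen_def)

lemma bitlen_le_input_size: "x \<in> set xs \<Longrightarrow> bitlen x \<le> input_size xs"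
  unfolding input_size_def by (rule member_le_sum_list) auto

lemma ram_init_bound: "snd (ram_init xs) i < 2 ^ input_size xs"
proof -
  have "length xs < 2 ^ input_size xs"
    using length_le_input_size[of xs] less_exp[of "input_size xs"] by linarith
  moreover have "xs ! j < 2 ^ input_size xs" if "j < length xs" for j
  proof -
    have "xs ! j < 2 ^ bitlen (xs ! j)" by (rule less_two_power_bitlen)
    also have "\<dots> \<le> 2 ^ input_size xs"
      using bitlen_le_input_size[of "xs ! j" xs] that by (intro power_increasing) auto
    finally show ?thesis .
  qed
  ultimately show ?thesis unfolding ram_init_def by auto
qed

lemma ram_computes_reach:
  assumes "operand_bound P L" "reach P k (ram_init xs) cf" "ram_step P cf = None"
  shows "ram_computes P xs (k * (5 * (input_size xs + L + k + 1))) (ram_output cf)"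
proof -
  define L' where "L' = input_size xs + L"
  have ob: "operand_bound P L'"
    using assms(1) by (rule operand_bound_mono) (simp add: L'_def)
  have m: "snd (ram_init xs) i < 2 ^ L'" for i
    unfolding L'_def using ram_init_bound[of xs i]
    by (meson le_add1 less_le_trans one_le_numeral power_increasing)
  have "fst (ram_run P k (fst (ram_init xs), snd (ram_init xs))) \<le> k * (5 * (L' + k + 1))"
    by (rule ram_run_cost[OF ob m])
  then show ?thesis
    unfolding ram_computes_def using ram_run_reach[OF assms(2)] assms(3)
    by (intro exI[of _ k]) (auto simp: L'_def split: prod.splits)
qed

section \<open>Straight-line code\<close>

primrec code_at :: "instr list \<Rightarrow> nat \<Rightarrow> instr list \<Rightarrow> bool" where
  "code_at P i [] \<longleftrightarrow> True"
| "code_at P i (x # xs) \<longleftrightarrow> i < length P \<and> P ! i = x \<and> code_at P (Suc i) xs"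

lemma code_at_append [simp]:
  "code_at P i (xs @ ys) \<longleftrightarrow> code_at P i xs \<and> code_at P (i + length xs) ys"
  by (induction xs arbitrary: i) auto

lemma code_at_middle: "code_at (us @ xs @ ws) (length us) xs"
proof (induction xs arbitrary: us)
  case (Cons x xs)
  show ?case using Cons.IH[of "us @ [x]"] by simp
qed simp

fun effect :: "instr \<Rightarrow> (nat \<Rightarrow> nat) \<Rightarrow> nat \<Rightarrow> nat" where
  "effect (LoadC r c) m = m(r := c)"
| "effect (Add r a b) m = m(r := m a + m b)"
| "effect (Sub r a b) m = m(r := m a - m b)"
| "effect (LoadI r a) m = m(r := m (m a))"
| "effect (StoreI a b) m = m(m a := m b)"
| "effect _ m = m"

fun is_straight :: "instr \<Rightarrow> bool" where
  "is_straight (Jz _ _) = False"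
| "is_straight Halt = False"
| "is_straight _ = True"

lemma reach_straight:
  assumes "code_at P i xs" "list_all is_straight xs"
  shows "reach P (length xs) (i, m) (i + length xs, fold effect xs m)"
  using assms
proof (induction xs arbitrary: i m)
  case (Cons x xs)
  have "\<exists>t. ram_step P (i, m) = Some (t, (Suc i, effect x m))"
    using Cons.prems by (cases x) (auto simp: ram_step_def)
  then show ?case using Cons.IH[of "Suc i" "effect x m"] Cons.prems
    by (auto intro: reach_step)
qed (auto intro: reach_refl)

lemma reach_straight':
  assumes "code_at P i xs" "list_all is_straight xs"
    "j = i + length xs" "m' = fold effect xs m" "k = length xs"
  shows "reach P k (i, m) (j, m')"
  using reach_straight[OF assms(1,2)] assms(3-) by simp

lemma reach_Jz:
  assumes "code_at P i [Jz r l]" "j = (if m r = 0 then l else Suc i)"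
  shows "reach P 1 (i, m) (j, m)"
  using assms by (intro reach_one) (auto simp: ram_step_def)

section \<open>A language of bounded loops\<close>

text \<open>\<open>DivS\<close> divides by the successor of its second operand, so that it always terminates; a loop
  reads its limit once, on entry.\<close>

type_synonym state = "(nat \<Rightarrow> nat) \<times> (nat \<Rightarrow> nat \<Rightarrow> nat)"

datatype com =
    SetC nat nat
  | AddV nat nat nat
  | SubV nat nat nat
  | DivS nat nat nat
  | ReadA nat nat nat
  | WriteA nat nat nat
  | Seq com com  (infixr \<open>;;\<close> 60)
  | IfZ nat com com
  | For nat nat com

definition setv :: "nat \<Rightarrow> nat \<Rightarrow> state \<Rightarrow> state" where
  "setv x c \<sigma> = ((fst \<sigma>)(x := c), snd \<sigma>)"

definition seta :: "nat \<Rightarrow> nat \<Rightarrow> nat \<Rightarrow> state \<Rightarrow> state" where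
  "seta k i c \<sigma> = (fst \<sigma>, (snd \<sigma>)(k := (snd \<sigma> k)(i := c)))"

lemma fst_setv [simp]: "fst (setv x c \<sigma>) = (fst \<sigma>)(x := c)"
  and snd_setv [simp]: "snd (setv x c \<sigma>) = snd \<sigma>"
  and fst_seta [simp]: "fst (seta k i c \<sigma>) = fst \<sigma>"
  and snd_seta [simp]: "snd (seta k i c \<sigma>) = (snd \<sigma>)(k := (snd \<sigma> k)(i := c))"
  by (simp_all add: setv_def seta_def)

primrec sem :: "com \<Rightarrow> state \<Rightarrow> state" where
  "sem (SetC x c) = setv x c"
| "sem (AddV x y z) = (\<lambda>\<sigma>. setv x (fst \<sigma> y + fst \<sigma> z) \<sigma>)"
| "sem (SubV x y z) = (\<lambda>\<sigma>. setv x (fst \<sigma> y - fst \<sigma> z) \<sigma>)"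
| "sem (DivS x y z) = (\<lambda>\<sigma>. setv x (fst \<sigma> y div Suc (fst \<sigma> z)) \<sigma>)"
| "sem (ReadA x k y) = (\<lambda>\<sigma>. setv x (snd \<sigma> k (fst \<sigma> y)) \<sigma>)"
| "sem (WriteA k x y) = (\<lambda>\<sigma>. seta k (fst \<sigma> x) (fst \<sigma> y) \<sigma>)"
| "sem (c1 ;; c2) = (\<lambda>\<sigma>. sem c2 (sem c1 \<sigma>))"
| "sem (IfZ x c1 c2) = (\<lambda>\<sigma>. if fst \<sigma> x = 0 then sem c1 \<sigma> else sem c2 \<sigma>)"
| "sem (For v x c) = (\<lambda>\<sigma>. fold (\<lambda>k \<tau>. sem c (setv v k \<tau>)) [0..<fst \<sigma> x] \<sigma>)"

text \<open>The constants count compiled instructions: an array access is seven for the address and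
  one for the transfer; a loop has two to start, one final test, and 3 + 5 around each run of the
  body; a division has 4 + 3 + 2 and seven per subtraction. For \<open>IfZ\<close> the 3 is the
  longer of the two branches' overheads.\<close>

primrec tm :: "com \<Rightarrow> state \<Rightarrow> nat" where
  "tm (SetC x c) = (\<lambda>\<sigma>. 1)"
| "tm (AddV x y z) = (\<lambda>\<sigma>. 1)"
| "tm (SubV x y z) = (\<lambda>\<sigma>. 1)"
| "tm (DivS x y z) = (\<lambda>\<sigma>. 9 + 7 * (fst \<sigma> y div Suc (fst \<sigma> z)))"
| "tm (ReadA x k y) = (\<lambda>\<sigma>. 8)"
| "tm (WriteA k x y) = (\<lambda>\<sigma>. 8)"
| "tm (c1 ;; c2) = (\<lambda>\<sigma>. tm c1 \<sigma> + tm c2 (sem c1 \<sigma>))"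
| "tm (IfZ x c1 c2) = (\<lambda>\<sigma>. 3 + (if fst \<sigma> x = 0 then tm c1 \<sigma> else tm c2 \<sigma>))"
| "tm (For v x c) = (\<lambda>\<sigma>. 3 + (\<Sum>k<fst \<sigma> x.
     8 + tm c (setv v k (fold (\<lambda>k \<tau>. sem c (setv v k \<tau>)) [0..<k] \<sigma>))))"

section \<open>Compilation\<close>

text \<open>Registers 0, 1, 3, 4, 5, 6 are scratch, register 2 holds the base address \<open>B\<close> of the
  heap, scalar \<open>x\<close> lives in register \<open>8 + x\<close>, and a loop at nesting depth \<open>d\<close> keeps its
  index and its remaining count in the registers \<open>40 + 2 * d\<close> and \<open>41 + 2 * d\<close>.
  The 16 arrays are interleaved: entry \<open>i\<close> of array \<open>k\<close> has address \<open>B + 16 * i + k\<close>, so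
  that none of them needs a length.\<close>

definition addr_code :: "nat \<Rightarrow> nat \<Rightarrow> instr list" where
  "addr_code k y = [Add 0 (8 + y) (8 + y), Add 0 0 0, Add 0 0 0, Add 0 0 0,
     LoadC 1 k, Add 0 0 1, Add 0 0 2]"

primrec csize :: "com \<Rightarrow> nat" where
  "csize (SetC x c) = 1"
| "csize (AddV x y z) = 1"
| "csize (SubV x y z) = 1"
| "csize (DivS x y z) = 13"
| "csize (ReadA x k y) = 8"
| "csize (WriteA k x y) = 8"
| "csize (c1 ;; c2) = csize c1 + csize c2"
| "csize (IfZ x c1 c2) = 3 + csize c1 + csize c2"
| "csize (For v x c) = 10 + csize c"

text \<open>An unconditional jump is a \<open>Jz\<close> on a register just set to 0. As
  \<open>Jz\<close> jumps on zero, the nonzero branch of \<open>IfZ\<close> comes first. In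
  \<open>DivS\<close>, register 6 receives \<open>a + 1 - divisor\<close>, and truncation makes this
  0 exactly when \<open>a < divisor\<close>.\<close>

primrec compile :: "com \<Rightarrow> nat \<Rightarrow> nat \<Rightarrow> instr list" where
  "compile (SetC x c) = (\<lambda>d i. [LoadC (8 + x) c])"
| "compile (AddV x y z) = (\<lambda>d i. [Add (8 + x) (8 + y) (8 + z)])"
| "compile (SubV x y z) = (\<lambda>d i. [Sub (8 + x) (8 + y) (8 + z)])"
| "compile (DivS x y z) = (\<lambda>d i.
     [LoadC 1 1, Add 3 (8 + z) 1, LoadC 4 0, Add 5 (8 + y) 4] @
     [Add 6 5 1, Sub 6 6 3] @ [Jz 6 (i + 11)] @
     [Sub 5 5 3, Add 4 4 1, LoadC 0 0] @ [Jz 0 (i + 4)] @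
     [LoadC 0 0, Add (8 + x) 4 0])"
| "compile (ReadA x k y) = (\<lambda>d i. addr_code k y @ [LoadI (8 + x) 0])"
| "compile (WriteA k x y) = (\<lambda>d i. addr_code k x @ [StoreI 0 (8 + y)])"
| "compile (c1 ;; c2) = (\<lambda>d i. compile c1 d i @ compile c2 d (i + csize c1))"
| "compile (IfZ x c1 c2) = (\<lambda>d i.
     [Jz (8 + x) (i + 3 + csize c2)] @ compile c2 d (i + 1) @
     [LoadC 1 0] @ [Jz 1 (i + 3 + csize c2 + csize c1)] @ compile c1 d (i + 3 + csize c2))"
| "compile (For v x c) = (\<lambda>d i.
     [LoadC (40 + 2 * d) 0, Add (41 + 2 * d) (8 + x) (40 + 2 * d)] @
     [Jz (41 + 2 * d) (i + 10 + csize c)] @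
     [LoadC 1 0, Add (8 + v) (40 + 2 * d) 1] @ compile c (Suc d) (i + 5) @
     [LoadC 1 1, Add (40 + 2 * d) (40 + 2 * d) 1, Sub (41 + 2 * d) (41 + 2 * d) 1, LoadC 1 0] @
     [Jz 1 (i + 2)])"

lemma length_compile [simp]: "length (compile c d i) = csize c"
  by (induction c arbitrary: d i) (auto simp: addr_code_def)

text \<open>The first argument is the number of further nested loops allowed; registers 40 to 47
  hold the index and count pairs of four of them.\<close>

primrec wf_com :: "nat \<Rightarrow> com \<Rightarrow> bool" where
  "wf_com d (SetC x c) \<longleftrightarrow> x < 32"
| "wf_com d (AddV x y z) \<longleftrightarrow> x < 32 \<and> y < 32 \<and> z < 32"
| "wf_com d (SubV x y z) \<longleftrightarrow> x < 32 \<and> y < 32 \<and> z < 32"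
| "wf_com d (DivS x y z) \<longleftrightarrow> x < 32 \<and> y < 32 \<and> z < 32"
| "wf_com d (ReadA x k y) \<longleftrightarrow> x < 32 \<and> k < 16 \<and> y < 32"
| "wf_com d (WriteA k x y) \<longleftrightarrow> x < 32 \<and> k < 16 \<and> y < 32"
| "wf_com d (c1 ;; c2) \<longleftrightarrow> wf_com d c1 \<and> wf_com d c2"
| "wf_com d (IfZ x c1 c2) \<longleftrightarrow> x < 32 \<and> wf_com d c1 \<and> wf_com d c2"
| "wf_com d (For v x c) \<longleftrightarrow> v < 32 \<and> x < 32 \<and> 0 < d \<and> wf_com (d - 1) c"

definition represents :: "nat \<Rightarrow> state \<Rightarrow> (nat \<Rightarrow> nat) \<Rightarrow> bool" where
  "represents B \<sigma> m \<longleftrightarrow> m 2 = B \<and> (\<forall>x<32. m (8 + x) = fst \<sigma> x) \<and>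
     (\<forall>k<16. \<forall>i. m (B + 16 * i + k) = snd \<sigma> k i)"

lemma representsD:
  assumes "represents B \<sigma> m"
  shows "m 2 = B" "x < 32 \<Longrightarrow> m (8 + x) = fst \<sigma> x"
    "k < 16 \<Longrightarrow> m (B + 16 * i + k) = snd \<sigma> k i"
  using assms by (auto simp: represents_def)

lemma represents_scratch:
  assumes "represents B \<sigma> m" "48 \<le> B" "r \<noteq> 2" "r < 8 \<or> 40 \<le> r \<and> r < 48"
  shows "represents B \<sigma> (m(r := c))"
  using assms by (auto simp: represents_def)

lemma represents_setv:
  assumes "represents B \<sigma> m" "48 \<le> B" "x < 32"
  shows "represents B (setv x c \<sigma>) (m(8 + x := c))"
  using assms by (auto simp: represents_def)

text \<open>Interleaved addresses do not collide: relative to \<open>B\<close>, the array number is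
  the remainder modulo 16 and the position is the quotient. The stride is a power of two so that
  addresses can be formed by doubling.\<close>

lemma represents_seta:
  assumes "represents B \<sigma> m" "48 \<le> B" "k < 16"
  shows "represents B (seta k i c \<sigma>) (m(B + 16 * i + k := c))"
proof -
  have inj: "B + 16 * i' + k' = B + 16 * i + k \<longleftrightarrow> k' = k \<and> i' = i" if "k' < 16" for i' k'
  proof
    assume "B + 16 * i' + k' = B + 16 * i + k"
    then have eq: "16 * i' + k' = 16 * i + k" by simp
    from arg_cong[OF eq, of "\<lambda>n. n mod 16"] arg_cong[OF eq, of "\<lambda>n. n div 16"]
    show "k' = k \<and> i' = i" using that assms(3) by simp
  qed simp
  show ?thesis unfolding represents_def
  proof (intro conjI allI impI)
    show "(m(B + 16 * i + k := c)) 2 = B"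
      using assms by (simp add: represents_def)
    show "(m(B + 16 * i + k := c)) (8 + x) = fst (seta k i c \<sigma>) x" if "x < 32" for x
      using assms that by (simp add: represents_def)
    show "(m(B + 16 * i + k := c)) (B + 16 * i' + k') = snd (seta k i c \<sigma>) k' i'" if "k' < 16" for k' i'
      using assms(1) that unfolding fun_upd_apply inj[OF that] by (auto simp: represents_def)
  qed
qed

text \<open>Loops at depths below \<open>d\<close> are running while the code for depth \<open>d\<close> executes.\<close>

definition same_loops :: "nat \<Rightarrow> (nat \<Rightarrow> nat) \<Rightarrow> (nat \<Rightarrow> nat) \<Rightarrow> bool" where
  "same_loops d m m' \<longleftrightarrow> (\<forall>r. 40 \<le> r \<and> r < 40 + 2 * d \<longrightarrow> m' r = m r)"

lemma same_loops_refl [simp]: "same_loops d m m"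
  by (simp add: same_loops_def)

lemma same_loops_trans: "same_loops d m m' \<Longrightarrow> same_loops d m' m'' \<Longrightarrow> same_loops d m m''"
  by (simp add: same_loops_def)

lemma same_loops_upd:
  "same_loops d m m' \<Longrightarrow> r < 40 \<or> 40 + 2 * d \<le> r \<Longrightarrow> same_loops d m (m'(r := c))"
  by (auto simp: same_loops_def)

definition simulates :: "instr list \<Rightarrow> nat \<Rightarrow> com \<Rightarrow> nat \<Rightarrow> nat \<Rightarrow> bool" where
  "simulates P B c d i \<longleftrightarrow> (\<forall>\<sigma> m. represents B \<sigma> m \<longrightarrow>
     (\<exists>k m'. k \<le> tm c \<sigma> \<and> reach P k (i, m) (i + csize c, m') \<and>
        represents B (sem c \<sigma>) m' \<and> same_loops d m m'))"

lemma simulatesI: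
  assumes "\<And>\<sigma> m. represents B \<sigma> m \<Longrightarrow>
     \<exists>k m'. k \<le> tm c \<sigma> \<and> reach P k (i, m) (i + csize c, m') \<and>
        represents B (sem c \<sigma>) m' \<and> same_loops d m m'"
  shows "simulates P B c d i"
  using assms by (simp add: simulates_def)

lemma simulatesE:
  assumes "simulates P B c d i" "represents B \<sigma> m"
  obtains k m' where "k \<le> tm c \<sigma>" "reach P k (i, m) (i + csize c, m')"
    "represents B (sem c \<sigma>) m'" "same_loops d m m'"
  using assms unfolding simulates_def by blast

lemma addr_effect:
  assumes "represents B \<sigma> m" "48 \<le> B" "y < 32"
  obtains m' where "fold effect (addr_code k y) m = m'" "m' 0 = B + 16 * fst \<sigma> y + k"
    "represents B \<sigma> m'" "same_loops d m m'"
proof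
  note r = representsD[OF assms(1)]
  show "fold effect (addr_code k y) m 0 = B + 16 * fst \<sigma> y + k"
    using assms r(2)[of y] r(1) by (simp add: addr_code_def)
  show "represents B \<sigma> (fold effect (addr_code k y) m)"
    using assms by (auto simp: addr_code_def intro!: represents_scratch)
  show "same_loops d m (fold effect (addr_code k y) m)"
    by (auto simp: addr_code_def intro!: same_loops_upd)
qed auto

lemma straight_addr_code: "list_all is_straight (addr_code k y)"
  by (simp add: addr_code_def)

text \<open>\<open>code_at\<close> advances by \<open>Suc\<close>, whereas jump targets are written
  with numerals; these equations bring both to one form.\<close>

lemma nat_offsets:
  fixes i :: nat
  shows "i + 1 = Suc i" "i + 2 = Suc (Suc i)" "i + 3 = Suc (Suc (Suc i))"
    "i + 4 = Suc (Suc (Suc (Suc i)))" "i + 5 = Suc (Suc (Suc (Suc (Suc i))))"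
    "i + 6 = Suc (Suc (Suc (Suc (Suc (Suc i)))))"
    "i + 7 = Suc (Suc (Suc (Suc (Suc (Suc (Suc i))))))"
    "i + 9 = Suc (Suc (Suc (Suc (Suc (Suc (Suc (Suc (Suc i))))))))"
    "i + 10 = Suc (Suc (Suc (Suc (Suc (Suc (Suc (Suc (Suc (Suc i)))))))))"
    "i + 11 = Suc (Suc (Suc (Suc (Suc (Suc (Suc (Suc (Suc (Suc (Suc i))))))))))"
    "i + 13 = Suc (Suc (Suc (Suc (Suc (Suc (Suc (Suc (Suc (Suc (Suc (Suc (Suc i))))))))))))"
    "i + 14 = Suc (Suc (Suc (Suc (Suc (Suc (Suc (Suc (Suc (Suc (Suc (Suc (Suc (Suc i)))))))))))))"
  by simp_all

lemma simulates_ReadA: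
  assumes "48 \<le> B" "x < 32" "k < 16" "y < 32" "code_at P i (compile (ReadA x k y) d i)"
  shows "simulates P B (ReadA x k y) d i"
proof (rule simulatesI)
  fix \<sigma> m assume m: "represents B \<sigma> m"
  from addr_effect[OF m assms(1,4), of k d] obtain m' where
    m': "fold effect (addr_code k y) m = m'" "m' 0 = B + 16 * fst \<sigma> y + k"
    "represents B \<sigma> m'" "same_loops d m m'" .
  have "reach P 8 (i, m) (i + 8, m'(8 + x := m' (m' 0)))"
    by (rule reach_straight'[where xs = "compile (ReadA x k y) d i"])
      (use assms straight_addr_code m' in \<open>auto simp: addr_code_def\<close>)
  moreover have "m' (m' 0) = snd \<sigma> k (fst \<sigma> y)"
    using m' representsD(3)[OF m'(3) assms(3)] by simp
  ultimately show "\<exists>ka m'. ka \<le> tm (ReadA x k y) \<sigma> \<and>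
      reach P ka (i, m) (i + csize (ReadA x k y), m') \<and>
      represents B (sem (ReadA x k y) \<sigma>) m' \<and> same_loops d m m'"
    using represents_setv[OF m'(3) assms(1,2)] same_loops_upd[OF m'(4)] assms(2)
    by (intro exI[of _ 8] exI[of _ "m'(8 + x := m' (m' 0))"]) auto
qed

lemma simulates_WriteA:
  assumes "48 \<le> B" "x < 32" "k < 16" "y < 32" "code_at P i (compile (WriteA k x y) d i)"
    "d \<le> 4"
  shows "simulates P B (WriteA k x y) d i"
proof (rule simulatesI)
  fix \<sigma> m assume m: "represents B \<sigma> m"
  from addr_effect[OF m assms(1,2), of k d] obtain m' where
    m': "fold effect (addr_code k x) m = m'" "m' 0 = B + 16 * fst \<sigma> x + k"
    "represents B \<sigma> m'" "same_loops d m m'" .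
  have "reach P 8 (i, m) (i + 8, m'(m' 0 := m' (8 + y)))"
    by (rule reach_straight'[where xs = "compile (WriteA k x y) d i"])
      (use assms straight_addr_code m' in \<open>auto simp: addr_code_def\<close>)
  moreover have "m' (8 + y) = fst \<sigma> y" using representsD(2)[OF m'(3) assms(4)] .
  ultimately show "\<exists>ka m'. ka \<le> tm (WriteA k x y) \<sigma> \<and>
      reach P ka (i, m) (i + csize (WriteA k x y), m') \<and>
      represents B (sem (WriteA k x y) \<sigma>) m' \<and> same_loops d m m'"
    using represents_seta[OF m'(3) assms(1,3), of "fst \<sigma> x" "fst \<sigma> y"]
      same_loops_upd[OF m'(4), of "m' 0"] assms(1,6) m'(2)
    by (intro exI[of _ 8] exI[of _ "m'(m' 0 := m' (8 + y))"]) auto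
qed

lemma simulates_basic:
  assumes "48 \<le> B" "x < 32" "y < 32" "z < 32"
  shows "code_at P i (compile (SetC x c) d i) \<Longrightarrow> simulates P B (SetC x c) d i"
    and "code_at P i (compile (AddV x y z) d i) \<Longrightarrow> simulates P B (AddV x y z) d i"
    and "code_at P i (compile (SubV x y z) d i) \<Longrightarrow> simulates P B (SubV x y z) d i"
proof -
  have *: "simulates P B c d i"
    if "code_at P i [ins]" "is_straight ins" "csize c = 1" "\<And>\<sigma>. tm c \<sigma> = 1"
      "\<And>\<sigma> m. represents B \<sigma> m \<Longrightarrow> \<exists>e. effect ins m = m(8 + x := e) \<and> sem c \<sigma> = setv x e \<sigma>" for c ins
  proof (rule simulatesI)
    fix \<sigma> m assume m: "represents B \<sigma> m"
    from that(5)[OF m] obtain e where e: "effect ins m = m(8 + x := e)" "sem c \<sigma> = setv x e \<sigma>"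
      by blast
    have "reach P 1 (i, m) (i + 1, m(8 + x := e))"
      by (rule reach_straight'[where xs = "[ins]"]) (use that e in auto)
    then show "\<exists>k m'. k \<le> tm c \<sigma> \<and> reach P k (i, m) (i + csize c, m') \<and>
        represents B (sem c \<sigma>) m' \<and> same_loops d m m'"
      using represents_setv[OF m assms(1,2), of e] e that assms(2)
      by (intro exI[of _ 1] exI[of _ "m(8 + x := e)"]) (auto simp: same_loops_upd)
  qed
  show "simulates P B (SetC x c) d i" if "code_at P i (compile (SetC x c) d i)"
    by (rule *[where ins = "LoadC (8 + x) c"]) (use that in auto)
  show "simulates P B (AddV x y z) d i" if "code_at P i (compile (AddV x y z) d i)"
    by (rule *[where ins = "Add (8 + x) (8 + y) (8 + z)"])
      (use that assms in \<open>auto simp: represents_def\<close>)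
  show "simulates P B (SubV x y z) d i" if "code_at P i (compile (SubV x y z) d i)"
    by (rule *[where ins = "Sub (8 + x) (8 + y) (8 + z)"])
      (use that assms in \<open>auto simp: represents_def\<close>)
qed

lemma simulates_DivS:
  assumes "48 \<le> B" "x < 32" "y < 32" "z < 32" and code: "code_at P i (compile (DivS x y z) d i)"
  shows "simulates P B (DivS x y z) d i"
proof (rule simulatesI)
  fix \<sigma> m assume m: "represents B \<sigma> m"
  define a b where "a = fst \<sigma> y" and "b = fst \<sigma> z"
  have code: "code_at P i [LoadC 1 1, Add 3 (8 + z) 1, LoadC 4 0, Add 5 (8 + y) 4]"
    "code_at P (i + 4) [Add 6 5 1, Sub 6 6 3]" "code_at P (i + 6) [Jz 6 (i + 11)]"
    "code_at P (i + 7) [Sub 5 5 3, Add 4 4 1, LoadC 0 0]" "code_at P (i + 10) [Jz 0 (i + 4)]"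
    "code_at P (i + 11) [LoadC 0 0, Add (8 + x) 4 0]"
    using code by (simp_all add: nat_offsets)
  \<comment> \<open>\<open>q\<close> is the part of the quotient still to be collected; register 5
    holds what is left of the dividend and register 4 the number of subtractions so far.\<close>
  have loop: "\<exists>m'. reach P (3 + 7 * q) (i + 4, m1) (i + 11, m') \<and> represents B \<sigma> m' \<and>
      m' 4 = m1 4 + q \<and> same_loops d m1 m'"
    if "represents B \<sigma> m1" "m1 3 = Suc b" "m1 1 = 1" "q = m1 5 div Suc b" for q m1
    using that
  proof (induction q arbitrary: m1)
    case 0
    define m2 where "m2 = m1(6 := m1 5 + 1 - Suc b)"
    have "reach P 2 (i + 4, m1) (i + 6, m2)"
      by (rule reach_straight'[OF code(2)]) (use 0 in \<open>auto simp: m2_def\<close>)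
    moreover have "m1 5 < Suc b" using 0 by (simp add: div_eq_0_iff)
    then have "reach P 1 (i + 6, m2) (i + 11, m2)"
      by (intro reach_Jz[OF code(3)]) (auto simp: m2_def)
    ultimately have "reach P 3 (i + 4, m1) (i + 11, m2)" by (rule reach_trans') simp
    moreover have "represents B \<sigma> m2" "m2 4 = m1 4" "same_loops d m1 m2"
      using 0 assms by (auto simp: m2_def intro!: represents_scratch same_loops_upd)
    ultimately show ?case by (intro exI[of _ m2]) auto
  next
    case (Suc q)
    define m2 where "m2 = m1(6 := m1 5 + 1 - Suc b)"
    define m3 where "m3 = m2(5 := m1 5 - Suc b, 4 := m1 4 + 1, 0 := 0)"
    have "reach P 2 (i + 4, m1) (i + 6, m2)"
      by (rule reach_straight'[OF code(2)]) (use Suc.prems in \<open>auto simp: m2_def\<close>)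
    moreover have ge: "m1 5 \<ge> Suc b" using Suc.prems(4) by (metis Zero_not_Suc div_less not_less)
    then have "reach P 1 (i + 6, m2) (i + 7, m2)"
      by (intro reach_Jz[OF code(3)]) (auto simp: m2_def)
    ultimately have "reach P 3 (i + 4, m1) (i + 7, m2)" by (rule reach_trans') simp
    moreover have "reach P 3 (i + 7, m2) (i + 10, m3)"
      by (rule reach_straight'[OF code(4)]) (use Suc.prems in \<open>auto simp: m2_def m3_def\<close>)
    ultimately have "reach P 6 (i + 4, m1) (i + 10, m3)" by (rule reach_trans') simp
    moreover have "reach P 1 (i + 10, m3) (i + 4, m3)"
      by (intro reach_Jz[OF code(5)]) (auto simp: m3_def)
    ultimately have r: "reach P 7 (i + 4, m1) (i + 4, m3)" by (rule reach_trans') simp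
    have m3: "represents B \<sigma> m3" "m3 4 = Suc (m1 4)" "same_loops d m1 m3" "m3 3 = Suc b" "m3 1 = 1"
      using Suc.prems assms by (auto simp: m2_def m3_def intro!: represents_scratch same_loops_upd)
    have "q = m3 5 div Suc b"
      using ge Suc.prems(4) by (simp add: m3_def div_if[of "m1 5"])
    from Suc.IH[OF m3(1,4,5) this] obtain m' where
      m': "reach P (3 + 7 * q) (i + 4, m3) (i + 11, m')" "represents B \<sigma> m'"
      "m' 4 = m3 4 + q" "same_loops d m3 m'" by blast
    have "reach P (3 + 7 * Suc q) (i + 4, m1) (i + 11, m')"
      using r m'(1) by (rule reach_trans') simp
    then show ?case using m' m3(2) same_loops_trans[OF m3(3) m'(4)]
      by (intro exI[of _ m']) simp
  qed
  define m1 where "m1 = m(1 := 1, 3 := Suc b, 4 := 0, 5 := a)"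
  have r1: "reach P 4 (i, m) (i + 4, m1)"
    by (rule reach_straight'[OF code(1)])
      (use representsD(2)[OF m, of y] representsD(2)[OF m, of z] assms
        in \<open>auto simp: m1_def a_def b_def\<close>)
  have m1: "represents B \<sigma> m1" "same_loops d m m1"
    using m assms by (auto simp: m1_def intro!: represents_scratch same_loops_upd)
  then obtain m2 where m2: "reach P (3 + 7 * (a div Suc b)) (i + 4, m1) (i + 11, m2)"
    "represents B \<sigma> m2" "m2 4 = a div Suc b" "same_loops d m1 m2"
    using loop[of m1 "a div Suc b"] by (auto simp: m1_def)
  define m3 where "m3 = m2(0 := 0, 8 + x := a div Suc b)"
  have r2: "reach P 2 (i + 11, m2) (i + 13, m3)"
    by (rule reach_straight'[OF code(6)]) (use m2 in \<open>auto simp: m3_def\<close>)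
  have "reach P (9 + 7 * (a div Suc b)) (i, m) (i + 13, m3)"
    by (rule reach_trans'[OF reach_trans[OF r1 m2(1)] r2]) simp
  moreover have "represents B (sem (DivS x y z) \<sigma>) m3"
    using m2 assms by (auto simp: m3_def a_def b_def intro!: represents_setv represents_scratch)
  moreover have "same_loops d m m3"
    unfolding m3_def using m1 m2 assms by (intro same_loops_upd) (auto intro: same_loops_trans)
  ultimately show "\<exists>k m'. k \<le> tm (DivS x y z) \<sigma> \<and>
      reach P k (i, m) (i + csize (DivS x y z), m') \<and>
      represents B (sem (DivS x y z) \<sigma>) m' \<and> same_loops d m m'"
    by (intro exI[of _ "9 + 7 * (a div Suc b)"] exI[of _ m3]) (auto simp: a_def b_def)
qed

lemma simulates_Seq:
  assumes "simulates P B c1 d i" "simulates P B c2 d (i + csize c1)"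
  shows "simulates P B (c1 ;; c2) d i"
proof (rule simulatesI)
  fix \<sigma> m assume "represents B \<sigma> m"
  from simulatesE[OF assms(1) this] obtain k1 m1 where
    1: "k1 \<le> tm c1 \<sigma>" "reach P k1 (i, m) (i + csize c1, m1)"
    "represents B (sem c1 \<sigma>) m1" "same_loops d m m1" .
  from simulatesE[OF assms(2) this(3)] obtain k2 m2 where
    2: "k2 \<le> tm c2 (sem c1 \<sigma>)" "reach P k2 (i + csize c1, m1) (i + csize c1 + csize c2, m2)"
    "represents B (sem c2 (sem c1 \<sigma>)) m2" "same_loops d m1 m2" .
  show "\<exists>k m'. k \<le> tm (c1 ;; c2) \<sigma> \<and> reach P k (i, m) (i + csize (c1 ;; c2), m') \<and>
      represents B (sem (c1 ;; c2) \<sigma>) m' \<and> same_loops d m m'"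
    using 1 2 same_loops_trans[OF 1(4) 2(4)] reach_trans[OF 1(2) 2(2)]
    by (intro exI[of _ "k1 + k2"] exI[of _ m2]) (auto simp: add.assoc)
qed

lemma simulates_IfZ:
  assumes "48 \<le> B" "x < 32" and code: "code_at P i (compile (IfZ x c1 c2) d i)"
    and sim: "simulates P B c1 d (i + 3 + csize c2)" "simulates P B c2 d (i + 1)"
  shows "simulates P B (IfZ x c1 c2) d i"
proof (rule simulatesI)
  fix \<sigma> m assume m: "represents B \<sigma> m"
  let ?j = "i + 3 + csize c2" and ?e = "i + 3 + csize c2 + csize c1"
  have code: "code_at P i [Jz (8 + x) ?j]" "code_at P (i + 1 + csize c2) [LoadC 1 0]"
    "code_at P (i + 2 + csize c2) [Jz 1 ?e]"
    using code by (simp_all add: nat_offsets)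
  have x: "m (8 + x) = fst \<sigma> x" using representsD(2)[OF m assms(2)] .
  show "\<exists>k m'. k \<le> tm (IfZ x c1 c2) \<sigma> \<and> reach P k (i, m) (i + csize (IfZ x c1 c2), m') \<and>
      represents B (sem (IfZ x c1 c2) \<sigma>) m' \<and> same_loops d m m'"
  proof (cases "fst \<sigma> x = 0")
    case True
    have r: "reach P 1 (i, m) (?j, m)" by (rule reach_Jz[OF code(1)]) (use True x in simp)
    from simulatesE[OF sim(1) m] obtain k m' where
      "k \<le> tm c1 \<sigma>" "reach P k (?j, m) (?e, m')" "represents B (sem c1 \<sigma>) m'" "same_loops d m m'" .
    then show ?thesis using True reach_trans[OF r, of k]
      by (intro exI[of _ "1 + k"] exI[of _ m']) (auto simp: ac_simps)
  next
    case False
    have r: "reach P 1 (i, m) (i + 1, m)" by (rule reach_Jz[OF code(1)]) (use False x in simp)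
    from simulatesE[OF sim(2) m] obtain k m' where
      m': "k \<le> tm c2 \<sigma>" "reach P k (i + 1, m) (i + 1 + csize c2, m')"
      "represents B (sem c2 \<sigma>) m'" "same_loops d m m'" .
    define m'' where "m'' = m'(1 := 0)"
    have "reach P 1 (i + 1 + csize c2, m') (i + 2 + csize c2, m'')"
      by (rule reach_straight'[OF code(2)]) (auto simp: m''_def)
    moreover have "reach P 1 (i + 2 + csize c2, m'') (?e, m'')"
      by (rule reach_Jz[OF code(3)]) (auto simp: m''_def)
    ultimately have "reach P 2 (i + 1 + csize c2, m') (?e, m'')" by (rule reach_trans') simp
    from reach_trans[OF reach_trans[OF r m'(2)] this] have
      "reach P (1 + k + 2) (i, m) (?e, m'')" .
    moreover have "represents B (sem c2 \<sigma>) m''" "same_loops d m m''"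
      using m' assms by (auto simp: m''_def intro!: represents_scratch same_loops_upd)
    ultimately show ?thesis using False m'(1)
      by (intro exI[of _ "1 + k + 2"] exI[of _ m'']) (auto simp: ac_simps)
  qed
qed

text \<open>The index and the remaining count live in registers reserved for depth \<open>d\<close>,
  which the body preserves by \<open>same_loops\<close>. So the body may overwrite both
  \<open>v\<close> and \<open>x\<close>, just as in \<open>sem\<close>.\<close>

lemma simulates_For:
  assumes "48 \<le> B" "v < 32" "x < 32" "d < 4" and code: "code_at P i (compile (For v x c) d i)"
    and sim: "simulates P B c (Suc d) (i + 5)"
  shows "simulates P B (For v x c) d i"
proof (rule simulatesI)
  fix \<sigma> m assume m: "represents B \<sigma> m"
  let ?h = "40 + 2 * d" and ?h' = "41 + 2 * d" and ?e = "i + 10 + csize c"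
  let ?n = "fst \<sigma> x"
  let ?st = "\<lambda>k. fold (\<lambda>k \<tau>. sem c (setv v k \<tau>)) [0..<k] \<sigma>"
  let ?t = "\<lambda>k. 8 + tm c (setv v k (?st k))"
  have code: "code_at P i [LoadC ?h 0, Add ?h' (8 + x) ?h]" "code_at P (i + 2) [Jz ?h' ?e]"
    "code_at P (i + 3) [LoadC 1 0, Add (8 + v) ?h 1]"
    "code_at P (i + 5 + csize c) [LoadC 1 1, Add ?h ?h 1, Sub ?h' ?h' 1, LoadC 1 0]"
    "code_at P (i + 9 + csize c) [Jz 1 (i + 2)]"
    using code by (simp_all add: nat_offsets)
  have loop: "\<exists>k m'. k \<le> 1 + (\<Sum>l = j..<?n. ?t l) \<and> reach P k (i + 2, m1) (?e, m') \<and>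
      represents B (?st ?n) m' \<and> same_loops d m1 m'"
    if "represents B (?st j) m1" "m1 ?h = j" "m1 ?h' = ?n - j" "j \<le> ?n" for j m1
    using that
  proof (induction "?n - j" arbitrary: j m1)
    case 0
    then have "j = ?n" by simp
    moreover have "reach P 1 (i + 2, m1) (?e, m1)"
      by (rule reach_Jz[OF code(2)]) (use 0 in simp)
    ultimately show ?case using 0 by (intro exI[of _ 1] exI[of _ m1]) auto
  next
    case (Suc r)
    then have j: "j < ?n" by simp
    define m2 where "m2 = m1(1 := 0, 8 + v := j)"
    have "reach P 1 (i + 2, m1) (i + 3, m1)"
      by (rule reach_Jz[OF code(2)]) (use Suc.prems j in simp)
    moreover have "reach P 2 (i + 3, m1) (i + 5, m2)"
      by (rule reach_straight'[OF code(3)]) (use Suc.prems in \<open>auto simp: m2_def\<close>)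
    ultimately have r1: "reach P 3 (i + 2, m1) (i + 5, m2)" by (rule reach_trans') simp
    have m2: "represents B (setv v j (?st j)) m2" "same_loops (Suc d) m1 m2"
      using Suc.prems assms
      by (auto simp: m2_def intro!: represents_setv represents_scratch same_loops_upd)
    from simulatesE[OF sim m2(1)] obtain k m3 where
      m3: "k \<le> tm c (setv v j (?st j))" "reach P k (i + 5, m2) (i + 5 + csize c, m3)"
      "represents B (sem c (setv v j (?st j))) m3" "same_loops (Suc d) m2 m3" .
    have "same_loops (Suc d) m1 m3" using m2(2) m3(4) by (rule same_loops_trans)
    then have h: "m3 ?h = j" "m3 ?h' = ?n - j" "same_loops d m1 m3"
      using Suc.prems by (auto simp: same_loops_def)
    define m4 where "m4 = m3(1 := 0, ?h := Suc j, ?h' := ?n - Suc j)"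
    have "reach P 4 (i + 5 + csize c, m3) (i + 9 + csize c, m4)"
      by (rule reach_straight'[OF code(4)]) (use h in \<open>auto simp: m4_def fun_eq_iff\<close>)
    moreover have "reach P 1 (i + 9 + csize c, m4) (i + 2, m4)"
      by (rule reach_Jz[OF code(5)]) (auto simp: m4_def)
    ultimately have r2: "reach P 5 (i + 5 + csize c, m3) (i + 2, m4)"
      by (rule reach_trans') simp
    have m4: "represents B (?st (Suc j)) m4" "same_loops d m1 m4" "m4 ?h = Suc j"
      "m4 ?h' = ?n - Suc j"
      using m3 h assms by (auto simp: m4_def intro!: represents_scratch same_loops_upd)
    from Suc.hyps(2) j have "r = ?n - Suc j" "Suc j \<le> ?n" by simp_all
    from Suc.hyps(1)[OF this(1) m4(1,3,4) this(2)] obtain k' m' where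
      m': "k' \<le> 1 + (\<Sum>l = Suc j..<?n. ?t l)" "reach P k' (i + 2, m4) (?e, m')"
      "represents B (?st ?n) m'" "same_loops d m4 m'"
      by blast
    have "reach P (3 + k + 5 + k') (i + 2, m1) (?e, m')"
      using reach_trans[OF reach_trans[OF reach_trans[OF r1 m3(2)] r2] m'(2)] .
    moreover have "3 + k + 5 + k' \<le> 1 + (\<Sum>l = j..<?n. ?t l)"
      using m'(1) m3(1) by (simp add: sum.atLeast_Suc_lessThan[OF j])
    ultimately show ?case
      using m'(3) same_loops_trans[OF m4(2) m'(4)] by blast
  qed
  define m1 where "m1 = m(?h := 0, ?h' := ?n)"
  have r: "reach P 2 (i, m) (i + 2, m1)"
    by (rule reach_straight'[OF code(1)])
      (use representsD(2)[OF m assms(3)] assms in \<open>auto simp: m1_def\<close>)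
  have m1: "represents B (?st 0) m1" "same_loops d m m1" "m1 ?h = 0" "m1 ?h' = ?n - 0"
    using m assms by (auto simp: m1_def intro!: represents_scratch same_loops_upd)
  from loop[OF m1(1,3,4)] obtain k m' where
    "k \<le> 1 + (\<Sum>l = 0..<?n. ?t l)" "reach P k (i + 2, m1) (?e, m')"
    "represents B (?st ?n) m'" "same_loops d m1 m'" by auto
  then show "\<exists>k m'. k \<le> tm (For v x c) \<sigma> \<and> reach P k (i, m) (i + csize (For v x c), m') \<and>
      represents B (sem (For v x c) \<sigma>) m' \<and> same_loops d m m'"
    using reach_trans[OF r] same_loops_trans[OF m1(2)]
    by (intro exI[of _ "2 + k"] exI[of _ m']) (auto simp: ac_simps atLeast0LessThan)
qed

theorem simulates_compile:
  assumes "48 \<le> B" "wf_com (4 - d) c" "d \<le> 4" "code_at P i (compile c d i)"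
  shows "simulates P B c d i"
  using assms
proof (induction c arbitrary: d i)
  case (For v x c)
  have "simulates P B c (Suc d) (i + 5)"
    by (rule For.IH) (use For.prems in \<open>auto simp: nat_offsets\<close>)
  then show ?case using For.prems by (intro simulates_For) auto
next
  case (Seq c1 c2)
  then show ?case by (intro simulates_Seq) auto
next
  case (IfZ x c1 c2)
  then show ?case by (intro simulates_IfZ) (auto simp: nat_offsets)
next
  case (DivS x y z)
  then show ?case by (intro simulates_DivS) auto
next
  case (ReadA x k y)
  then show ?case by (intro simulates_ReadA) auto
next
  case (WriteA k x y)
  then show ?case by (intro simulates_WriteA) auto
qed (use simulates_basic in auto)

section \<open>Relocation of input and output\<close>

text \<open>The input occupies the low registers that compiled code needs, and the length of the
  input in register 0 is the only spare information. Doubling it six times yields an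
  address \<open>B\<close> beyond both the input and the 48 fixed registers, using no other register;
  the input is then spread out as array 0 above \<open>B\<close>. Dually, array 14 is finally copied to
  the addresses from 0 on; the last two registers to be filled are 1, whose value is
  required to be 0, and 0, which serves as the pointer until it overwrites itself.\<close>

definition prologue :: "instr list" where
  "prologue =
     ([Add 0 0 0, Add 0 0 0, Add 0 0 0, Add 0 0 0, Add 0 0 0, Add 0 0 0] @ [StoreI 0 1, LoadC 1 16] @
      concat (map (\<lambda>r. [Add 0 0 1, StoreI 0 r]) [2..<48]) @
      [LoadC 3 (16 * 46), Sub 2 0 3, LoadC 3 48, Sub 4 2 3]) @
     [Jz 4 113] @
     [Add 0 0 1, LoadI 5 3, StoreI 0 5, LoadC 5 1, Add 3 3 5, Sub 4 4 5, LoadC 5 0] @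
     [Jz 5 104]"

definition epilogue :: "nat \<Rightarrow> instr list" where
  "epilogue i =
     [LoadC 1 (16 * 48 + 14), Add 0 1 2, LoadC 1 16, LoadC 3 48, Sub 4 2 3] @
     [Jz 4 (i + 14)] @
     [LoadI 5 0, StoreI 3 5, LoadC 5 1, Add 3 3 5, Sub 4 4 5, Add 0 0 1, LoadC 5 0] @
     [Jz 5 (i + 5)] @
     ([LoadC 0 (16 * 47 + 14), Add 0 0 2] @
      concat (map (\<lambda>r. [LoadI r 0, Sub 0 0 1]) (rev [2..<48])) @
      [Sub 0 0 1, LoadI 0 0, LoadC 1 0]) @
     [Halt]"

definition machine :: "com \<Rightarrow> instr list" where
  "machine c = prologue @ compile c 0 113 @ epilogue (113 + csize c)"

definition input_arrays :: "nat list \<Rightarrow> nat \<Rightarrow> nat \<Rightarrow> nat" where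
  "input_arrays xs k i = (if k = 0 \<and> i < length xs then xs ! i else 0)"

text \<open>Memory after registers 1 to \<open>r\<close> have been copied to \<open>B\<close>,
  \<open>B + 16\<close>, and so on. Input word \<open>i\<close> starts in register
  \<open>i + 1\<close>, hence the \<open>Suc\<close>.\<close>

definition spread :: "(nat \<Rightarrow> nat) \<Rightarrow> nat \<Rightarrow> nat \<Rightarrow> nat \<Rightarrow> nat" where
  "spread m B r x = (if B \<le> x \<and> 16 dvd (x - B) \<and> (x - B) div 16 < r
     then m (Suc ((x - B) div 16)) else m x)"

lemma spread_upd: "(spread m B r)(B + 16 * r := m (Suc r)) = spread m B (Suc r)"
proof
  fix x
  show "((spread m B r)(B + 16 * r := m (Suc r))) x = spread m B (Suc r) x"
    by (auto simp: spread_def less_Suc_eq)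
qed

lemma spread_0: "spread m B 0 = m"
  by (simp add: spread_def fun_eq_iff)

lemma spread_low: "x < B \<Longrightarrow> spread m B r x = m x"
  by (simp add: spread_def)

lemma length_concat_map_const:
  "(\<And>x. length (f x) = n) \<Longrightarrow> length (concat (map f xs)) = n * length xs"
  by (induction xs) auto

lemma fold_effect_snoc:
  "fold effect (concat (map f (ys @ [y]))) m = fold effect (f y) (fold effect (concat (map f ys)) m)"
  by simp

text \<open>Registers 2 to 47 are each copied by an instruction that names them, since no register
  is free yet for a source pointer: 0 holds the target and 1 the stride.\<close>

lemma fold_spread:
  assumes "48 \<le> B" "2 + r \<le> 48"
  shows "fold effect (concat (map (\<lambda>r. [Add 0 0 1, StoreI 0 r]) [2..<2 + r]))
           ((spread m B 1)(0 := B, 1 := 16)) =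
         (spread m B (Suc r))(0 := B + 16 * r, 1 := 16)"
  using assms(2)
proof (induction r)
  case 0
  then show ?case by simp
next
  case (Suc r)
  have "[2..<2 + Suc r] = [2..<2 + r] @ [2 + r]" by simp
  moreover from Suc have IH: "fold effect (concat (map (\<lambda>r. [Add 0 0 1, StoreI 0 r]) [2..<2 + r]))
           ((spread m B 1)(0 := B, 1 := 16)) =
         (spread m B (Suc r))(0 := B + 16 * r, 1 := 16)" by linarith
  ultimately have "fold effect (concat (map (\<lambda>r. [Add 0 0 1, StoreI 0 r]) [2..<2 + Suc r]))
           ((spread m B 1)(0 := B, 1 := 16)) =
     fold effect [Add 0 0 1, StoreI 0 (2 + r)] ((spread m B (Suc r))(0 := B + 16 * r, 1 := 16))"
    by (simp only: fold_effect_snoc)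
  also have "\<dots> = ((spread m B (Suc r))(B + 16 * Suc r := m (Suc (Suc r))))(0 := B + 16 * Suc r, 1 := 16)"
    using assms(1) Suc.prems by (auto simp: fun_eq_iff spread_low)
  finally show ?case by (simp only: spread_upd)
qed

lemma straight_concat: "(\<And>x. list_all is_straight (f x)) \<Longrightarrow> list_all is_straight (concat (map f xs))"
  by (induction xs) auto

lemma prologue_correct:
  assumes "xs \<noteq> []" and code: "code_at P 0 prologue"
  defines "B \<equiv> 64 * length xs"
  obtains k m where "k \<le> 105 + 9 * B" "reach P k (ram_init xs) (113, m)"
    "represents B (\<lambda>x. m (8 + x), input_arrays xs) m"
proof -
  define m0 where "m0 = snd (ram_init xs)"
  have init: "ram_init xs = (0, m0)" by (simp add: m0_def ram_init_def)
  have B: "64 \<le> B" "length xs < B" using assms(1) by (cases xs; simp add: B_def)+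
  have m00: "m0 0 = length xs" by (simp add: m0_def ram_init_def)
  define c1 where "c1 = [Add 0 0 0, Add 0 0 0, Add 0 0 0, Add 0 0 0, Add 0 0 0, Add 0 0 0] @ [StoreI 0 1, LoadC 1 16] @
      concat (map (\<lambda>r. [Add 0 0 1, StoreI 0 r]) [2..<48]) @
      [LoadC 3 (16 * 46), Sub 2 0 3, LoadC 3 48, Sub 4 2 3]"
  define c2 where "c2 = [Add 0 0 1, LoadI 5 3, StoreI 0 5, LoadC 5 1, Add 3 3 5, Sub 4 4 5, LoadC 5 0]"
  have len: "length c1 = 104" unfolding c1_def
    by (simp add: length_concat_map_const[where n = 2] del: upt_rec_numeral)
  have peq: "prologue = c1 @ [Jz 4 113] @ c2 @ [Jz 5 104]"
    by (simp only: prologue_def c1_def c2_def append_assoc)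
  have code: "code_at P 0 c1" "code_at P 104 [Jz 4 113]" "code_at P 105 c2"
    "code_at P 112 [Jz 5 104]"
    using code unfolding peq using len by (simp_all add: c2_def)
  have "fold effect ([Add 0 0 0, Add 0 0 0, Add 0 0 0, Add 0 0 0, Add 0 0 0, Add 0 0 0] @ [StoreI 0 1, LoadC 1 16]) m0 =
      (spread m0 B 1)(0 := B, 1 := 16)"
  proof -
    have e1: "fold effect ([Add 0 0 0, Add 0 0 0, Add 0 0 0, Add 0 0 0, Add 0 0 0, Add 0 0 0]) m0 = m0(0 := B)"
      by (simp add: m00 B_def fun_eq_iff)
    have e2: "spread m0 B 1 = m0(B := m0 1)"
      using spread_upd[of m0 B 0] by (simp add: spread_0)
    show ?thesis unfolding fold_append o_apply e1 e2 using B by (simp add: fun_eq_iff)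
  qed
  moreover have "fold effect (concat (map (\<lambda>r. [Add 0 0 1, StoreI 0 r]) [2..<48]))
      ((spread m0 B 1)(0 := B, 1 := 16)) = (spread m0 B 47)(0 := B + 16 * 46, 1 := 16)"
    using fold_spread[of B 46 m0] B by (simp del: upt_rec_numeral)
  ultimately have "fold effect c1 m0 =
      fold effect [LoadC 3 (16 * 46), Sub 2 0 3, LoadC 3 48, Sub 4 2 3]
        ((spread m0 B 47)(0 := B + 16 * 46, 1 := 16))"
    by (simp only: c1_def fold_append o_apply)
  also have "\<dots> = (spread m0 B 47)(0 := B + 16 * 46, 1 := 16, 2 := B, 3 := 48, 4 := B - 48)"
    by (auto simp: fun_eq_iff)
  finally have m1: "fold effect c1 m0 =
      (spread m0 B 47)(0 := B + 16 * 46, 1 := 16, 2 := B, 3 := 48, 4 := B - 48)" .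
  \<comment> \<open>\<open>t\<close> copies remain, the next one from register \<open>B - t\<close>.
    Sources lie below \<open>B\<close> and targets at or above it, so no source is destroyed.
    Copying all registers up to \<open>B - 1\<close> is harmless: those behind the input are
    0.\<close>
  have loop: "\<exists>m'. reach P (1 + 9 * t) (104, m) (113, m') \<and> m' 2 = B \<and>
      (\<forall>x\<ge>48. m' x = spread m0 B (B - 1) x)"
    if "m 0 = B + 16 * (B - 2 - t)" "m 1 = 16" "m 2 = B" "m 3 = B - t" "m 4 = t" "t \<le> B - 48"
      "\<forall>x\<ge>48. m x = spread m0 B (B - 1 - t) x" for t m
    using that
  proof (induction t arbitrary: m)
    case 0
    have "reach P 1 (104, m) (113, m)" by (rule reach_Jz[OF code(2)]) (use 0 in auto)
    then show ?case using 0 by auto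
  next
    case (Suc t)
    define m' where "m' = m(0 := B + 16 * (B - 2 - t), B + 16 * (B - 2 - t) := m0 (B - Suc t),
        3 := B - t, 4 := t, 5 := 0)"
    have "m (B - Suc t) = m0 (B - Suc t)"
      using Suc.prems by (auto simp: spread_low)
    moreover have eq: "B - 2 - t = Suc (B - 2 - Suc t)" "B - t = Suc (B - Suc t)"
      "B - Suc t \<ge> 48" "B - Suc t < B" "B - Suc t = Suc (B - 2 - t)" "B - 1 - Suc t = B - 2 - t"
      "B - 1 - t = Suc (B - 2 - t)"
      using Suc.prems(6) B by linarith+
    ultimately have "fold effect c2 m = m'"
      using Suc.prems(1-5) B unfolding c2_def m'_def by (auto simp: fun_eq_iff)
    then have "reach P 7 (105, m) (112, m')"
      by (intro reach_straight'[OF code(3)]) (auto simp: c2_def)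
    moreover have "reach P 1 (104, m) (105, m)"
      by (rule reach_Jz[OF code(2)]) (use Suc.prems in auto)
    ultimately have "reach P 8 (104, m) (112, m')" by (auto intro: reach_trans')
    moreover have "reach P 1 (112, m') (104, m')"
      by (rule reach_Jz[OF code(4)]) (auto simp: m'_def)
    ultimately have r: "reach P 9 (104, m) (104, m')" by (auto intro: reach_trans')
    have "m' x = spread m0 B (B - 1 - t) x" if "x \<ge> 48" for x
    proof -
      have "m' x = ((spread m0 B (B - 2 - t))(B + 16 * (B - 2 - t) := m0 (Suc (B - 2 - t)))) x"
        using Suc.prems(7) that eq(5,6) by (auto simp: m'_def)
      then show ?thesis unfolding spread_upd eq(7) .
    qed
    then have "\<exists>m''. reach P (1 + 9 * t) (104, m') (113, m'') \<and> m'' 2 = B \<and>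
      (\<forall>x\<ge>48. m'' x = spread m0 B (B - 1) x)"
      using Suc.prems B by (intro Suc.IH) (auto simp: m'_def)
    then obtain m'' where m'': "reach P (1 + 9 * t) (104, m') (113, m'')" "m'' 2 = B"
      "\<forall>x\<ge>48. m'' x = spread m0 B (B - 1) x" by blast
    have "reach P (1 + 9 * Suc t) (104, m) (113, m'')"
      using r m''(1) by (rule reach_trans') simp
    then show ?case using m'' by blast
  qed
  have "\<exists>m'. reach P (1 + 9 * (B - 48)) (104, fold effect c1 m0) (113, m') \<and> m' 2 = B \<and>
      (\<forall>x\<ge>48. m' x = spread m0 B (B - 1) x)"
    by (rule loop) (use B in \<open>auto simp: m1\<close>)
  then obtain m where m: "reach P (1 + 9 * (B - 48)) (104, fold effect c1 m0) (113, m)" "m 2 = B"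
      "\<forall>x\<ge>48. m x = spread m0 B (B - 1) x" by blast
  have "reach P 104 (0, m0) (104, fold effect c1 m0)"
  proof (rule reach_straight'[OF code(1)])
    show "list_all is_straight c1"
      by (simp add: c1_def straight_concat del: upt_rec_numeral)
  qed (simp_all add: len)
  from reach_trans[OF this m(1)] have "reach P (104 + (1 + 9 * (B - 48))) (ram_init xs) (113, m)"
    by (simp add: init)
  moreover have "represents B (\<lambda>x. m (8 + x), input_arrays xs) m"
  proof -
    have "m (B + 16 * i + k) = input_arrays xs k i" if "k < 16" for k i
    proof -
      have x: "m (B + 16 * i + k) = spread m0 B (B - 1) (B + 16 * i + k)"
        using m(3) B by simp
      \<comment> \<open>The input ends below \<open>B\<close>, so the heap is blank at the start and
        all arrays other than the input array begin as 0.\<close>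
      have z: "m0 y = 0" if "y \<ge> B" for y using that B by (simp add: m0_def ram_init_def)
      show ?thesis
      proof (cases "k = 0")
        case True
        have "m0 (Suc i) = (if i < length xs then xs ! i else 0)"
          by (simp add: m0_def ram_init_def)
        then show ?thesis using x B z[of "B + 16 * i"] True
          by (auto simp: spread_def input_arrays_def)
      next
        case False
        then have "\<not> 16 dvd (16 * i + k)" using that
          by (metis dvd_add_right_iff dvd_imp_le dvd_triv_left not_gr_zero not_less)
        then show ?thesis using x False z[of "B + 16 * i + k"]
          by (auto simp: spread_def input_arrays_def)
      qed
    qed
    then show ?thesis using m(2) by (simp add: represents_def)
  qed
  ultimately show thesis using B by (intro that) auto
qed

text \<open>Registers from 48 on are filled by a loop while the low ones still hold pointers and
  counters. Then 47 down to 2 are filled by one load each, which needs only the pointer in 0 and the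
  stride in 1.\<close>

lemma epilogue_correct:
  assumes code: "code_at P i (epilogue i)" and "48 \<le> B" "represents B \<sigma> m"
  obtains k m' where "k \<le> 105 + 9 * B" "reach P k (i, m) (i + 111, m')" "ram_step P (i + 111, m') = None"
    "m' 0 = snd \<sigma> 14 0" "m' 1 = 0" "\<And>x. 2 \<le> x \<Longrightarrow> x < B \<Longrightarrow> m' x = snd \<sigma> 14 x"
proof -
  define out where "out = snd \<sigma> 14"
  define c1 where "c1 = [LoadC 1 (16 * 48 + 14), Add 0 1 2, LoadC 1 16, LoadC 3 48, Sub 4 2 3]"
  define c2 where "c2 = [LoadI 5 0, StoreI 3 5, LoadC 5 1, Add 3 3 5, Sub 4 4 5, Add 0 0 1, LoadC 5 0]"
  define c3 where "c3 = [LoadC 0 (16 * 47 + 14), Add 0 0 2] @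
      concat (map (\<lambda>r. [LoadI r 0, Sub 0 0 1]) (rev [2..<48])) @
      [Sub 0 0 1, LoadI 0 0, LoadC 1 0]"
  have len: "length c3 = 97" unfolding c3_def
    by (simp add: length_concat_map_const[where n = 2] del: upt_rec_numeral)
  have peq: "epilogue i = c1 @ [Jz 4 (i + 14)] @ c2 @ [Jz 5 (i + 5)] @ c3 @ [Halt]"
    by (simp only: epilogue_def c1_def c2_def c3_def append_assoc)
  have code: "code_at P i c1" "code_at P (i + 5) [Jz 4 (i + 14)]" "code_at P (i + 6) c2"
    "code_at P (i + 13) [Jz 5 (i + 5)]" "code_at P (i + 14) c3" "code_at P (i + 111) [Halt]"
    using code unfolding peq using len by (simp_all add: c2_def c1_def nat_offsets add.commute[of i 111])
  have arr: "m (B + 16 * x + 14) = out x" for x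
    using assms(3) by (simp add: represents_def out_def)
  have loop: "\<exists>m'. reach P (1 + 9 * t) (i + 5, m1) (i + 14, m') \<and> m' 1 = 16 \<and> m' 2 = B \<and>
      (\<forall>x. 48 \<le> x \<and> x < B \<longrightarrow> m' x = out x) \<and> (\<forall>x. m' (B + 16 * x + 14) = out x)"
    if "m1 0 = B + 16 * (B - t) + 14" "m1 1 = 16" "m1 2 = B" "m1 3 = B - t" "m1 4 = t" "t \<le> B - 48"
      "\<forall>x. 48 \<le> x \<and> x < B - t \<longrightarrow> m1 x = out x" "\<forall>x. m1 (B + 16 * x + 14) = out x" for t m1
    using that
  proof (induction t arbitrary: m1)
    case 0
    have "reach P 1 (i + 5, m1) (i + 14, m1)" by (rule reach_Jz[OF code(2)]) (use 0 in auto)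
    then show ?case using 0 by auto
  next
    case (Suc t)
    define m2 where "m2 = m1(B - Suc t := out (B - Suc t), 0 := B + 16 * (B - t) + 14,
        3 := B - t, 4 := t, 5 := 0)"
    have eq: "B - t = Suc (B - Suc t)" "B - Suc t \<ge> 48"
      using Suc.prems(6) assms(2) by linarith+
    have "fold effect c2 m1 = m2"
      using Suc.prems(1-5) Suc.prems(8) assms(2) eq unfolding c2_def m2_def
      by (auto simp: fun_eq_iff)
    then have "reach P 7 (i + 6, m1) (i + 13, m2)"
      by (intro reach_straight'[OF code(3)]) (auto simp: c2_def)
    moreover have "reach P 1 (i + 5, m1) (i + 6, m1)"
      by (rule reach_Jz[OF code(2)]) (use Suc.prems in auto)
    ultimately have "reach P 8 (i + 5, m1) (i + 13, m2)" by (auto intro: reach_trans')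
    moreover have "reach P 1 (i + 13, m2) (i + 5, m2)"
      by (rule reach_Jz[OF code(4)]) (auto simp: m2_def)
    ultimately have r: "reach P 9 (i + 5, m1) (i + 5, m2)" by (auto intro: reach_trans')
    have "\<exists>m'. reach P (1 + 9 * t) (i + 5, m2) (i + 14, m') \<and> m' 1 = 16 \<and> m' 2 = B \<and>
      (\<forall>x. 48 \<le> x \<and> x < B \<longrightarrow> m' x = out x) \<and> (\<forall>x. m' (B + 16 * x + 14) = out x)"
    proof (rule Suc.IH)
      show "\<forall>x. 48 \<le> x \<and> x < B - t \<longrightarrow> m2 x = out x"
        using Suc.prems(7) eq by (auto simp: m2_def less_Suc_eq)
      show "\<forall>x. m2 (B + 16 * x + 14) = out x"
      proof
        fix x
        have "B + 16 * x + 14 \<noteq> B - Suc t" "B + 16 * x + 14 > 48" using assms(2) by linarith+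
        then show "m2 (B + 16 * x + 14) = out x" using Suc.prems(8) by (simp add: m2_def)
      qed
    qed (use Suc.prems eq in \<open>auto simp: m2_def\<close>)
    then obtain m3 where m3: "reach P (1 + 9 * t) (i + 5, m2) (i + 14, m3)" "m3 1 = 16" "m3 2 = B"
      "\<forall>x. 48 \<le> x \<and> x < B \<longrightarrow> m3 x = out x" "\<forall>x. m3 (B + 16 * x + 14) = out x" by blast
    have "reach P (1 + 9 * Suc t) (i + 5, m1) (i + 14, m3)"
      using r m3(1) by (rule reach_trans') simp
    then show ?case using m3 by blast
  qed
  define m1 where "m1 = m(0 := B + 16 * 48 + 14, 1 := 16, 3 := 48, 4 := B - 48)"
  have m12: "m 2 = B" using assms(3) by (simp add: represents_def)
  have r1: "reach P 5 (i, m) (i + 5, m1)"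
    by (rule reach_straight'[OF code(1)]) (use m12 in \<open>auto simp: c1_def m1_def fun_eq_iff\<close>)
  have "\<exists>m'. reach P (1 + 9 * (B - 48)) (i + 5, m1) (i + 14, m') \<and> m' 1 = 16 \<and> m' 2 = B \<and>
      (\<forall>x. 48 \<le> x \<and> x < B \<longrightarrow> m' x = out x) \<and> (\<forall>x. m' (B + 16 * x + 14) = out x)"
    by (rule loop) (use assms(2) m12 arr in \<open>auto simp: m1_def\<close>)
  then obtain m2 where m2: "reach P (1 + 9 * (B - 48)) (i + 5, m1) (i + 14, m2)" "m2 1 = 16" "m2 2 = B"
    "\<And>x. 48 \<le> x \<Longrightarrow> x < B \<Longrightarrow> m2 x = out x" "\<And>x. m2 (B + 16 * x + 14) = out x" by blast
  \<comment> \<open>Downward induction on the last register filled. The sources lie at or above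
    \<open>B\<close>, so they survive all the loads.\<close>
  have chain: "fold effect (concat (map (\<lambda>r. [LoadI r 0, Sub 0 0 1]) (rev [s..<48]))) m3 =
      (\<lambda>x. if x = 0 then B + 16 * (s - 1) + 14 else if s \<le> x \<and> x < 48 then out x else m3 x)"
    if "2 \<le> s" "s \<le> 48" "m3 0 = B + 16 * 47 + 14" "m3 1 = 16" "\<And>x. m3 (B + 16 * x + 14) = out x"
    for s m3
    using that(2,1)
  proof (induction s rule: inc_induct)
    case base
    then show ?case using that(3) by auto
  next
    case (step s)
    let ?m = "\<lambda>x. if x = 0 then B + 16 * (Suc s - 1) + 14 else if Suc s \<le> x \<and> x < 48 then out x else m3 x"
    have "rev [s..<48] = rev [Suc s..<48] @ [s]"
      using step.hyps by (simp add: upt_conv_Cons)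
    then have "fold effect (concat (map (\<lambda>r. [LoadI r 0, Sub 0 0 1]) (rev [s..<48]))) m3 =
       fold effect [LoadI s 0, Sub 0 0 1] ?m"
      using step.IH step.prems by (simp del: upt_rec_numeral)
    also have "\<dots> = (\<lambda>x. if x = 0 then B + 16 * (s - 1) + 14 else if s \<le> x \<and> x < 48 then out x else m3 x)"
    proof -
      have "?m (?m 0) = out s" using that(5)[of s] assms(2) by simp
      moreover have "?m 1 = 16" using step.prems that(4) by simp
      moreover have "16 * s + 14 - 16 = 16 * (s - 1) + 14" using step.prems by simp
      ultimately show ?thesis using step.prems step.hyps
        by (auto simp: fun_eq_iff)
    qed
    finally show ?case .
  qed
  define m3 where "m3 = m2(0 := B + 16 * 47 + 14)"
  have ch: "fold effect (concat (map (\<lambda>r. [LoadI r 0, Sub 0 0 1]) (rev [2..<48]))) m3 =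
      (\<lambda>x. if x = 0 then B + 16 * (2 - 1) + 14 else if 2 \<le> x \<and> x < 48 then out x else m3 x)"
    by (rule chain) (use m2 in \<open>auto simp: m3_def\<close>)
  define m4 where "m4 = (\<lambda>x. if x = 0 then out 0 else if x = 1 then 0
      else if x < 48 then out x else m2 x)"
  have "fold effect [LoadC 0 (16 * 47 + 14), Add 0 0 2] m2 = m3"
    using m2(3) by (auto simp: m3_def)
  then have "fold effect c3 m2 = fold effect [Sub 0 0 1, LoadI 0 0, LoadC 1 0]
      (\<lambda>x. if x = 0 then B + 16 * (2 - 1) + 14 else if 2 \<le> x \<and> x < 48 then out x else m3 x)"
    by (simp only: c3_def fold_append o_apply ch)
  also have "\<dots> = m4"
    using m2(2) m2(5)[of 0] assms(2) by (auto simp: m3_def m4_def fun_eq_iff add.commute[of B 14])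
  finally have "reach P 97 (i + 14, m2) (i + 111, m4)"
  proof (intro reach_straight'[OF code(5)])
    show "list_all is_straight c3"
      by (simp add: c3_def straight_concat del: upt_rec_numeral)
  qed (simp_all add: len)
  from reach_trans[OF reach_trans[OF r1 m2(1)] this]
  have "reach P (5 + (1 + 9 * (B - 48)) + 97) (i, m) (i + 111, m4)" .
  moreover have "ram_step P (i + 111, m4) = None" using code(6) by (simp add: ram_step_def)
  moreover have "m4 x = out x" if "2 \<le> x" "x < B" for x
    using that m2(4)[of x] by (auto simp: m4_def)
  ultimately show thesis
    by (intro that[of _ m4]) (auto simp: m4_def out_def)
qed

text \<open>\<open>s\<close> is whatever the prologue leaves in the scalar registers, so a program
  has to initialise its scalars; only the arrays are known. The output has to end below the heap
  base \<open>64 * length xs\<close>, and its first word is 0 because the source always runs on the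
  server. The extra steps are twice \<open>105 + 9 * B\<close>.\<close>

theorem machine_correct:
  assumes "wf_com 4 c" "xs \<noteq> []"
  obtains s where "\<And>\<sigma>. \<sigma> = sem c (s, input_arrays xs) \<Longrightarrow>
    snd \<sigma> 14 0 < 64 * length xs \<Longrightarrow> snd \<sigma> 14 1 = 0 \<Longrightarrow>
    \<exists>k cf. k \<le> tm c (s, input_arrays xs) + (210 + 1152 * length xs) \<and>
      reach (machine c) k (ram_init xs) cf \<and> ram_step (machine c) cf = None \<and>
      ram_output cf = map (\<lambda>i. snd \<sigma> 14 (Suc i)) [0..<snd \<sigma> 14 0]"
proof -
  let ?P = "machine c"
  define B where "B = 64 * length xs"
  have B: "48 \<le> B" using assms(2) by (cases xs) (auto simp: B_def)
  have len: "length prologue = 113"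
    by (simp add: prologue_def length_concat_map_const[where n = 2] del: upt_rec_numeral)
  have code: "code_at ?P 0 prologue" "code_at ?P 113 (compile c 0 113)"
    "code_at ?P (113 + csize c) (epilogue (113 + csize c))"
    using code_at_middle[of "[]" prologue] code_at_middle[of prologue "compile c 0 113"]
      code_at_middle[of "prologue @ compile c 0 113" "epilogue (113 + csize c)" "[]"]
    by (simp_all add: machine_def len del: code_at_append)
  obtain k1 m1 where 1: "k1 \<le> 105 + 9 * B" "reach ?P k1 (ram_init xs) (113, m1)"
    "represents B (\<lambda>x. m1 (8 + x), input_arrays xs) m1"
    using prologue_correct[OF assms(2) code(1)] unfolding B_def .
  define s where "s = (\<lambda>x. m1 (8 + x))"
  have "simulates ?P B c 0 113" using B assms code(2) by (intro simulates_compile) auto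
  from simulatesE[OF this 1(3)] obtain k2 m2 where
    2: "k2 \<le> tm c (s, input_arrays xs)" "reach ?P k2 (113, m1) (113 + csize c, m2)"
    "represents B (sem c (s, input_arrays xs)) m2" unfolding s_def .
  obtain k3 m3 where 3: "k3 \<le> 105 + 9 * B"
    "reach ?P k3 (113 + csize c, m2) (113 + csize c + 111, m3)"
    "ram_step ?P (113 + csize c + 111, m3) = None"
    "m3 0 = snd (sem c (s, input_arrays xs)) 14 0" "m3 1 = 0"
    "\<And>x. 2 \<le> x \<Longrightarrow> x < B \<Longrightarrow> m3 x = snd (sem c (s, input_arrays xs)) 14 x"
    using epilogue_correct[OF code(3) B 2(3)] by blast
  show thesis
  proof (rule that[of s])
    fix \<sigma> assume \<sigma>: "\<sigma> = sem c (s, input_arrays xs)" "snd \<sigma> 14 0 < 64 * length xs" "snd \<sigma> 14 1 = 0"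
    have "m3 (Suc i) = snd \<sigma> 14 (Suc i)" if "i < snd \<sigma> 14 0" for i
      using that \<sigma> 3(5,6) by (cases i) (auto simp: B_def)
    then have "ram_output (113 + csize c + 111, m3) = map (\<lambda>i. snd \<sigma> 14 (Suc i)) [0..<snd \<sigma> 14 0]"
      using 3(4) \<sigma>(1) by (simp add: ram_output_def)
    then show "\<exists>k cf. k \<le> tm c (s, input_arrays xs) + (210 + 1152 * length xs) \<and>
      reach ?P k (ram_init xs) cf \<and> ram_step ?P cf = None \<and>
      ram_output cf = map (\<lambda>i. snd \<sigma> 14 (Suc i)) [0..<snd \<sigma> 14 0]"
      using reach_trans[OF reach_trans[OF 1(2) 2(2)] 3(2)] 3(3) 1(1) 2(1) 3(1)
      by (intro exI[of _ "k1 + k2 + k3"] exI[of _ "(113 + csize c + 111, m3)"]) (auto simp: B_def)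
  qed
qed

section \<open>Frames, loop invariants and running time\<close>

primrec vars_written :: "com \<Rightarrow> nat set" where
  "vars_written (SetC x c) = {x}"
| "vars_written (AddV x y z) = {x}"
| "vars_written (SubV x y z) = {x}"
| "vars_written (DivS x y z) = {x}"
| "vars_written (ReadA x k y) = {x}"
| "vars_written (WriteA k x y) = {}"
| "vars_written (c1 ;; c2) = vars_written c1 \<union> vars_written c2"
| "vars_written (IfZ x c1 c2) = vars_written c1 \<union> vars_written c2"
| "vars_written (For v x c) = insert v (vars_written c)"

primrec arrs_written :: "com \<Rightarrow> nat set" where
  "arrs_written (SetC x c) = {}"
| "arrs_written (AddV x y z) = {}"
| "arrs_written (SubV x y z) = {}"
| "arrs_written (DivS x y z) = {}"
| "arrs_written (ReadA x k y) = {}"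
| "arrs_written (WriteA k x y) = {k}"
| "arrs_written (c1 ;; c2) = arrs_written c1 \<union> arrs_written c2"
| "arrs_written (IfZ x c1 c2) = arrs_written c1 \<union> arrs_written c2"
| "arrs_written (For v x c) = arrs_written c"

definition agree :: "com \<Rightarrow> state \<Rightarrow> state \<Rightarrow> bool" where
  "agree c \<sigma> \<tau> \<longleftrightarrow> (\<forall>x. x \<notin> vars_written c \<longrightarrow> fst \<tau> x = fst \<sigma> x) \<and>
     (\<forall>k. k \<notin> arrs_written c \<longrightarrow> snd \<tau> k = snd \<sigma> k)"

lemma agreeD:
  assumes "agree c \<sigma> \<tau>"
  shows "x \<notin> vars_written c \<Longrightarrow> fst \<tau> x = fst \<sigma> x" "k \<notin> arrs_written c \<Longrightarrow> snd \<tau> k = snd \<sigma> k"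
  using assms by (auto simp: agree_def)

lemma agree_fold:
  assumes "\<And>\<sigma>. agree c \<sigma> (sem c \<sigma>)"
  shows "agree (For v x c) \<sigma> (fold (\<lambda>k \<tau>. sem c (setv v k \<tau>)) ks \<sigma>)"
proof (induction ks arbitrary: \<sigma>)
  case (Cons k ks)
  have "agree (For v x c) \<sigma> (sem c (setv v k \<sigma>))"
    using assms[of "setv v k \<sigma>"] by (auto simp: agree_def)
  then show ?case using Cons.IH[of "sem c (setv v k \<sigma>)"] by (simp add: agree_def)
qed (simp add: agree_def)

lemma agree_sem: "agree c \<sigma> (sem c \<sigma>)"
proof (induction c arbitrary: \<sigma>)
  case (Seq c1 c2)
  show ?case using Seq.IH(1)[of \<sigma>] Seq.IH(2)[of "sem c1 \<sigma>"] by (simp add: agree_def)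
next
  case (IfZ x c1 c2)
  then show ?case by (simp add: agree_def)
next
  case (For v x c)
  then show ?case using agree_fold[of c v x] by simp
qed (auto simp: agree_def)

lemma sem_frame:
  "x \<notin> vars_written c \<Longrightarrow> fst (sem c \<sigma>) x = fst \<sigma> x"
  "k \<notin> arrs_written c \<Longrightarrow> snd (sem c \<sigma>) k = snd \<sigma> k"
  using agree_sem[of c \<sigma>] by (auto simp: agree_def)

text \<open>The step case may also assume \<open>agree\<close>, so an invariant has to mention only
  what the loop changes; everything else is inherited from \<open>\<sigma>\<close>.\<close>

lemma For_rule:
  assumes "I 0 \<sigma>"
    and "\<And>k \<tau>. k < fst \<sigma> x \<Longrightarrow> agree (For v x c) \<sigma> \<tau> \<Longrightarrow> I k \<tau> \<Longrightarrow>
       I (Suc k) (sem c (setv v k \<tau>))"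
  shows "I (fst \<sigma> x) (sem (For v x c) \<sigma>)"
proof -
  have "I n (fold (\<lambda>k \<tau>. sem c (setv v k \<tau>)) [0..<n] \<sigma>)" if "n \<le> fst \<sigma> x" for n
    using that
  proof (induction n)
    case (Suc n)
    then have "I n (fold (\<lambda>k \<tau>. sem c (setv v k \<tau>)) [0..<n] \<sigma>)" by simp
    with assms(2)[of n] Suc.prems agree_fold[OF agree_sem, where v = v and x = x and c = c and ks = "[0..<n]" and \<sigma> = \<sigma>]
    show ?case by simp
  qed (use assms(1) in simp)
  then show ?thesis by simp
qed

text \<open>\<open>L\<close> collects the variables allowed as loop limits; none of them may be
  assigned. Division is excluded because its time depends on values rather than on limits.\<close>

primrec fixed_limits :: "nat set \<Rightarrow> com \<Rightarrow> bool" where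
  "fixed_limits L (SetC x c) \<longleftrightarrow> x \<notin> L"
| "fixed_limits L (AddV x y z) \<longleftrightarrow> x \<notin> L"
| "fixed_limits L (SubV x y z) \<longleftrightarrow> x \<notin> L"
| "fixed_limits L (DivS x y z) \<longleftrightarrow> False"
| "fixed_limits L (ReadA x k y) \<longleftrightarrow> x \<notin> L"
| "fixed_limits L (WriteA k x y) \<longleftrightarrow> True"
| "fixed_limits L (c1 ;; c2) \<longleftrightarrow> fixed_limits L c1 \<and> fixed_limits L c2"
| "fixed_limits L (IfZ x c1 c2) \<longleftrightarrow> fixed_limits L c1 \<and> fixed_limits L c2"
| "fixed_limits L (For v x c) \<longleftrightarrow> x \<in> L \<and> v \<notin> L \<and> fixed_limits L c"

primrec loop_depth :: "com \<Rightarrow> nat" where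
  "loop_depth (SetC x c) = 0"
| "loop_depth (AddV x y z) = 0"
| "loop_depth (SubV x y z) = 0"
| "loop_depth (DivS x y z) = 0"
| "loop_depth (ReadA x k y) = 0"
| "loop_depth (WriteA k x y) = 0"
| "loop_depth (c1 ;; c2) = max (loop_depth c1) (loop_depth c2)"
| "loop_depth (IfZ x c1 c2) = max (loop_depth c1) (loop_depth c2)"
| "loop_depth (For v x c) = Suc (loop_depth c)"

primrec time_coeff :: "com \<Rightarrow> nat" where
  "time_coeff (SetC x c) = 1"
| "time_coeff (AddV x y z) = 1"
| "time_coeff (SubV x y z) = 1"
| "time_coeff (DivS x y z) = 1"
| "time_coeff (ReadA x k y) = 8"
| "time_coeff (WriteA k x y) = 8"
| "time_coeff (c1 ;; c2) = time_coeff c1 + time_coeff c2"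
| "time_coeff (IfZ x c1 c2) = 3 + time_coeff c1 + time_coeff c2"
| "time_coeff (For v x c) = 11 + time_coeff c"

lemma fixed_limits_disjoint: "fixed_limits L c \<Longrightarrow> x \<in> L \<Longrightarrow> x \<notin> vars_written c"
  by (induction c) auto

text \<open>Limits in \<open>L\<close> never change, so every loop at every depth runs at most
  \<open>N\<close> times. \<open>Suc N\<close> instead of \<open>N\<close> keeps the powers positive
  and monotone in the exponent.\<close>

lemma tm_bound:
  assumes "fixed_limits L c" "\<And>x. x \<in> L \<Longrightarrow> fst \<sigma> x \<le> N"
  shows "tm c \<sigma> \<le> time_coeff c * Suc N ^ loop_depth c"
  using assms
proof (induction c arbitrary: \<sigma>)
  case (Seq c1 c2)
  let ?d = "loop_depth (c1 ;; c2)"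
  have "fst (sem c1 \<sigma>) x \<le> N" if "x \<in> L" for x
    using that Seq.prems sem_frame(1)[of x c1 \<sigma>] fixed_limits_disjoint[of L c1 x] by auto
  then have "tm c2 (sem c1 \<sigma>) \<le> time_coeff c2 * Suc N ^ loop_depth c2"
    using Seq.prems by (intro Seq.IH) auto
  also have "\<dots> \<le> time_coeff c2 * Suc N ^ ?d"
    by (intro mult_left_mono power_increasing) auto
  finally have 2: "tm c2 (sem c1 \<sigma>) \<le> time_coeff c2 * Suc N ^ ?d" .
  have "tm c1 \<sigma> \<le> time_coeff c1 * Suc N ^ loop_depth c1"
    using Seq.prems by (intro Seq.IH) auto
  also have "\<dots> \<le> time_coeff c1 * Suc N ^ ?d"
    by (intro mult_left_mono power_increasing) auto
  finally show ?case using 2 by (simp add: distrib_right)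
next
  case (IfZ x c1 c2)
  let ?d = "loop_depth (IfZ x c1 c2)"
  have "tm c2 \<sigma> \<le> time_coeff c2 * Suc N ^ loop_depth c2"
    using IfZ.prems by (intro IfZ.IH) auto
  also have "\<dots> \<le> time_coeff c2 * Suc N ^ ?d"
    by (intro mult_left_mono power_increasing) auto
  finally have 2: "tm c2 \<sigma> \<le> time_coeff c2 * Suc N ^ ?d" .
  have "tm c1 \<sigma> \<le> time_coeff c1 * Suc N ^ loop_depth c1"
    using IfZ.prems by (intro IfZ.IH) auto
  also have "\<dots> \<le> time_coeff c1 * Suc N ^ ?d"
    by (intro mult_left_mono power_increasing) auto
  finally have 1: "tm c1 \<sigma> \<le> time_coeff c1 * Suc N ^ ?d" .
  have "1 \<le> Suc N ^ ?d" by (rule one_le_power) simp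
  then have "3 \<le> 3 * Suc N ^ ?d" by linarith
  moreover have "tm (IfZ x c1 c2) \<sigma> \<le> 3 + (tm c1 \<sigma> + tm c2 \<sigma>)" by simp
  ultimately have "tm (IfZ x c1 c2) \<sigma> \<le>
      3 * Suc N ^ ?d + time_coeff c1 * Suc N ^ ?d + time_coeff c2 * Suc N ^ ?d"
    using 1 2 by linarith
  then show ?case by (simp only: time_coeff.simps distrib_right)
next
  case (For v x c)
  let ?d = "loop_depth c" and ?st = "\<lambda>k. fold (\<lambda>k \<tau>. sem c (setv v k \<tau>)) [0..<k] \<sigma>"
  have "tm c (setv v k (?st k)) \<le> time_coeff c * Suc N ^ ?d" for k
  proof (rule For.IH)
    fix y assume "y \<in> L"
    then show "fst (setv v k (?st k)) y \<le> N"
      using For.prems agreeD(1)[OF agree_fold[OF agree_sem, where v = v and x = x and c = c and ks = "[0..<k]" and \<sigma> = \<sigma>], of y]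
        fixed_limits_disjoint[of L c y] by auto
  qed (use For.prems in simp)
  moreover have "1 \<le> Suc N ^ ?d" by simp
  ultimately have "8 + tm c (setv v k (?st k)) \<le> (8 + time_coeff c) * Suc N ^ ?d" for k
    using add_mono[of 8 "8 * Suc N ^ ?d"] by (simp add: distrib_right)
  then have "(\<Sum>k<fst \<sigma> x. 8 + tm c (setv v k (?st k))) \<le>
      (\<Sum>k<fst \<sigma> x. (8 + time_coeff c) * Suc N ^ ?d)"
    by (intro sum_mono) auto
  also have "\<dots> \<le> N * ((8 + time_coeff c) * Suc N ^ ?d)"
    using For.prems by simp
  also have "\<dots> \<le> (8 + time_coeff c) * Suc N ^ Suc ?d"
    by (simp add: algebra_simps)
  finally have "tm (For v x c) \<sigma> \<le> 3 + (8 + time_coeff c) * Suc N ^ Suc ?d" by simp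
  also have "\<dots> \<le> (11 + time_coeff c) * Suc N ^ Suc ?d"
  proof -
    have "1 \<le> Suc N ^ Suc ?d" by (rule one_le_power) simp
    then have "3 \<le> 3 * Suc N ^ Suc ?d" by linarith
    then show ?thesis by (simp add: distrib_right del: power_Suc)
  qed
  finally show ?case by simp
qed auto

text \<open>Fully applied equations: otherwise the simplifier would unfold a whole program under a
  lambda, before the state that decides its conditionals is known.\<close>

lemma sem_apply [simp]:
  "sem (SetC x c) \<sigma> = setv x c \<sigma>"
  "sem (AddV x y z) \<sigma> = setv x (fst \<sigma> y + fst \<sigma> z) \<sigma>"
  "sem (SubV x y z) \<sigma> = setv x (fst \<sigma> y - fst \<sigma> z) \<sigma>"
  "sem (DivS x y z) \<sigma> = setv x (fst \<sigma> y div Suc (fst \<sigma> z)) \<sigma>"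
  "sem (ReadA x k y) \<sigma> = setv x (snd \<sigma> k (fst \<sigma> y)) \<sigma>"
  "sem (WriteA k x y) \<sigma> = seta k (fst \<sigma> x) (fst \<sigma> y) \<sigma>"
  "sem (c1 ;; c2) \<sigma> = sem c2 (sem c1 \<sigma>)"
  "fst \<sigma> x = 0 \<Longrightarrow> sem (IfZ x c1 c2) \<sigma> = sem c1 \<sigma>"
  "fst \<sigma> x \<noteq> 0 \<Longrightarrow> sem (IfZ x c1 c2) \<sigma> = sem c2 \<sigma>"
  by simp_all

declare sem.simps [simp del]

section \<open>The search program\<close>

abbreviation (input) "vN \<equiv> (2::nat)"
abbreviation (input) "vBd \<equiv> (3::nat)"
abbreviation (input) "vP \<equiv> (4::nat)"
abbreviation (input) "vQ \<equiv> (5::nat)"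
abbreviation (input) "vK \<equiv> (6::nat)"
abbreviation (input) "vR \<equiv> (7::nat)"
abbreviation (input) "vS \<equiv> (8::nat)"
abbreviation (input) "vPw \<equiv> (9::nat)"
abbreviation (input) "vPtr \<equiv> (10::nat)"
abbreviation (input) "vT \<equiv> (11::nat)"
abbreviation (input) "vT2 \<equiv> (12::nat)"
abbreviation (input) "vJ \<equiv> (13::nat)"
abbreviation (input) "vM \<equiv> (14::nat)"
abbreviation (input) "vI \<equiv> (15::nat)"
abbreviation (input) "vX \<equiv> (16::nat)"
abbreviation (input) "vV \<equiv> (17::nat)"
abbreviation (input) "vUs \<equiv> (18::nat)"
abbreviation (input) "vVs \<equiv> (19::nat)"
abbreviation (input) "vA \<equiv> (20::nat)"
abbreviation (input) "vB \<equiv> (21::nat)"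
abbreviation (input) "vC \<equiv> (22::nat)"
abbreviation (input) "vBest \<equiv> (23::nat)"
abbreviation (input) "vSol \<equiv> (24::nat)"
abbreviation (input) "vAcc \<equiv> (25::nat)"
abbreviation (input) "vMax \<equiv> (26::nat)"
abbreviation (input) "vD \<equiv> (27::nat)"
abbreviation (input) "vU \<equiv> (28::nat)"
abbreviation (input) "vZero \<equiv> (29::nat)"
abbreviation (input) "vOne \<equiv> (30::nat)"

abbreviation (input) "aIn \<equiv> (0::nat)"
abbreviation (input) "aU \<equiv> (2::nat)"
abbreviation (input) "aV \<equiv> (3::nat)"
abbreviation (input) "aL \<equiv> (4::nat)"
abbreviation (input) "aB \<equiv> (5::nat)"
abbreviation (input) "aUs \<equiv> (6::nat)"
abbreviation (input) "aVs \<equiv> (7::nat)"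
abbreviation (input) "aF \<equiv> (8::nat)"
abbreviation (input) "aG \<equiv> (9::nat)"
abbreviation (input) "aH \<equiv> (10::nat)"
abbreviation (input) "aF' \<equiv> (11::nat)"
abbreviation (input) "aG' \<equiv> (12::nat)"
abbreviation (input) "aH' \<equiv> (13::nat)"
abbreviation (input) "aOut \<equiv> (14::nat)"
abbreviation (input) "aPw \<equiv> (15::nat)"
text \<open>Shares its storage with \<open>aF'\<close>, whose contents are dead once the search has
  ended.\<close>

abbreviation (input) "aSel \<equiv> (11::nat)"

text \<open>The language has no empty command; \<open>vT\<close> is scratch, so clearing it does no
  harm.\<close>

abbreviation (input) "skip \<equiv> SetC vT 0"

text \<open>\<open>F v\<close> is the least resource use with rounded objective at most \<open>v\<close>, attained by the set of
  objective-side items with bit mask \<open>G v\<close> and exact objective \<open>H v\<close>. \<open>vBest\<close> is 0 as long as no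
  solution is known, and the successor of the best value otherwise.\<close>

definition scale_loop :: com where
  "scale_loop = For vX vR (
     AddV vAcc vAcc vA ;;
     SubV vB vAcc vM ;;
     IfZ vB skip (SubV vAcc vB vOne ;; AddV vUs vUs vOne))"

definition scale :: com where
  "scale = For vI vN (
     ReadA vA aU vI ;; SubV vT vA vM ;; ReadA vB aL vI ;; AddV vT vT vB ;;
     IfZ vT (SetC vAcc 0 ;; SetC vUs 0 ;; scale_loop) (AddV vUs vS vZero) ;;
     WriteA aUs vI vUs ;;
     ReadA vB aB vI ;; SubV vB vB vM ;;
     IfZ vB (ReadA vVs aV vI) (AddV vVs vBd vOne) ;;
     WriteA aVs vI vVs)"

definition dp_init :: com where
  "dp_init = For vV vS (WriteA aF vV vZero ;; WriteA aG vV vZero ;; WriteA aH vV vZero)"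

text \<open>The new row goes to separate arrays: entry \<open>v\<close> also reads the old entry
  \<open>v - vUs\<close>, which an ascending update in place would have overwritten.\<close>

definition dp_step :: com where
  "dp_step = For vV vS (
     ReadA vA aF vV ;; AddV vA vA vVs ;; ReadA vB aG vV ;; ReadA vC aH vV ;;
     SubV vT vUs vV ;;
     IfZ vT
       (SubV vT2 vV vUs ;; ReadA vD aF vT2 ;; SubV vT vD vA ;;
        IfZ vT
          (AddV vA vD vZero ;; ReadA vB aG vT2 ;; AddV vB vB vPw ;;
           ReadA vC aH vT2 ;; AddV vC vC vU)
          skip)
       skip ;;
     WriteA aF' vV vA ;; WriteA aG' vV vB ;; WriteA aH' vV vC)"

definition dp_copy :: com where
  "dp_copy = For vV vS (
     ReadA vA aF' vV ;; WriteA aF vV vA ;; ReadA vA aG' vV ;; WriteA aG vV vA ;;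
     ReadA vA aH' vV ;; WriteA aH vV vA)"

definition dp :: com where
  "dp = For vI vN (
     ReadA vUs aUs vI ;; ReadA vVs aVs vI ;; ReadA vU aU vI ;; ReadA vPw aPw vI ;;
     dp_step ;; dp_copy)"

text \<open>With truncated subtraction, \<open>vC + (vM - vC)\<close> is the maximum of both. The
  difference \<open>vBest - vC\<close> is nonzero exactly for a strict improvement, and
  \<open>vT\<close> is forced to 1 as long as no solution is known.\<close>

definition pick :: com where
  "pick = For vV vS (
     ReadA vA aF vV ;; SubV vT vA vBd ;;
     IfZ vT
       (ReadA vC aH vV ;; SubV vT vM vC ;; AddV vC vC vT ;; AddV vC vC vOne ;;
        SubV vT vBest vC ;; IfZ vBest (SetC vT 1) (SetC vT2 0) ;;
        IfZ vT skip (AddV vBest vC vZero ;; ReadA vSol aG vV))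
       skip)"

definition attempt :: com where
  "attempt = scale ;; dp_init ;; dp ;; pick"

text \<open>Threshold 0 is tried separately so that the empty instance, which offers no other
  candidate, also gets one attempt.\<close>

definition search :: com where
  "search = SetC vBest 0 ;; SetC vSol 0 ;; SetC vM 0 ;; attempt ;;
     For vJ vN (ReadA vM aU vJ ;; attempt ;; ReadA vM aB vJ ;; attempt)"

section \<open>Correctness of the search\<close>

lemma written [simp]:
  "vars_written scale_loop = {vX, vAcc, vB, vT, vUs}" "arrs_written scale_loop = {}"
  "vars_written scale = {vI, vA, vT, vB, vAcc, vUs, vX, vVs}" "arrs_written scale = {aUs, aVs}"
  "vars_written dp_init = {vV}" "arrs_written dp_init = {aF, aG, aH}"
  "vars_written dp_step = {vV, vA, vB, vC, vT, vT2, vD}" "arrs_written dp_step = {aF', aG', aH'}"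
  "vars_written dp_copy = {vV, vA}" "arrs_written dp_copy = {aF, aG, aH}"
  "vars_written dp = {vI, vUs, vVs, vU, vPw, vV, vA, vB, vC, vT, vT2, vD}"
  "arrs_written dp = {aF, aG, aH, aF', aG', aH'}"
  "vars_written attempt = {vI, vA, vT, vB, vAcc, vUs, vX, vVs, vV, vU, vPw, vC, vT2, vD, vBest, vSol}"
  "arrs_written attempt = {aUs, aVs, aF, aG, aH, aF', aG', aH'}"
  "vars_written pick = {vV, vA, vT, vT2, vC, vBest, vSol}" "arrs_written pick = {}"
  by (auto simp: scale_loop_def scale_def dp_init_def dp_step_def dp_copy_def dp_def pick_def attempt_def)

text \<open>The floor of \<open>R * U / (M + 1)\<close> arises as a count of carries:
  \<open>U\<close> is added \<open>R\<close> times to a counter modulo \<open>M + 1\<close>. Since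
  \<open>U\<close> is at most \<open>M\<close>, each addition causes at most one carry.\<close>

lemma scale_loop_sem:
  assumes "fst \<sigma> vA \<le> fst \<sigma> vM" "fst \<sigma> vAcc = 0" "fst \<sigma> vUs = 0" "fst \<sigma> vOne = 1"
  shows "fst (sem scale_loop \<sigma>) vUs = (fst \<sigma> vR * fst \<sigma> vA) div Suc (fst \<sigma> vM)"
proof -
  let ?u = "fst \<sigma> vA" and ?M = "fst \<sigma> vM"
  let ?I = "\<lambda>k \<tau>. fst \<tau> vUs * Suc ?M + fst \<tau> vAcc = k * ?u \<and> fst \<tau> vAcc < Suc ?M"
  have "?I (fst \<sigma> vR) (sem scale_loop \<sigma>)"
    unfolding scale_loop_def
  proof (rule For_rule[where I = ?I])
    show "?I 0 \<sigma>" using assms by simp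
    fix k \<tau>
    assume a: "agree (For vX vR (AddV vAcc vAcc vA ;; SubV vB vAcc vM ;;
       IfZ vB skip (SubV vAcc vB vOne ;; AddV vUs vUs vOne))) \<sigma> \<tau>" and I: "?I k \<tau>"
    have "fst \<tau> vA = ?u" "fst \<tau> vM = ?M" "fst \<tau> vOne = 1"
      using a assms by (auto simp: agree_def)
    then show "?I (Suc k) (sem (AddV vAcc vAcc vA ;; SubV vB vAcc vM ;;
       IfZ vB skip (SubV vAcc vB vOne ;; AddV vUs vUs vOne)) (setv vX k \<tau>))"
      using I assms(1)
      by (cases "fst \<tau> vAcc + ?u \<le> ?M") (auto simp: algebra_simps)
  qed
  then have "fst \<sigma> vR * ?u = fst (sem scale_loop \<sigma>) vUs * Suc ?M + fst (sem scale_loop \<sigma>) vAcc"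
    "fst (sem scale_loop \<sigma>) vAcc < Suc ?M" by simp_all
  moreover have "(a * Suc b + r) div Suc b = a" if "r < Suc b" for a b r :: nat
    using div_mult_self3[of "Suc b" a r] div_less[OF that] by simp
  ultimately show ?thesis by metis
qed

text \<open>A nonzero \<open>L j\<close> bars item \<open>j\<close> from the objective side;
  \<open>B j\<close> is the threshold that it needs on the other side. An allowed rounded value is
  at most \<open>R\<close>, so \<open>n\<close> of them sum to at most \<open>n * R\<close>, which
  determines the table size \<open>S\<close>.\<close>

locale knapsack =
  fixes n Bd R S N0 :: nat and U V L B :: "nat \<Rightarrow> nat"
  assumes R: "R = 2 * n * N0" and S: "S = Suc (n * R)" and N0: "0 < N0"
begin

definition env :: "state \<Rightarrow> bool" where
  "env \<sigma> \<longleftrightarrow> fst \<sigma> vZero = 0 \<and> fst \<sigma> vOne = 1 \<and> fst \<sigma> vN = n \<and> fst \<sigma> vBd = Bd \<and>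
     fst \<sigma> vR = R \<and> fst \<sigma> vS = S \<and>
     (\<forall>j<n. snd \<sigma> aU j = U j \<and> snd \<sigma> aV j = V j \<and> snd \<sigma> aL j = L j \<and>
        snd \<sigma> aB j = B j \<and> snd \<sigma> aPw j = 2 ^ j)"

lemma env_agree:
  assumes "env \<sigma>" "agree c \<sigma> \<tau>" "vars_written c \<inter> {vZero, vOne, vN, vBd, vR, vS} = {}"
    "arrs_written c \<inter> {aU, aV, aL, aB, aPw} = {}"
  shows "env \<tau>"
  using assms unfolding env_def agree_def by auto

lemma env_sem:
  assumes "env \<sigma>" "vars_written c \<inter> {vZero, vOne, vN, vBd, vR, vS} = {}"
    "arrs_written c \<inter> {aU, aV, aL, aB, aPw} = {}"
  shows "env (sem c \<sigma>)"
  using env_agree[OF assms(1) agree_sem assms(2,3)] .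

text \<open>\<open>S\<close> exceeds every table index, so a barred item fits into no entry; in the
  same way \<open>Suc Bd\<close> in \<open>vs\<close> exceeds the resource bound. Dividing by
  \<open>Suc M\<close> keeps the threshold 0 legal.\<close>

definition us :: "nat \<Rightarrow> nat \<Rightarrow> nat" where
  "us M j = (if U j \<le> M \<and> L j = 0 then R * U j div Suc M else S)"

definition vs :: "nat \<Rightarrow> nat \<Rightarrow> nat" where
  "vs M j = (if B j \<le> M then V j else Suc Bd)"

lemma scale_sem:
  assumes "env \<sigma>"
  shows "\<forall>j<n. snd (sem scale \<sigma>) aUs j = us (fst \<sigma> vM) j \<and> snd (sem scale \<sigma>) aVs j = vs (fst \<sigma> vM) j"
proof -
  let ?I = "\<lambda>k \<tau>. \<forall>j<k. snd \<tau> aUs j = us (fst \<sigma> vM) j \<and> snd \<tau> aVs j = vs (fst \<sigma> vM) j"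
  define body where "body = ReadA vA aU vI ;; SubV vT vA vM ;; ReadA vB aL vI ;; AddV vT vT vB ;;
     IfZ vT (SetC vAcc 0 ;; SetC vUs 0 ;; scale_loop) (AddV vUs vS vZero) ;;
     WriteA aUs vI vUs ;;
     ReadA vB aB vI ;; SubV vB vB vM ;;
     IfZ vB (ReadA vVs aV vI) (AddV vVs vBd vOne) ;;
     WriteA aVs vI vVs"
  have "?I (fst \<sigma> vN) (sem scale \<sigma>)"
    unfolding scale_def body_def[symmetric]
  proof (rule For_rule[where I = ?I])
    fix k \<tau>
    assume k: "k < fst \<sigma> vN" and a: "agree (For vI vN body) \<sigma> \<tau>" and I: "?I k \<tau>"
    have env: "env \<tau>"
      by (rule env_agree[OF assms a]) (simp_all add: body_def)
    have M: "fst \<tau> vM = fst \<sigma> vM"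
      by (rule agreeD(1)[OF a]) (simp add: body_def)
    have k': "k < n" using k assms by (simp add: env_def)
    have "snd (sem body (setv vI k \<tau>)) aUs = (snd \<tau> aUs)(k := us (fst \<sigma> vM) k) \<and>
      snd (sem body (setv vI k \<tau>)) aVs = (snd \<tau> aVs)(k := vs (fst \<sigma> vM) k)"
    proof (cases "U k \<le> fst \<sigma> vM \<and> L k = 0")
      case True
      then show ?thesis using env k' M
        by (cases "B k \<le> fst \<sigma> vM")
          (simp_all add: body_def env_def us_def vs_def scale_loop_sem sem_frame)
    next
      case False
      then show ?thesis using env k' M
        by (cases "B k \<le> fst \<sigma> vM")
          (auto simp: body_def env_def us_def vs_def sem_frame)
    qed
    then show "?I (Suc k) (sem body (setv vI k \<tau>))"
      using I by (metis fun_upd_apply less_Suc_eq)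
  qed simp
  then show ?thesis using assms by (simp add: env_def)
qed

section \<open>The dynamic program for one threshold\<close>

lemma dp_init_sem:
  assumes "env \<sigma>"
  shows "\<forall>v<S. snd (sem dp_init \<sigma>) aF v = 0 \<and> snd (sem dp_init \<sigma>) aG v = 0 \<and>
    snd (sem dp_init \<sigma>) aH v = 0"
proof -
  let ?I = "\<lambda>k \<tau>. \<forall>v<k. snd \<tau> aF v = 0 \<and> snd \<tau> aG v = 0 \<and> snd \<tau> aH v = 0"
  define body where "body = WriteA aF vV vZero ;; WriteA aG vV vZero ;; WriteA aH vV vZero"
  have "?I (fst \<sigma> vS) (sem dp_init \<sigma>)"
    unfolding dp_init_def body_def[symmetric]
  proof (rule For_rule[where I = ?I])
    fix k \<tau>
    assume a: "agree (For vV vS body) \<sigma> \<tau>" and I: "?I k \<tau>"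
    have "env \<tau>" by (rule env_agree[OF assms a]) (simp_all add: body_def)
    then show "?I (Suc k) (sem body (setv vV k \<tau>))"
      using I by (auto simp: body_def env_def less_Suc_eq)
  qed simp
  then show ?thesis using assms by (simp add: env_def)
qed

lemma dp_step_sem:
  assumes "env \<sigma>"
  defines "F \<equiv> snd \<sigma> aF" and "G \<equiv> snd \<sigma> aG" and "H \<equiv> snd \<sigma> aH"
    and "x \<equiv> fst \<sigma> vUs" and "y \<equiv> fst \<sigma> vVs"
  defines "tk v \<equiv> x \<le> v \<and> F (v - x) \<le> F v + y"
  shows "\<forall>v<S. snd (sem dp_step \<sigma>) aF' v = (if tk v then F (v - x) else F v + y) \<and>
     snd (sem dp_step \<sigma>) aG' v = (if tk v then G (v - x) + fst \<sigma> vPw else G v) \<and>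
     snd (sem dp_step \<sigma>) aH' v = (if tk v then H (v - x) + fst \<sigma> vU else H v)"
proof -
  let ?I = "\<lambda>k \<tau>. \<forall>v<k. snd \<tau> aF' v = (if tk v then F (v - x) else F v + y) \<and>
     snd \<tau> aG' v = (if tk v then G (v - x) + fst \<sigma> vPw else G v) \<and>
     snd \<tau> aH' v = (if tk v then H (v - x) + fst \<sigma> vU else H v)"
  define body where "body =
     ReadA vA aF vV ;; AddV vA vA vVs ;; ReadA vB aG vV ;; ReadA vC aH vV ;;
     SubV vT vUs vV ;;
     IfZ vT
       (SubV vT2 vV vUs ;; ReadA vD aF vT2 ;; SubV vT vD vA ;;
        IfZ vT
          (AddV vA vD vZero ;; ReadA vB aG vT2 ;; AddV vB vB vPw ;;
           ReadA vC aH vT2 ;; AddV vC vC vU)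
          skip)
       skip ;;
     WriteA aF' vV vA ;; WriteA aG' vV vB ;; WriteA aH' vV vC"
  have "?I (fst \<sigma> vS) (sem dp_step \<sigma>)"
    unfolding dp_step_def body_def[symmetric]
  proof (rule For_rule[where I = ?I])
    fix k \<tau>
    assume a: "agree (For vV vS body) \<sigma> \<tau>" and I: "?I k \<tau>"
    have env: "env \<tau>" by (rule env_agree[OF assms(1) a]) (simp_all add: body_def)
    have *: "snd \<tau> aF = F" "snd \<tau> aG = G" "snd \<tau> aH = H" "fst \<tau> vUs = x" "fst \<tau> vVs = y"
      "fst \<tau> vPw = fst \<sigma> vPw" "fst \<tau> vU = fst \<sigma> vU"
      unfolding F_def G_def H_def x_def y_def
      by (intro agreeD[OF a]; simp add: body_def)+
    have new: "snd (sem body (setv vV k \<tau>)) aF' = (snd \<tau> aF')(k := if tk k then F (k - x) else F k + y) \<and>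
      snd (sem body (setv vV k \<tau>)) aG' = (snd \<tau> aG')(k := if tk k then G (k - x) + fst \<sigma> vPw else G k) \<and>
      snd (sem body (setv vV k \<tau>)) aH' = (snd \<tau> aH')(k := if tk k then H (k - x) + fst \<sigma> vU else H k)"
    proof (cases "x \<le> k")
      case True
      then show ?thesis using env *
        by (cases "F (k - x) \<le> F k + y") (simp_all add: body_def env_def tk_def)
    next
      case False
      then show ?thesis using env * by (simp add: body_def env_def tk_def)
    qed
    show "?I (Suc k) (sem body (setv vV k \<tau>))"
    proof (intro allI impI)
      fix v assume "v < Suc k"
      then consider "v < k" | "v = k" by linarith
      then show "snd (sem body (setv vV k \<tau>)) aF' v = (if tk v then F (v - x) else F v + y) \<and>
         snd (sem body (setv vV k \<tau>)) aG' v = (if tk v then G (v - x) + fst \<sigma> vPw else G v) \<and>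
         snd (sem body (setv vV k \<tau>)) aH' v = (if tk v then H (v - x) + fst \<sigma> vU else H v)"
        by cases (use I new in simp_all)
    qed
  qed simp
  then show ?thesis using assms(1) by (simp add: env_def)
qed

lemma dp_copy_sem:
  assumes "env \<sigma>"
  shows "\<forall>v<S. snd (sem dp_copy \<sigma>) aF v = snd \<sigma> aF' v \<and> snd (sem dp_copy \<sigma>) aG v = snd \<sigma> aG' v \<and>
    snd (sem dp_copy \<sigma>) aH v = snd \<sigma> aH' v"
proof -
  let ?I = "\<lambda>k \<tau>. \<forall>v<k. snd \<tau> aF v = snd \<sigma> aF' v \<and> snd \<tau> aG v = snd \<sigma> aG' v \<and>
    snd \<tau> aH v = snd \<sigma> aH' v"
  define body where "body =
     ReadA vA aF' vV ;; WriteA aF vV vA ;; ReadA vA aG' vV ;; WriteA aG vV vA ;;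
     ReadA vA aH' vV ;; WriteA aH vV vA"
  have "?I (fst \<sigma> vS) (sem dp_copy \<sigma>)"
    unfolding dp_copy_def body_def[symmetric]
  proof (rule For_rule[where I = ?I])
    fix k \<tau>
    assume a: "agree (For vV vS body) \<sigma> \<tau>" and I: "?I k \<tau>"
    have "snd \<tau> aF' = snd \<sigma> aF'" "snd \<tau> aG' = snd \<sigma> aG'" "snd \<tau> aH' = snd \<sigma> aH'"
      by (intro agreeD[OF a]; simp add: body_def)+
    then show "?I (Suc k) (sem body (setv vV k \<tau>))"
      using I by (auto simp: body_def less_Suc_eq)
  qed simp
  then show ?thesis using assms by (simp add: env_def)
qed

text \<open>A single witness \<open>X\<close> ties mask, exact objective and resource use to the
  same set. Only \<open>f\<close> is optimal; \<open>h\<close> is merely the exact objective of the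
  set that attains it.\<close>

definition dp_ok :: "nat \<Rightarrow> nat \<Rightarrow> nat \<Rightarrow> nat \<Rightarrow> nat \<Rightarrow> nat \<Rightarrow> bool" where
  "dp_ok M i v f g h \<longleftrightarrow> (\<exists>X. X \<subseteq> {..<i} \<and> g = (\<Sum>j\<in>X. 2 ^ j) \<and> h = sum U X \<and>
     f = sum (vs M) ({..<i} - X) \<and> sum (us M) X \<le> v \<and>
     (\<forall>Y. Y \<subseteq> {..<i} \<longrightarrow> sum (us M) Y \<le> v \<longrightarrow> f \<le> sum (vs M) ({..<i} - Y)))"

lemma dp_ok_0: "dp_ok M 0 v 0 0 0"
  by (auto simp: dp_ok_def)

text \<open>Bellman step: on the objective side item \<open>i\<close> leaves
  \<open>v - us M i\<close> for the others, on the resource side it adds \<open>vs M i\<close>. Both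
  old entries have index at most \<open>v\<close>, hence the range in the assumption.\<close>

lemma dp_ok_Suc:
  assumes "\<And>v'. v' \<le> v \<Longrightarrow> dp_ok M i v' (F v') (G v') (H v')"
  defines "tk \<equiv> us M i \<le> v \<and> F (v - us M i) \<le> F v + vs M i"
  shows "dp_ok M (Suc i) v (if tk then F (v - us M i) else F v + vs M i)
    (if tk then G (v - us M i) + 2 ^ i else G v) (if tk then H (v - us M i) + U i else H v)"
proof -
  let ?f = "if tk then F (v - us M i) else F v + vs M i"
  have diff: "{..<Suc i} - insert i X = {..<i} - X" "{..<Suc i} - X = insert i ({..<i} - X)"
    if "X \<subseteq> {..<i}" for X
    using that by (auto simp: lessThan_Suc)
  have opt: "?f \<le> sum (vs M) ({..<Suc i} - Y)" if Y: "Y \<subseteq> {..<Suc i}" "sum (us M) Y \<le> v" for Y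
  proof (cases "i \<in> Y")
    case True
    define Y' where "Y' = Y - {i}"
    have Y': "Y' \<subseteq> {..<i}" "Y = insert i Y'" "i \<notin> Y'"
      using Y True by (auto simp: Y'_def lessThan_Suc)
    then have "finite Y'" using finite_subset by blast
    then have "us M i + sum (us M) Y' \<le> v" using Y(2) Y'(2,3) by simp
    then have "us M i \<le> v" "sum (us M) Y' \<le> v - us M i" by auto
    moreover have "F (v - us M i) \<le> sum (vs M) ({..<i} - Y')"
      using assms(1)[of "v - us M i"] Y'(1) calculation(2) unfolding dp_ok_def by auto
    ultimately show ?thesis using diff(1)[OF Y'(1)] Y'(2) by (auto simp: tk_def)
  next
    case False
    then have Y': "Y \<subseteq> {..<i}" using Y(1) by (auto simp: lessThan_Suc)
    then have "F v \<le> sum (vs M) ({..<i} - Y)"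
      using assms(1)[of v] Y(2) unfolding dp_ok_def by auto
    then show ?thesis using diff(2)[OF Y'] by (auto simp: tk_def)
  qed
  show ?thesis
  proof (cases tk)
    case True
    from assms(1)[of "v - us M i"] obtain X where X: "X \<subseteq> {..<i}"
      "G (v - us M i) = (\<Sum>j\<in>X. 2 ^ j)" "H (v - us M i) = sum U X"
      "F (v - us M i) = sum (vs M) ({..<i} - X)" "sum (us M) X \<le> v - us M i"
      unfolding dp_ok_def by auto
    have "finite X" "i \<notin> X" using X(1) finite_subset by auto
    note sums = sum.insert[OF this] and le = True[unfolded tk_def]
    show ?thesis
      unfolding dp_ok_def
    proof (intro exI[of _ "insert i X"] conjI allI impI)
      show "?f \<le> sum (vs M) ({..<Suc i} - Y)" if "Y \<subseteq> {..<Suc i}" "sum (us M) Y \<le> v" for Y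
        using opt[OF that] .
      show "insert i X \<subseteq> {..<Suc i}" using X(1) by auto
      show "sum (us M) (insert i X) \<le> v" using X(5) le sums[of "us M"] by linarith
    qed (use True X diff(1)[OF X(1)] sums[of U] sums[of "\<lambda>j. 2 ^ j :: nat"] in simp_all)
  next
    case False
    from assms(1)[of v] obtain X where X: "X \<subseteq> {..<i}"
      "G v = (\<Sum>j\<in>X. 2 ^ j)" "H v = sum U X"
      "F v = sum (vs M) ({..<i} - X)" "sum (us M) X \<le> v"
      unfolding dp_ok_def by auto
    have "finite ({..<i} - X)" "i \<notin> {..<i} - X" by auto
    note sums = sum.insert[OF this]
    show ?thesis
      unfolding dp_ok_def
    proof (intro exI[of _ X] conjI allI impI)
      show "?f \<le> sum (vs M) ({..<Suc i} - Y)" if "Y \<subseteq> {..<Suc i}" "sum (us M) Y \<le> v" for Y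
        using opt[OF that] .
      show "X \<subseteq> {..<Suc i}" using X(1) by auto
    qed (use False X diff(2)[OF X(1)] sums[of "vs M"] in simp_all)
  qed
qed

lemma dp_sem:
  assumes "env \<sigma>"
    and us: "\<forall>j<n. snd \<sigma> aUs j = us M j \<and> snd \<sigma> aVs j = vs M j"
    and init: "\<forall>v<S. snd \<sigma> aF v = 0 \<and> snd \<sigma> aG v = 0 \<and> snd \<sigma> aH v = 0"
  shows "\<forall>v<S. dp_ok M n v (snd (sem dp \<sigma>) aF v) (snd (sem dp \<sigma>) aG v) (snd (sem dp \<sigma>) aH v)"
proof -
  let ?I = "\<lambda>k \<tau>. \<forall>v<S. dp_ok M k v (snd \<tau> aF v) (snd \<tau> aG v) (snd \<tau> aH v)"
  define body where "body =
     ReadA vUs aUs vI ;; ReadA vVs aVs vI ;; ReadA vU aU vI ;; ReadA vPw aPw vI ;;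
     dp_step ;; dp_copy"
  have "?I (fst \<sigma> vN) (sem dp \<sigma>)"
    unfolding dp_def body_def[symmetric]
  proof (rule For_rule[where I = ?I])
    show "?I 0 \<sigma>" using init by (simp add: dp_ok_0)
    fix k \<tau>
    assume k: "k < fst \<sigma> vN" and a: "agree (For vI vN body) \<sigma> \<tau>" and I: "?I k \<tau>"
    have env: "env \<tau>" by (rule env_agree[OF assms(1) a]) (simp_all add: body_def)
    have k': "k < n" using k assms(1) by (simp add: env_def)
    have "snd \<tau> aUs = snd \<sigma> aUs" "snd \<tau> aVs = snd \<sigma> aVs"
      by (intro agreeD[OF a]; simp add: body_def)+
    then have u: "snd \<tau> aUs k = us M k" "snd \<tau> aVs k = vs M k" using us k' by simp_all
    define \<tau>1 where "\<tau>1 = sem (ReadA vUs aUs vI ;; ReadA vVs aVs vI ;; ReadA vU aU vI ;;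
       ReadA vPw aPw vI) (setv vI k \<tau>)"
    have \<tau>1: "env \<tau>1" "snd \<tau>1 = snd \<tau>" "fst \<tau>1 vUs = us M k" "fst \<tau>1 vVs = vs M k"
      "fst \<tau>1 vU = U k" "fst \<tau>1 vPw = 2 ^ k"
      using env k' u by (simp_all add: \<tau>1_def env_def)
    define \<tau>2 where "\<tau>2 = sem dp_step \<tau>1"
    have "env \<tau>2" unfolding \<tau>2_def by (rule env_sem[OF \<tau>1(1)]) simp_all
    note copy = dp_copy_sem[OF this] and step = dp_step_sem[OF \<tau>1(1), folded \<tau>2_def, unfolded \<tau>1]
    have body: "sem body (setv vI k \<tau>) = sem dp_copy \<tau>2"
      by (simp add: body_def \<tau>2_def \<tau>1_def)
    show "?I (Suc k) (sem body (setv vI k \<tau>))"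
    proof (intro allI impI)
      fix v assume v: "v < S"
      have "dp_ok M k v' (snd \<tau> aF v') (snd \<tau> aG v') (snd \<tau> aH v')" if "v' \<le> v" for v'
        using I that v by auto
      from dp_ok_Suc[OF this]
      show "dp_ok M (Suc k) v (snd (sem body (setv vI k \<tau>)) aF v)
         (snd (sem body (setv vI k \<tau>)) aG v) (snd (sem body (setv vI k \<tau>)) aH v)"
        unfolding body using copy step v by simp
    qed
  qed
  then show ?thesis using assms(1) by (simp add: env_def)
qed

section \<open>Feasible sets and the loss caused by rounding\<close>

definition feasible :: "nat \<Rightarrow> nat set \<Rightarrow> bool" where
  "feasible M X \<longleftrightarrow> X \<subseteq> {..<n} \<and> (\<forall>j\<in>X. U j \<le> M \<and> L j = 0) \<and>
     (\<forall>j\<in>{..<n} - X. B j \<le> M) \<and> sum V ({..<n} - X) \<le> Bd"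

lemma us_lessD: "us M j < S \<Longrightarrow> U j \<le> M" "us M j < S \<Longrightarrow> L j = 0"
  by (auto simp: us_def split: if_splits)

lemma vs_leD: "vs M j \<le> Bd \<Longrightarrow> B j \<le> M"
  by (auto simp: vs_def split: if_splits)

text \<open>A barred item alone would contribute \<open>S\<close> to the rounded objective or
  \<open>Suc Bd\<close> to the resource, so a cheap entry contains none, and then \<open>vs\<close>
  agrees with \<open>V\<close> on the resource side.\<close>

lemma dp_ok_feasible:
  assumes "dp_ok M n v f g h" "v < S" "f \<le> Bd"
  obtains X where "feasible M X" "g = (\<Sum>j\<in>X. 2 ^ j)" "h = sum U X"
proof -
  obtain X where X: "X \<subseteq> {..<n}" "g = (\<Sum>j\<in>X. 2 ^ j)" "h = sum U X"
    "f = sum (vs M) ({..<n} - X)" "sum (us M) X \<le> v"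
    using assms(1) unfolding dp_ok_def by blast
  have "finite X" using X(1) finite_subset by blast
  then have "us M j \<le> v" if "j \<in> X" for j
    using member_le_sum[of j X "us M"] that X(5) by simp
  then have obj: "U j \<le> M \<and> L j = 0" if "j \<in> X" for j
    using that assms(2) us_lessD by (meson le_less_trans)
  have "vs M j \<le> Bd" if "j \<in> {..<n} - X" for j
    using member_le_sum[of j "{..<n} - X" "vs M"] that X(4) assms(3) by simp
  then have con: "B j \<le> M" if "j \<in> {..<n} - X" for j
    using that vs_leD by blast
  have "sum (vs M) ({..<n} - X) = sum V ({..<n} - X)"
    using con by (intro sum.cong) (auto simp: vs_def)
  then have "feasible M X" unfolding feasible_def using X(1,4) obj con assms(3) by simp
  then show thesis using that X by blast
qed

text \<open>Rounding down loses less than one unit, worth \<open>(M + 1) / R\<close>, per item. The total loss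
  \<open>(M + 1) / (2 * N0)\<close> is at most \<open>M / N0\<close> unless \<open>M = 0\<close>, where the objective is 0 anyway.\<close>

lemma dp_ok_near_optimal:
  assumes Y: "feasible M Y"
  obtains v where "v < S" "\<And>f g h. dp_ok M n v f g h \<Longrightarrow> f \<le> Bd \<and> N0 * h \<le> N0 * sum U Y + M"
proof
  define v where "v = sum (us M) Y"
  have fY: "finite Y" "card Y \<le> n"
    using Y finite_subset[of Y "{..<n}"] card_mono[of "{..<n}" Y] by (auto simp: feasible_def)
  have us: "us M j = R * U j div Suc M" if "U j \<le> M" "L j = 0" for j
    using that by (simp add: us_def)
  have "us M j \<le> R" if "j \<in> Y" for j
  proof -
    have *: "U j \<le> M" "L j = 0" using Y that by (auto simp: feasible_def)
    then have "R * U j \<le> R * Suc M" by (intro mult_le_mono2) simp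
    then have "R * U j div Suc M \<le> R * Suc M div Suc M" by (rule div_le_mono)
    then show ?thesis using us[OF *] by (simp del: mult_Suc_right)
  qed
  then have "v \<le> card Y * R" unfolding v_def using sum_bounded_above[of Y "us M" R] by simp
  also have "\<dots> \<le> n * R" using fY by simp
  finally show "v < S" by (simp add: S)
  fix f g h assume "dp_ok M n v f g h"
  then obtain X where X: "X \<subseteq> {..<n}" "h = sum U X" "sum (us M) X \<le> v"
    "f \<le> sum (vs M) ({..<n} - Y)"
    using Y unfolding dp_ok_def feasible_def v_def by blast
  have "sum (vs M) ({..<n} - Y) = sum V ({..<n} - Y)"
    using Y by (intro sum.cong) (auto simp: vs_def feasible_def)
  then have f: "f \<le> Bd" using X(4) Y by (simp add: feasible_def)
  have fX: "finite X" "card X \<le> n"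
    using X(1) finite_subset[of X "{..<n}"] card_mono[of "{..<n}" X] by auto
  have "us M j \<le> v" if "j \<in> X" for j
    using member_le_sum[of j X "us M"] that X(3) fX by simp
  then have obj: "U j \<le> M" "L j = 0" if "j \<in> X" for j
    using that \<open>v < S\<close> us_lessD by (meson le_less_trans)+
  have "N0 * h \<le> N0 * sum U Y + M"
  \<comment> \<open>Here every item of \<open>X\<close> has objective 0, or there is none. Otherwise
    the final inequality may be divided by \<open>2 * n\<close>, and \<open>Suc M\<close> is at most
    \<open>2 * M\<close>.\<close>
  proof (cases "M = 0 \<or> n = 0")
    case True
    have "U j = 0" if "j \<in> X" for j using obj[OF that] True X(1) that by auto
    then show ?thesis using X(2) by simp
  next
    case False
    have "R * U j \<le> (us M j + 1) * Suc M" if "j \<in> X" for j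
    proof -
      have "R * U j = us M j * Suc M + R * U j mod Suc M"
        unfolding us[OF obj[OF that]] by (rule div_mult_mod_eq[symmetric])
      moreover have "R * U j mod Suc M \<le> Suc M" by (simp add: less_imp_le_nat)
      ultimately show ?thesis unfolding distrib_right mult_1 by linarith
    qed
    then have "(\<Sum>j\<in>X. R * U j) \<le> (\<Sum>j\<in>X. (us M j + 1) * Suc M)" by (rule sum_mono)
    moreover have "(\<Sum>j\<in>X. R * U j) = R * h"
      by (simp only: X(2) sum_distrib_left)
    moreover have "(\<Sum>j\<in>X. (us M j + 1) * Suc M) = (sum (us M) X + card X) * Suc M"
      by (simp only: sum_distrib_right[symmetric] sum.distrib card_eq_sum)
    ultimately have "R * h \<le> (sum (us M) X + card X) * Suc M" by simp
    also have "\<dots> \<le> (v + n) * Suc M"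
      using X(3) fX by (intro mult_right_mono) auto
    also have "\<dots> = (\<Sum>j\<in>Y. us M j * Suc M) + n * Suc M"
      by (simp only: v_def sum_distrib_right distrib_right)
    also have "(\<Sum>j\<in>Y. us M j * Suc M) \<le> (\<Sum>j\<in>Y. R * U j)"
    proof (rule sum_mono)
      fix j assume "j \<in> Y"
      then have "us M j = R * U j div Suc M" using Y by (intro us) (auto simp: feasible_def)
      then show "us M j * Suc M \<le> R * U j" using div_times_less_eq_dividend by metis
    qed
    also have "(\<Sum>j\<in>Y. R * U j) = R * sum U Y" by (simp only: sum_distrib_left)
    finally have "R * h \<le> R * sum U Y + n * Suc M" by (simp only:)
    \<comment> \<open>This use of \<open>0 < M\<close> is the origin of the factor 2 in
      \<open>R\<close>.\<close>
    also have "n * Suc M \<le> n * (2 * M)" using False by simp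
    finally have "2 * n * (N0 * h) \<le> 2 * n * (N0 * sum U Y + M)"
      by (simp add: R algebra_simps)
    then show ?thesis using False by simp
  qed
  with f show "f \<le> Bd \<and> N0 * h \<le> N0 * sum U Y + M" by simp
qed

section \<open>The best solution over all thresholds\<close>

definition sound :: "nat \<Rightarrow> nat \<Rightarrow> bool" where
  "sound b g \<longleftrightarrow> (b \<noteq> 0 \<longrightarrow> (\<exists>M X. feasible M X \<and> g = (\<Sum>j\<in>X. 2 ^ j) \<and> b = Suc (max (sum U X) M)))"

lemma pick_sem:
  assumes "env \<sigma>" and M: "fst \<sigma> vM = M"
    and dp: "\<forall>v<S. dp_ok M n v (snd \<sigma> aF v) (snd \<sigma> aG v) (snd \<sigma> aH v)"
    and sound: "sound (fst \<sigma> vBest) (fst \<sigma> vSol)"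
  shows "sound (fst (sem pick \<sigma>) vBest) (fst (sem pick \<sigma>) vSol)"
    and "fst \<sigma> vBest \<noteq> 0 \<Longrightarrow> fst (sem pick \<sigma>) vBest \<noteq> 0 \<and> fst (sem pick \<sigma>) vBest \<le> fst \<sigma> vBest"
    and "v < S \<Longrightarrow> snd \<sigma> aF v \<le> Bd \<Longrightarrow>
      fst (sem pick \<sigma>) vBest \<noteq> 0 \<and> fst (sem pick \<sigma>) vBest \<le> Suc (max (snd \<sigma> aH v) M)"
proof -
  let ?I = "\<lambda>k \<tau>. sound (fst \<tau> vBest) (fst \<tau> vSol) \<and>
    (fst \<sigma> vBest \<noteq> 0 \<longrightarrow> fst \<tau> vBest \<noteq> 0 \<and> fst \<tau> vBest \<le> fst \<sigma> vBest) \<and>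
    (\<forall>v<k. snd \<sigma> aF v \<le> Bd \<longrightarrow> fst \<tau> vBest \<noteq> 0 \<and> fst \<tau> vBest \<le> Suc (max (snd \<sigma> aH v) M))"
  define body where "body =
     ReadA vA aF vV ;; SubV vT vA vBd ;;
     IfZ vT
       (ReadA vC aH vV ;; SubV vT vM vC ;; AddV vC vC vT ;; AddV vC vC vOne ;;
        SubV vT vBest vC ;; IfZ vBest (SetC vT 1) (SetC vT2 0) ;;
        IfZ vT skip (AddV vBest vC vZero ;; ReadA vSol aG vV))
       skip"
  have "?I (fst \<sigma> vS) (sem pick \<sigma>)"
    unfolding pick_def body_def[symmetric]
  proof (rule For_rule[where I = ?I])
    show "?I 0 \<sigma>" using sound by simp
    fix k \<tau>
    assume k: "k < fst \<sigma> vS" and a: "agree (For vV vS body) \<sigma> \<tau>" and I: "?I k \<tau>"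
    have k': "k < S" using k assms(1) by (simp add: env_def)
    have env: "env \<tau>" by (rule env_agree[OF assms(1) a]) (simp_all add: body_def)
    have "fst \<tau> vM = fst \<sigma> vM" "snd \<tau> aF = snd \<sigma> aF" "snd \<tau> aG = snd \<sigma> aG" "snd \<tau> aH = snd \<sigma> aH"
      by (intro agreeD[OF a]; simp add: body_def)+
    note * = this[unfolded M]
    let ?val = "max (snd \<sigma> aH k) M"
    define upd where "upd \<longleftrightarrow> snd \<sigma> aF k \<le> Bd \<and> (fst \<tau> vBest = 0 \<or> Suc ?val < fst \<tau> vBest)"
    have max: "snd \<sigma> aH k + (M - snd \<sigma> aH k) = ?val" by simp
    have new: "fst (sem body (setv vV k \<tau>)) vBest = (if upd then Suc ?val else fst \<tau> vBest)"
      "fst (sem body (setv vV k \<tau>)) vSol = (if upd then snd \<sigma> aG k else fst \<tau> vSol)"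
    proof -
      have "fst (sem body (setv vV k \<tau>)) vBest = (if upd then Suc ?val else fst \<tau> vBest) \<and>
        fst (sem body (setv vV k \<tau>)) vSol = (if upd then snd \<sigma> aG k else fst \<tau> vSol)"
      proof (cases "snd \<sigma> aF k \<le> Bd")
        case True
        consider "fst \<tau> vBest = 0" | "fst \<tau> vBest \<noteq> 0" "Suc ?val < fst \<tau> vBest"
          | "fst \<tau> vBest \<noteq> 0" "\<not> Suc ?val < fst \<tau> vBest" by blast
        then show ?thesis
        proof cases
          case 1
          then show ?thesis using True env * max by (simp add: body_def env_def upd_def)
        next
          case 2
          then show ?thesis using True env * max by (simp add: body_def env_def upd_def)
        next
          case 3
          then have "fst \<tau> vBest \<le> Suc ?val" by simp
          with 3 show ?thesis using True env * max by (simp add: body_def env_def upd_def)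
        qed
      next
        case False
        then show ?thesis using env * by (simp add: body_def env_def upd_def)
      qed
      then show "fst (sem body (setv vV k \<tau>)) vBest = (if upd then Suc ?val else fst \<tau> vBest)"
        "fst (sem body (setv vV k \<tau>)) vSol = (if upd then snd \<sigma> aG k else fst \<tau> vSol)" by auto
    qed
    show "?I (Suc k) (sem body (setv vV k \<tau>))"
    proof (cases upd)
      case True
      have "sound (Suc ?val) (snd \<sigma> aG k)"
      proof -
        have "snd \<sigma> aF k \<le> Bd" using True by (simp add: upd_def)
        from dp_ok_feasible[OF dp[rule_format, OF k'] k' this] obtain X where
          "feasible M X" "snd \<sigma> aG k = (\<Sum>j\<in>X. 2 ^ j)" "snd \<sigma> aH k = sum U X" .
        then show ?thesis unfolding sound_def by auto
      qed
      moreover have "fst \<tau> vBest = 0 \<or> Suc ?val \<le> fst \<tau> vBest" using True by (auto simp: upd_def)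
      ultimately show ?thesis unfolding new if_P[OF True] using I
        by (auto simp: less_Suc_eq intro: order_trans)
    next
      case False
      then have "snd \<sigma> aF k \<le> Bd \<Longrightarrow> fst \<tau> vBest \<noteq> 0 \<and> fst \<tau> vBest \<le> Suc ?val"
        by (auto simp: upd_def)
      then show ?thesis unfolding new if_not_P[OF False] using I by (auto simp: less_Suc_eq)
    qed
  qed
  then have I: "?I S (sem pick \<sigma>)" using assms(1) by (simp add: env_def)
  from I show "sound (fst (sem pick \<sigma>) vBest) (fst (sem pick \<sigma>) vSol)" by blast
  from I show "fst \<sigma> vBest \<noteq> 0 \<Longrightarrow> fst (sem pick \<sigma>) vBest \<noteq> 0 \<and> fst (sem pick \<sigma>) vBest \<le> fst \<sigma> vBest"
    by blast
  from I show "v < S \<Longrightarrow> snd \<sigma> aF v \<le> Bd \<Longrightarrow>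
      fst (sem pick \<sigma>) vBest \<noteq> 0 \<and> fst (sem pick \<sigma>) vBest \<le> Suc (max (snd \<sigma> aH v) M)"
    by blast
qed

text \<open>\<open>D\<close> holds the thresholds tried so far. The guarantee allows an additive
  loss of \<open>M / N0\<close>, multiplied out to stay in the naturals; the \<open>- 1\<close>
  undoes the \<open>Suc\<close> with which \<open>vBest\<close> is stored.\<close>

definition searched :: "nat set \<Rightarrow> state \<Rightarrow> bool" where
  "searched D \<sigma> \<longleftrightarrow> env \<sigma> \<and> sound (fst \<sigma> vBest) (fst \<sigma> vSol) \<and>
     (\<forall>M\<in>D. \<forall>Y. feasible M Y \<longrightarrow> fst \<sigma> vBest \<noteq> 0 \<and>
        N0 * (fst \<sigma> vBest - 1) \<le> N0 * max (sum U Y) M + M)"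

text \<open>For the new threshold the guarantee comes from \<open>dp_ok_near_optimal\<close>. For
  earlier ones it survives because \<open>pick\<close> never raises a nonzero
  \<open>vBest\<close>.\<close>

lemma attempt_sem:
  assumes "searched D \<sigma>" "fst \<sigma> vM = M"
  shows "searched (insert M D) (sem attempt \<sigma>)"
proof -
  have env: "env \<sigma>" and sound: "sound (fst \<sigma> vBest) (fst \<sigma> vSol)"
    and old: "\<And>M Y. M \<in> D \<Longrightarrow> feasible M Y \<Longrightarrow> fst \<sigma> vBest \<noteq> 0 \<and>
        N0 * (fst \<sigma> vBest - 1) \<le> N0 * max (sum U Y) M + M"
    using assms(1) unfolding searched_def by auto
  define \<sigma>1 where "\<sigma>1 = sem scale \<sigma>"
  define \<sigma>2 where "\<sigma>2 = sem dp_init \<sigma>1"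
  define \<sigma>3 where "\<sigma>3 = sem dp \<sigma>2"
  define \<sigma>4 where "\<sigma>4 = sem pick \<sigma>3"
  have att: "sem attempt \<sigma> = \<sigma>4" by (simp add: attempt_def \<sigma>1_def \<sigma>2_def \<sigma>3_def \<sigma>4_def)
  have env1: "env \<sigma>1" unfolding \<sigma>1_def by (rule env_sem[OF env]) simp_all
  have env2: "env \<sigma>2" unfolding \<sigma>2_def by (rule env_sem[OF env1]) simp_all
  have env3: "env \<sigma>3" unfolding \<sigma>3_def by (rule env_sem[OF env2]) simp_all
  have env4: "env \<sigma>4" unfolding \<sigma>4_def by (rule env_sem[OF env3]) simp_all
  have "\<forall>j<n. snd \<sigma>2 aUs j = us M j \<and> snd \<sigma>2 aVs j = vs M j"
    using scale_sem[OF env] assms(2) by (simp add: \<sigma>2_def \<sigma>1_def sem_frame)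
  moreover have "\<forall>v<S. snd \<sigma>2 aF v = 0 \<and> snd \<sigma>2 aG v = 0 \<and> snd \<sigma>2 aH v = 0"
    unfolding \<sigma>2_def by (rule dp_init_sem[OF env1])
  ultimately have dp: "\<forall>v<S. dp_ok M n v (snd \<sigma>3 aF v) (snd \<sigma>3 aG v) (snd \<sigma>3 aH v)"
    unfolding \<sigma>3_def by (rule dp_sem[OF env2])
  have b: "fst \<sigma>3 vBest = fst \<sigma> vBest" "fst \<sigma>3 vSol = fst \<sigma> vSol" "fst \<sigma>3 vM = M"
    using assms(2) by (simp_all add: \<sigma>3_def \<sigma>2_def \<sigma>1_def sem_frame)
  note pick = pick_sem[OF env3 b(3) dp, folded \<sigma>4_def, unfolded b, OF sound]
  have "fst \<sigma>4 vBest \<noteq> 0 \<and> N0 * (fst \<sigma>4 vBest - 1) \<le> N0 * max (sum U Y) M' + M'"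
    if "M' \<in> insert M D" "feasible M' Y" for M' Y
  proof (cases "M' = M")
    case True
    with that dp_ok_near_optimal[of M Y] obtain v where v: "v < S"
      "\<And>f g h. dp_ok M n v f g h \<Longrightarrow> f \<le> Bd \<and> N0 * h \<le> N0 * sum U Y + M" by metis
    from v(2)[OF dp[rule_format, OF v(1)]]
    have h: "snd \<sigma>3 aF v \<le> Bd" "N0 * snd \<sigma>3 aH v \<le> N0 * sum U Y + M" by auto
    from pick(3)[OF v(1) h(1)] have b4: "fst \<sigma>4 vBest \<noteq> 0" "fst \<sigma>4 vBest - 1 \<le> max (snd \<sigma>3 aH v) M"
      by auto
    have "N0 * (fst \<sigma>4 vBest - 1) \<le> N0 * max (snd \<sigma>3 aH v) M" using b4(2) by simp
    also have "\<dots> = max (N0 * snd \<sigma>3 aH v) (N0 * M)" by (simp add: max_def)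
    also have "\<dots> \<le> N0 * max (sum U Y) M + M"
    proof -
      have "N0 * sum U Y \<le> N0 * max (sum U Y) M" "N0 * M \<le> N0 * max (sum U Y) M" by simp_all
      then show ?thesis using h(2) by linarith
    qed
    finally show ?thesis using b4(1) True by simp
  next
    case False
    then have *: "fst \<sigma> vBest \<noteq> 0" "N0 * (fst \<sigma> vBest - 1) \<le> N0 * max (sum U Y) M' + M'"
      using old that by auto
    with pick(2) have p: "fst \<sigma>4 vBest \<noteq> 0" "fst \<sigma>4 vBest \<le> fst \<sigma> vBest" by auto
    have "N0 * (fst \<sigma>4 vBest - 1) \<le> N0 * (fst \<sigma> vBest - 1)"
      using p(2) by (intro mult_le_mono2 diff_le_mono)
    with * p(1) show ?thesis by linarith
  qed
  then show ?thesis unfolding att searched_def using env4 pick(1) by simp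
qed

lemma searched_setv:
  assumes "searched D \<sigma>"
  shows "searched D (setv vM c \<sigma>)" "searched D (setv vJ c \<sigma>)"
  using assms by (simp_all add: searched_def env_def)

lemma search_sem:
  assumes "env \<sigma>"
  shows "searched ({0} \<union> U ` {..<n} \<union> B ` {..<n}) (sem search \<sigma>)"
proof -
  let ?I = "\<lambda>k. searched ({0} \<union> U ` {..<k} \<union> B ` {..<k})"
  define body where "body = ReadA vM aU vJ ;; attempt ;; ReadA vM aB vJ ;; attempt"
  define \<sigma>1 where "\<sigma>1 = sem attempt (setv vM 0 (setv vSol 0 (setv vBest 0 \<sigma>)))"
  have "searched {} (setv vM 0 (setv vSol 0 (setv vBest 0 \<sigma>)))"
    using assms by (simp add: searched_def env_def sound_def)
  then have s1: "searched {0} \<sigma>1" unfolding \<sigma>1_def by (rule attempt_sem) simp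
  have "?I (fst \<sigma>1 vN) (sem (For vJ vN body) \<sigma>1)"
  proof (rule For_rule[where I = ?I])
    show "?I 0 \<sigma>1" using s1 by simp
    fix k \<tau>
    assume k: "k < fst \<sigma>1 vN" and I: "?I k \<tau>"
    have k': "k < n" using k s1 by (simp add: searched_def env_def)
    define \<tau>1 where "\<tau>1 = sem attempt (sem (ReadA vM aU vJ) (setv vJ k \<tau>))"
    have "env \<tau>" using I by (simp add: searched_def)
    have 1: "searched (insert (U k) ({0} \<union> U ` {..<k} \<union> B ` {..<k})) \<tau>1"
      unfolding \<tau>1_def
    proof (rule attempt_sem)
      show "searched ({0} \<union> U ` {..<k} \<union> B ` {..<k}) (sem (ReadA vM aU vJ) (setv vJ k \<tau>))"
        using I by (simp add: searched_setv)
      show "fst (sem (ReadA vM aU vJ) (setv vJ k \<tau>)) vM = U k"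
        using \<open>env \<tau>\<close> k' by (simp add: env_def)
    qed
    define \<tau>2 where "\<tau>2 = sem attempt (sem (ReadA vM aB vJ) \<tau>1)"
    have "env \<tau>1" using 1 by (simp add: searched_def)
    moreover have "fst \<tau>1 vJ = k" by (simp add: \<tau>1_def sem_frame)
    ultimately have "searched (insert (B k) (insert (U k) ({0} \<union> U ` {..<k} \<union> B ` {..<k}))) \<tau>2"
      unfolding \<tau>2_def using 1 k'
      by (intro attempt_sem) (simp_all add: searched_setv env_def)
    moreover have "insert (B k) (insert (U k) ({0} \<union> U ` {..<k} \<union> B ` {..<k})) =
        {0} \<union> U ` {..<Suc k} \<union> B ` {..<Suc k}" by (auto simp: lessThan_Suc)
    moreover have "sem body (setv vJ k \<tau>) = \<tau>2" by (simp add: body_def \<tau>2_def \<tau>1_def)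
    ultimately show "?I (Suc k) (sem body (setv vJ k \<tau>))" by simp
  qed
  moreover have "sem search \<sigma> = sem (For vJ vN body) \<sigma>1"
    by (simp add: search_def body_def \<sigma>1_def)
  moreover have "fst \<sigma>1 vN = n" using s1 by (simp add: searched_def env_def)
  ultimately show ?thesis by simp
qed

end

section \<open>Reading instances and writing schedules\<close>

text \<open>The instance takes \<open>4 * n + 1\<close> words, so the bound, \<open>p\<close> and
  \<open>q\<close> follow at that offset. \<open>vP\<close> is decremented because
  \<open>DivS\<close> divides by the successor.\<close>

definition init :: com where
  "init = SetC vZero 0 ;; SetC vOne 1 ;; ReadA vN aIn vZero ;;
     AddV vPtr vN vN ;; AddV vPtr vPtr vPtr ;; AddV vPtr vPtr vOne ;; ReadA vBd aIn vPtr ;;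
     AddV vPtr vPtr vOne ;; ReadA vP aIn vPtr ;; AddV vPtr vPtr vOne ;; ReadA vQ aIn vPtr ;;
     SubV vP vP vOne ;; DivS vK vQ vP ;; AddV vK vK vOne"

text \<open>Products by repeated addition. This stage stands apart because it assigns
  \<open>vR\<close> and \<open>vS\<close>, which are loop limits from then on.\<close>

definition sizes :: com where
  "sizes = SetC vR 0 ;; For vX vN (AddV vR vR vK ;; AddV vR vR vK) ;;
     SetC vS 1 ;; For vX vN (AddV vS vS vR)"

definition read_job :: com where
  "read_job = ReadA vA aIn vPtr ;; AddV vPtr vPtr vOne ;; ReadA vB aIn vPtr ;; AddV vPtr vPtr vOne ;;
     ReadA vC aIn vPtr ;; AddV vC vC vB ;; AddV vPtr vPtr vOne ;;
     ReadA vT aIn vPtr ;; AddV vT vT vC ;; AddV vPtr vPtr vOne"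

text \<open>The flag selects the objective: \<open>True\<close> is the cost (paid on the cloud side, with the
  deadline bounding the server side), \<open>False\<close> the makespan (paid on the server side, with the
  budget bounding the cloud side).\<close>

definition prep :: "bool \<Rightarrow> com" where
  "prep cost = SetC vPw 1 ;; SetC vPtr 1 ;; For vI vN (
     read_job ;;
     (if cost
      then WriteA aU vI vB ;; WriteA aV vI vA ;; SubV vT2 vT vBd ;; WriteA aL vI vT2 ;; WriteA aB vI vZero
      else WriteA aU vI vA ;; WriteA aV vI vB ;; WriteA aL vI vZero ;; WriteA aB vI vT) ;;
     WriteA aPw vI vPw ;; AddV vPw vPw vPw)"

definition decode :: com where
  "decode = For vX vN (
     SubV vT vN vOne ;; SubV vT vT vX ;; ReadA vA aPw vT ;; SubV vB vA vSol ;;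
     IfZ vB (SubV vSol vSol vA ;; WriteA aSel vT vOne) (WriteA aSel vT vZero))"

definition on_server :: com where
  "on_server = SetC vV 0 ;; AddV vAcc vAcc vA ;; AddV vU vAcc vZero"

definition on_cloud :: com where
  "on_cloud = SetC vV 1 ;; AddV vU vC vZero ;; SubV vT vT vMax ;; AddV vMax vMax vT"

definition emit_job :: "bool \<Rightarrow> com" where
  "emit_job cost = read_job ;; ReadA vX aSel vI ;;
     (if cost then IfZ vX on_server on_cloud else IfZ vX on_cloud on_server) ;;
     WriteA aOut vD vV ;; AddV vD vD vOne ;; WriteA aOut vD vU ;; AddV vD vD vOne"

text \<open>Entry 0 of \<open>aOut\<close> is the output length and entries 1 and 2 belong to the
  source. At the end \<open>vD\<close> is the index of the last entry, which equals that length
  because the output starts at index 1.\<close>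

definition emit :: "bool \<Rightarrow> com" where
  "emit cost = SetC vAcc 0 ;; SetC vMax 0 ;; SetC vPtr 1 ;; SetC vD 3 ;; SetC vT 2 ;;
     WriteA aOut vOne vZero ;; WriteA aOut vT vZero ;;
     For vI vN (emit_job cost) ;;
     WriteA aOut vD vZero ;; AddV vD vD vOne ;; SubV vT vMax vAcc ;; AddV vT vT vAcc ;;
     WriteA aOut vD vT ;; WriteA aOut vZero vD"

definition write_output :: "bool \<Rightarrow> com" where
  "write_output cost = IfZ vBest (WriteA aOut vZero vZero ;; WriteA aOut vOne vZero) (decode ;; emit cost)"

definition prog :: "bool \<Rightarrow> com" where
  "prog cost = init ;; sizes ;; prep cost ;; search ;; write_output cost"

lemma written' [simp]:
  "vars_written read_job = {vA, vPtr, vB, vC, vT}" "arrs_written read_job = {}"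
  "vars_written (prep cost) \<subseteq> {vPw, vPtr, vI, vA, vB, vC, vT, vT2}"
  "arrs_written (prep cost) = {aU, aV, aL, aB, aPw}"
  "vars_written decode = {vX, vT, vA, vB, vSol}" "arrs_written decode = {aSel}"
  "vars_written (emit_job cost) = {vA, vPtr, vB, vC, vT, vX, vV, vAcc, vU, vMax, vD}"
  "arrs_written (emit_job cost) = {aOut}"
  "vars_written search \<subseteq> {vBest, vSol, vM, vJ} \<union> vars_written attempt"
  "arrs_written search = arrs_written attempt"
  by (auto simp: read_job_def prep_def decode_def emit_job_def on_server_def on_cloud_def search_def)

lemma length_enc_fp: "length (enc_fp xs) = 4 * length xs + 1"
  unfolding enc_fp_def by (induction xs) auto

lemma enc_fp_nth:
  assumes "j < length xs"
  shows "enc_fp xs ! (4 * j + 1) = fp_ps xs (Suc j)"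
    "enc_fp xs ! (4 * j + 2) = fp_pc xs (Suc j)"
    "enc_fp xs ! (4 * j + 3) = fp_c xs (0, Suc j)"
    "enc_fp xs ! (4 * j + 4) = fp_c xs (Suc j, Suc (length xs))"
proof -
  obtain a b ci co where x: "xs ! j = (a, b, ci, co)" by (cases "xs ! j") auto
  have *: "concat (map (\<lambda>(a, b, ci, co). [a, b, ci, co]) xs) ! (4 * j) = a \<and>
    concat (map (\<lambda>(a, b, ci, co). [a, b, ci, co]) xs) ! (4 * j + 1) = b \<and>
    concat (map (\<lambda>(a, b, ci, co). [a, b, ci, co]) xs) ! (4 * j + 2) = ci \<and>
    concat (map (\<lambda>(a, b, ci, co). [a, b, ci, co]) xs) ! (4 * j + 3) = co"
    using assms x
  proof (induction xs arbitrary: j)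
    case (Cons y ys)
    show ?case
    proof (cases j)
      case 0
      then show ?thesis using Cons.prems by (simp add: eval_nat_numeral)
    next
      case (Suc i)
      obtain a' b' ci' co' where y: "y = (a', b', ci', co')" by (cases y) auto
      show ?thesis using Cons.IH[of i] Cons.prems Suc y by (simp add: eval_nat_numeral)
    qed
  qed simp
  show "enc_fp xs ! (4 * j + 1) = fp_ps xs (Suc j)"
    "enc_fp xs ! (4 * j + 2) = fp_pc xs (Suc j)"
    "enc_fp xs ! (4 * j + 3) = fp_c xs (0, Suc j)"
    "enc_fp xs ! (4 * j + 4) = fp_c xs (Suc j, Suc (length xs))"
    using * x assms
    by (simp_all add: enc_fp_def fp_ps_def fp_pc_def fp_c_def fp_inner_def nth_Cons' eval_nat_numeral)
qed

section \<open>The scheduling instance as a knapsack instance\<close>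

locale fp_run =
  fixes xs :: fp_inst and d p q :: nat and cost :: bool
  assumes p: "0 < p" and q: "0 < q"
begin

abbreviation n :: nat where "n \<equiv> length xs"
abbreviation ps :: "nat \<Rightarrow> nat" where "ps j \<equiv> fp_ps xs (Suc j)"
abbreviation pc :: "nat \<Rightarrow> nat" where "pc j \<equiv> fp_pc xs (Suc j)"
abbreviation ci :: "nat \<Rightarrow> nat" where "ci j \<equiv> fp_c xs (0, Suc j)"
abbreviation co :: "nat \<Rightarrow> nat" where "co j \<equiv> fp_c xs (Suc j, Suc n)"
abbreviation w :: "nat \<Rightarrow> nat" where "w j \<equiv> ci j + pc j + co j"
abbreviation inp :: "nat list" where "inp \<equiv> enc_fp xs @ [d, p, q]"

definition U where "U j = (if cost then pc j else ps j)"
definition V where "V j = (if cost then ps j else pc j)"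
text \<open>For the cost objective this is nonzero exactly when the job would miss the deadline on
  the cloud.\<close>

definition L where "L j = (if cost then w j - d else 0)"
text \<open>For the makespan objective a cloud job forces the makespan up to \<open>w j\<close>, so
  \<open>w j\<close> must not exceed the threshold.\<close>

definition B where "B j = (if cost then 0 else w j)"
text \<open>The least convenient integer above \<open>q / p\<close>, so that \<open>1 / N0\<close>
  is below the permitted relative error.\<close>

definition N0 where "N0 = Suc (q div p)"
definition R where "R = 2 * n * N0"
definition S where "S = Suc (n * R)"

sublocale knapsack n d R S N0 U V L B
  by unfold_locales (simp_all add: N0_def R_def S_def)

definition input_ok :: "state \<Rightarrow> bool" where
  "input_ok \<sigma> \<longleftrightarrow> snd \<sigma> aIn = input_arrays inp aIn"

lemma input_okD:
  assumes "input_ok \<sigma>"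
  shows "snd \<sigma> aIn 0 = n" "snd \<sigma> aIn (4 * n + 1) = d" "snd \<sigma> aIn (4 * n + 2) = p"
    "snd \<sigma> aIn (4 * n + 3) = q"
    "j < n \<Longrightarrow> snd \<sigma> aIn (4 * j + 1) = ps j" "j < n \<Longrightarrow> snd \<sigma> aIn (4 * j + 2) = pc j"
    "j < n \<Longrightarrow> snd \<sigma> aIn (4 * j + 3) = ci j" "j < n \<Longrightarrow> snd \<sigma> aIn (4 * j + 4) = co j"
proof -
  have *: "snd \<sigma> aIn i = (if i < 4 * n + 4 then inp ! i else 0)" for i
    using assms by (simp add: input_ok_def input_arrays_def length_enc_fp)
  show "snd \<sigma> aIn 0 = n" by (simp add: * nth_append length_enc_fp) (simp add: enc_fp_def)
  show "snd \<sigma> aIn (4 * n + 1) = d" "snd \<sigma> aIn (4 * n + 2) = p" "snd \<sigma> aIn (4 * n + 3) = q"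
    by (simp_all add: * nth_append length_enc_fp)
  show "j < n \<Longrightarrow> snd \<sigma> aIn (4 * j + 1) = ps j" "j < n \<Longrightarrow> snd \<sigma> aIn (4 * j + 2) = pc j"
    "j < n \<Longrightarrow> snd \<sigma> aIn (4 * j + 3) = ci j" "j < n \<Longrightarrow> snd \<sigma> aIn (4 * j + 4) = co j"
    using enc_fp_nth[of j xs] by (simp_all add: * nth_append length_enc_fp)
qed

lemma read_job_sem:
  assumes "input_ok \<sigma>" "fst \<sigma> vOne = 1" "fst \<sigma> vPtr = 4 * j + 1" "j < n"
  shows "fst (sem read_job \<sigma>) vA = ps j" "fst (sem read_job \<sigma>) vB = pc j"
    "fst (sem read_job \<sigma>) vC = ci j + pc j" "fst (sem read_job \<sigma>) vT = w j"
    "fst (sem read_job \<sigma>) vPtr = 4 * Suc j + 1" "snd (sem read_job \<sigma>) = snd \<sigma>"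
  using assms input_okD(5-8)[OF assms(1,4)] by (simp_all add: read_job_def nat_offsets)

lemma init_sem:
  assumes "input_ok \<sigma>"
  shows "snd (sem init \<sigma>) = snd \<sigma>" "fst (sem init \<sigma>) vZero = 0" "fst (sem init \<sigma>) vOne = 1"
    "fst (sem init \<sigma>) vN = n" "fst (sem init \<sigma>) vBd = d" "fst (sem init \<sigma>) vK = N0"
proof -
  note i = input_okD(1-4)[OF assms]
  have *: "n + n + (n + n) = 4 * n" by simp
  show "snd (sem init \<sigma>) = snd \<sigma>" "fst (sem init \<sigma>) vZero = 0" "fst (sem init \<sigma>) vOne = 1"
    "fst (sem init \<sigma>) vN = n" "fst (sem init \<sigma>) vBd = d" "fst (sem init \<sigma>) vK = N0"
    using i p by (simp_all add: init_def N0_def * nat_offsets)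
qed

lemma sizes_sem:
  assumes "fst \<sigma> vN = n" "fst \<sigma> vK = N0"
  shows "fst (sem sizes \<sigma>) vR = R" "fst (sem sizes \<sigma>) vS = S"
    "snd (sem sizes \<sigma>) = snd \<sigma>" "x \<notin> {vR, vS, vX} \<Longrightarrow> fst (sem sizes \<sigma>) x = fst \<sigma> x"
proof -
  define \<sigma>1 where "\<sigma>1 = sem (For vX vN (AddV vR vR vK ;; AddV vR vR vK)) (setv vR 0 \<sigma>)"
  define \<sigma>2 where "\<sigma>2 = sem (For vX vN (AddV vS vS vR)) (setv vS 1 \<sigma>1)"
  have s: "sem sizes \<sigma> = \<sigma>2" by (simp add: sizes_def \<sigma>1_def \<sigma>2_def)
  have "fst \<sigma>1 vR = fst (setv vR 0 \<sigma>) vN * (2 * N0)"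
    unfolding \<sigma>1_def
    by (rule For_rule[where I = "\<lambda>k \<tau>. fst \<tau> vR = k * (2 * N0)"])
      (use assms in \<open>auto simp: agree_def\<close>)
  then have 1: "fst \<sigma>1 vR = R" using assms by (simp add: R_def)
  have f1: "fst \<sigma>1 x = fst \<sigma> x" if "x \<notin> {vR, vX}" for x
    using that by (simp add: \<sigma>1_def sem_frame)
  have "fst \<sigma>2 vS = Suc (fst (setv vS 1 \<sigma>1) vN * R)"
    unfolding \<sigma>2_def
    by (rule For_rule[where I = "\<lambda>k \<tau>. fst \<tau> vS = Suc (k * R)"])
      (use 1 in \<open>auto simp: agree_def\<close>)
  then show "fst (sem sizes \<sigma>) vS = S" using assms(1) f1[of vN] by (simp add: s S_def)
  show "fst (sem sizes \<sigma>) vR = R" using 1 by (simp add: s \<sigma>2_def sem_frame)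
  show "snd (sem sizes \<sigma>) = snd \<sigma>"
    by (rule ext, simp add: s \<sigma>2_def \<sigma>1_def sem_frame)
  show "x \<notin> {vR, vS, vX} \<Longrightarrow> fst (sem sizes \<sigma>) x = fst \<sigma> x"
    using f1[of x] by (simp add: s \<sigma>2_def sem_frame)
qed

lemma prep_sem:
  assumes "input_ok \<sigma>" "fst \<sigma> vZero = 0" "fst \<sigma> vOne = 1" "fst \<sigma> vN = n" "fst \<sigma> vBd = d"
    "fst \<sigma> vR = R" "fst \<sigma> vS = S"
  shows "env (sem (prep cost) \<sigma>)"
proof -
  define body where "body = read_job ;;
     (if cost
      then WriteA aU vI vB ;; WriteA aV vI vA ;; SubV vT2 vT vBd ;; WriteA aL vI vT2 ;; WriteA aB vI vZero
      else WriteA aU vI vA ;; WriteA aV vI vB ;; WriteA aL vI vZero ;; WriteA aB vI vT) ;;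
     WriteA aPw vI vPw ;; AddV vPw vPw vPw"
  have wr: "vars_written body \<subseteq> {vPw, vPtr, vA, vB, vC, vT, vT2}"
    "arrs_written body = {aU, aV, aL, aB, aPw}" by (auto simp: body_def)
  let ?I = "\<lambda>k \<tau>. fst \<tau> vPw = 2 ^ k \<and> fst \<tau> vPtr = 4 * k + 1 \<and> (\<forall>j<k. snd \<tau> aU j = U j \<and>
     snd \<tau> aV j = V j \<and> snd \<tau> aL j = L j \<and> snd \<tau> aB j = B j \<and> snd \<tau> aPw j = 2 ^ j)"
  let ?\<sigma> = "setv vPtr 1 (setv vPw 1 \<sigma>)"
  have "?I (fst ?\<sigma> vN) (sem (For vI vN body) ?\<sigma>)"
  proof (rule For_rule[where I = ?I])
    show "?I 0 ?\<sigma>" by simp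
    fix k \<tau>
    assume k: "k < fst ?\<sigma> vN" and a: "agree (For vI vN body) ?\<sigma> \<tau>" and I: "?I k \<tau>"
    have k': "k < n" using k assms by simp
    have *: "fst \<tau> vZero = 0" "fst \<tau> vOne = 1" "fst \<tau> vBd = d" "input_ok \<tau>"
    proof -
      have "fst \<tau> x = fst ?\<sigma> x" if "x \<in> {vZero, vOne, vBd}" for x
        using that wr by (intro agreeD(1)[OF a]) auto
      then show "fst \<tau> vZero = 0" "fst \<tau> vOne = 1" "fst \<tau> vBd = d" using assms by simp_all
      have "snd \<tau> aIn = snd ?\<sigma> aIn" by (rule agreeD(2)[OF a]) (simp add: wr)
      then show "input_ok \<tau>" using assms(1) by (simp add: input_ok_def)
    qed
    define \<tau>1 where "\<tau>1 = sem read_job (setv vI k \<tau>)"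
    have "input_ok (setv vI k \<tau>)" using *(4) by (simp add: input_ok_def)
    then have r: "fst \<tau>1 vA = ps k" "fst \<tau>1 vB = pc k" "fst \<tau>1 vT = w k" "fst \<tau>1 vPtr = 4 * Suc k + 1"
      "snd \<tau>1 = snd \<tau>" "fst \<tau>1 vI = k" "fst \<tau>1 vZero = 0" "fst \<tau>1 vBd = d" "fst \<tau>1 vPw = 2 ^ k"
      unfolding \<tau>1_def using read_job_sem[of "setv vI k \<tau>" k] * k' I
      by (simp_all add: sem_frame)
    let ?\<tau> = "sem body (setv vI k \<tau>)"
    have newc: "snd ?\<tau> aU = (snd \<tau> aU)(k := U k) \<and>
      snd ?\<tau> aV = (snd \<tau> aV)(k := V k) \<and>
      snd ?\<tau> aL = (snd \<tau> aL)(k := L k) \<and>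
      snd ?\<tau> aB = (snd \<tau> aB)(k := B k) \<and>
      snd ?\<tau> aPw = (snd \<tau> aPw)(k := 2 ^ k) \<and>
      fst ?\<tau> vPw = 2 ^ Suc k \<and>
      fst ?\<tau> vPtr = 4 * Suc k + 1"
    proof (cases cost)
      case True
      have "?\<tau> = sem (WriteA aU vI vB ;; WriteA aV vI vA ;; SubV vT2 vT vBd ;; WriteA aL vI vT2 ;;
          WriteA aB vI vZero ;; WriteA aPw vI vPw ;; AddV vPw vPw vPw) \<tau>1"
        unfolding body_def if_P[OF True] by (simp only: sem_apply(7) \<tau>1_def)
      moreover have "U k = pc k" "V k = ps k" "L k = w k - d" "B k = 0"
        unfolding U_def V_def L_def B_def if_P[OF True] by (rule refl)+
      ultimately show ?thesis by (simp add: r)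
    next
      case False
      have "?\<tau> = sem (WriteA aU vI vA ;; WriteA aV vI vB ;; WriteA aL vI vZero ;; WriteA aB vI vT ;;
          WriteA aPw vI vPw ;; AddV vPw vPw vPw) \<tau>1"
        unfolding body_def if_not_P[OF False] by (simp only: sem_apply(7) \<tau>1_def)
      moreover have "U k = ps k" "V k = pc k" "L k = 0" "B k = w k"
        unfolding U_def V_def L_def B_def if_not_P[OF False] by (rule refl)+
      ultimately show ?thesis by (simp add: r)
    qed
    have new: "snd ?\<tau> aU = (snd \<tau> aU)(k := U k)"
      "snd ?\<tau> aV = (snd \<tau> aV)(k := V k)"
      "snd ?\<tau> aL = (snd \<tau> aL)(k := L k)"
      "snd ?\<tau> aB = (snd \<tau> aB)(k := B k)"
      "snd ?\<tau> aPw = (snd \<tau> aPw)(k := 2 ^ k)"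
      "fst ?\<tau> vPw = 2 ^ Suc k"
      "fst ?\<tau> vPtr = 4 * Suc k + 1"
      using newc by blast+
    have "snd ?\<tau> aU j = U j \<and> snd ?\<tau> aV j = V j \<and> snd ?\<tau> aL j = L j \<and> snd ?\<tau> aB j = B j \<and>
      snd ?\<tau> aPw j = 2 ^ j" if "j < Suc k" for j
    proof -
      from that consider "j < k" | "j = k" by linarith
      then show ?thesis unfolding new by cases (use I in simp_all)
    qed
    then show "?I (Suc k) ?\<tau>" using new(6,7) by blast
  qed
  moreover have "sem (prep cost) \<sigma> = sem (For vI vN body) ?\<sigma>" by (simp add: prep_def body_def)
  moreover have "fst (sem (For vI vN body) ?\<sigma>) x = fst \<sigma> x"
    if "x \<in> {vZero, vOne, vN, vBd, vR, vS}" for x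
  proof -
    have "x \<notin> vars_written (For vI vN body)" using that wr(1) by auto
    then have "fst (sem (For vI vN body) ?\<sigma>) x = fst ?\<sigma> x" by (rule sem_frame(1))
    then show ?thesis using that by auto
  qed
  ultimately show ?thesis using assms by (simp add: env_def)
qed

lemma sum_powers_less: "X \<subseteq> {..<t} \<Longrightarrow> (\<Sum>j\<in>X. 2 ^ j) < (2 :: nat) ^ t"
proof -
  assume "X \<subseteq> {..<t}"
  then have "(\<Sum>j\<in>X. 2 ^ j) \<le> (\<Sum>j<t. 2 ^ j :: nat)" by (intro sum_mono2) auto
  also have "\<dots> < 2 ^ t" by (induction t) auto
  finally show ?thesis .
qed

text \<open>Bits are extracted from the top. All powers below \<open>2 ^ t\<close> together stay
  below \<open>2 ^ t\<close>, so bit \<open>t\<close> is set exactly when the remaining mask is at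
  least \<open>2 ^ t\<close>.\<close>

lemma decode_sem:
  assumes "env \<sigma>" "X \<subseteq> {..<n}" "fst \<sigma> vSol = (\<Sum>j\<in>X. 2 ^ j)"
  shows "\<forall>j<n. snd (sem decode \<sigma>) aSel j = (if j \<in> X then 1 else 0)"
proof -
  let ?I = "\<lambda>k \<tau>. fst \<tau> vSol = (\<Sum>j \<in> X \<inter> {..<n - k}. 2 ^ j) \<and>
     (\<forall>j. n - k \<le> j \<and> j < n \<longrightarrow> snd \<tau> aSel j = (if j \<in> X then 1 else 0))"
  define body where "body =
     SubV vT vN vOne ;; SubV vT vT vX ;; ReadA vA aPw vT ;; SubV vB vA vSol ;;
     IfZ vB (SubV vSol vSol vA ;; WriteA aSel vT vOne) (WriteA aSel vT vZero)"
  have "?I (fst \<sigma> vN) (sem decode \<sigma>)"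
    unfolding decode_def body_def[symmetric]
  proof (rule For_rule[where I = ?I])
    show "?I 0 \<sigma>" using assms by (simp add: Int_absorb2)
    fix k \<tau>
    assume k: "k < fst \<sigma> vN" and a: "agree (For vX vN body) \<sigma> \<tau>" and I: "?I k \<tau>"
    have k': "k < n" using k assms(1) by (simp add: env_def)
    have env: "env \<tau>" by (rule env_agree[OF assms(1) a]) (simp_all add: body_def)
    define t where "t = n - Suc 0 - k"
    have t: "n - k = Suc t" "n - Suc k = t" "t < n" using k' by (auto simp: t_def)
    have less: "(\<Sum>j \<in> X \<inter> {..<t}. 2 ^ j) < (2::nat) ^ t" by (rule sum_powers_less) auto
    let ?\<tau> = "sem body (setv vX k \<tau>)"
    have sol: "fst \<tau> vSol = (if t \<in> X then 2 ^ t else 0) + (\<Sum>j \<in> X \<inter> {..<t}. 2 ^ j)"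
    proof -
      have "X \<inter> {..<Suc t} = (if t \<in> X then insert t (X \<inter> {..<t}) else X \<inter> {..<t})"
        by (auto simp: lessThan_Suc)
      then show ?thesis using I t(1) by simp
    qed
    have new: "fst ?\<tau> vSol = (\<Sum>j \<in> X \<inter> {..<t}. 2 ^ j) \<and>
      snd ?\<tau> aSel = (snd \<tau> aSel)(t := if t \<in> X then 1 else 0)"
    proof (cases "t \<in> X")
      case True
      then have "2 ^ t \<le> fst \<tau> vSol" "fst \<tau> vSol - 2 ^ t = (\<Sum>j \<in> X \<inter> {..<t}. 2 ^ j)"
        using sol by simp_all
      then show ?thesis using True env t(3) by (simp add: body_def env_def t_def)
    next
      case False
      then have "fst \<tau> vSol < 2 ^ t" "fst \<tau> vSol = (\<Sum>j \<in> X \<inter> {..<t}. 2 ^ j)"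
        using sol less by simp_all
      then show ?thesis using False env t(3) by (simp add: body_def env_def t_def)
    qed
    have "snd ?\<tau> aSel j = (if j \<in> X then 1 else 0)" if "t \<le> j" "j < n" for j
      using new I that t by (cases "j = t") auto
    then show "?I (Suc k) ?\<tau>" using new t(2) by simp
  qed
  then show ?thesis using assms(1) by (simp add: env_def)
qed

text \<open>The maximum of the server load and the cloud times, expressed as an attained upper bound
  to avoid a maximum over a possibly empty set.\<close>

definition makespan_of :: "nat set \<Rightarrow> nat \<Rightarrow> bool" where
  "makespan_of K T \<longleftrightarrow> sum ps ({..<n} - K) \<le> T \<and> (\<forall>j\<in>K. w j \<le> T) \<and>
     (T = sum ps ({..<n} - K) \<or> (\<exists>j\<in>K. T = w j))"

text \<open>After the length, each job has a pair of side and completion time; inner job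
  \<open>Suc j\<close> sits at \<open>2 * j + 3\<close>, the sink at \<open>2 * n + 3\<close>.
  Server jobs run back to back in index order, and cloud jobs start as soon as their input has
  arrived.\<close>

definition schedule_out :: "nat set \<Rightarrow> nat \<Rightarrow> (nat \<Rightarrow> nat) \<Rightarrow> bool" where
  "schedule_out K T out \<longleftrightarrow> out 0 = 2 * n + 4 \<and> out 1 = 0 \<and> out 2 = 0 \<and>
     (\<forall>j<n. out (2 * j + 3) = (if j \<in> K then 1 else 0) \<and>
        out (2 * j + 4) = (if j \<in> K then ci j + pc j else sum ps ({..j} - K))) \<and>
     out (2 * n + 3) = 0 \<and> out (2 * n + 4) = T"

text \<open>\<open>aSel\<close> marks the objective side, which is the cloud for the cost and the
  server for the makespan; hence the form of the last assumption.\<close>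

lemma emit_sem:
  assumes "env \<sigma>" "input_ok \<sigma>" "K \<subseteq> {..<n}"
    and sel: "\<And>j. j < n \<Longrightarrow> snd \<sigma> aSel j = 0 \<longleftrightarrow> (j \<in> K \<longleftrightarrow> \<not> cost)"
  obtains T where "makespan_of K T" "schedule_out K T (snd (sem (emit cost) \<sigma>) aOut)"
proof -
  \<comment> \<open>The first fact is how the program forms maxima; the second separates side
    entries from completion entries by parity.\<close>
  have max: "a + (b - a) = max a b" and odd: "2 * a + 3 \<noteq> 2 * b + 4" for a b :: nat
    by (simp, presburger)
  let ?J = "\<lambda>k acc mx out. acc = sum ps ({..<k} - K) \<and> (\<forall>j\<in>K. j < k \<longrightarrow> w j \<le> mx) \<and>
     (mx = 0 \<or> (\<exists>j\<in>K. mx = w j)) \<and> out 1 = 0 \<and> out 2 = 0 \<and>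
     (\<forall>j<k. out (2 * j + 3) = (if j \<in> K then 1 else 0) \<and>
        out (2 * j + 4) = (if j \<in> K then ci j + pc j else sum ps ({..j} - K)))"
  let ?I = "\<lambda>k \<tau>. fst \<tau> vPtr = 4 * k + 1 \<and> fst \<tau> vD = 2 * k + 3 \<and>
     ?J k (fst \<tau> vAcc) (fst \<tau> vMax) (snd \<tau> aOut)"
  let ?c = "SetC vAcc 0 ;; SetC vMax 0 ;; SetC vPtr 1 ;; SetC vD 3 ;; SetC vT 2 ;;
     WriteA aOut vOne vZero ;; WriteA aOut vT vZero"
  define \<sigma>1 where "\<sigma>1 = sem ?c \<sigma>"
  have env1: "env \<sigma>1" unfolding \<sigma>1_def by (rule env_sem[OF assms(1)]) simp_all
  have in1: "input_ok \<sigma>1" using assms(2) by (simp add: \<sigma>1_def input_ok_def)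
  have sel1: "snd \<sigma>1 aSel = snd \<sigma> aSel" by (simp add: \<sigma>1_def)
  have "?I (fst \<sigma>1 vN) (sem (For vI vN (emit_job cost)) \<sigma>1)"
  proof (rule For_rule[where I = ?I])
    show "?I 0 \<sigma>1" using assms(1) by (simp add: \<sigma>1_def env_def)
    fix k \<tau>
    assume k: "k < fst \<sigma>1 vN" and a: "agree (For vI vN (emit_job cost)) \<sigma>1 \<tau>" and I: "?I k \<tau>"
    have k': "k < n" using k env1 by (simp add: env_def)
    have env: "env \<tau>" by (rule env_agree[OF env1 a]) simp_all
    have inp: "input_ok \<tau>" using a in1 by (simp add: input_ok_def agree_def)
    have sel2: "snd \<tau> aSel k = 0 \<longleftrightarrow> (k \<in> K \<longleftrightarrow> \<not> cost)" using a sel1 sel[OF k'] by (simp add: agree_def)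
    define \<tau>1 where "\<tau>1 = sem read_job (setv vI k \<tau>)"
    have "input_ok (setv vI k \<tau>)" using inp by (simp add: input_ok_def)
    then have r: "fst \<tau>1 vA = ps k" "fst \<tau>1 vC = ci k + pc k" "fst \<tau>1 vT = w k"
      "fst \<tau>1 vPtr = 4 * Suc k + 1" "snd \<tau>1 = snd \<tau>" "fst \<tau>1 vI = k" "fst \<tau>1 vZero = 0"
      "fst \<tau>1 vOne = 1" "fst \<tau>1 vD = 2 * k + 3" "fst \<tau>1 vAcc = fst \<tau> vAcc" "fst \<tau>1 vMax = fst \<tau> vMax"
      unfolding \<tau>1_def using read_job_sem[of "setv vI k \<tau>" k] env k' I
      by (simp_all add: sem_frame env_def)
    let ?\<tau> = "sem (emit_job cost) (setv vI k \<tau>)"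
    have new: "fst ?\<tau> vPtr = 4 * Suc k + 1 \<and> fst ?\<tau> vD = 2 * Suc k + 3 \<and>
      fst ?\<tau> vAcc = (if k \<in> K then fst \<tau> vAcc else fst \<tau> vAcc + ps k) \<and>
      fst ?\<tau> vMax = (if k \<in> K then max (fst \<tau> vMax) (w k) else fst \<tau> vMax) \<and>
      snd ?\<tau> aOut = (snd \<tau> aOut)(2 * k + 3 := if k \<in> K then 1 else 0,
        2 * k + 4 := if k \<in> K then ci k + pc k else fst \<tau> vAcc + ps k)"
    proof -
      have em: "?\<tau> = sem (ReadA vX aSel vI ;;
         (if cost then IfZ vX on_server on_cloud else IfZ vX on_cloud on_server) ;;
         WriteA aOut vD vV ;; AddV vD vD vOne ;; WriteA aOut vD vU ;; AddV vD vD vOne) \<tau>1"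
        by (simp only: emit_job_def sem_apply(7) \<tau>1_def)
      show ?thesis
      proof (cases "k \<in> K")
        case True
        then have "snd \<tau> aSel k = 0 \<longleftrightarrow> \<not> cost" using sel2 by simp
        then show ?thesis unfolding em using True
          by (cases cost) (simp_all add: r on_server_def on_cloud_def max add.commute[of "2 * k" 4])
      next
        case False
        then have "snd \<tau> aSel k = 0 \<longleftrightarrow> cost" using sel2 by simp
        then show ?thesis unfolding em using False
          by (cases cost) (simp_all add: r on_server_def on_cloud_def add.commute[of "2 * k" 4])
      qed
    qed
    have dif: "{..<Suc k} - K = (if k \<in> K then {..<k} - K else insert k ({..<k} - K))"
      by (auto simp: lessThan_Suc)
    have I': "fst \<tau> vAcc = sum ps ({..<k} - K)" "\<And>j. j \<in> K \<Longrightarrow> j < k \<Longrightarrow> w j \<le> fst \<tau> vMax"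
      "fst \<tau> vMax = 0 \<or> (\<exists>j\<in>K. fst \<tau> vMax = w j)" "snd \<tau> aOut 1 = 0" "snd \<tau> aOut 2 = 0"
      "\<And>j. j < k \<Longrightarrow> snd \<tau> aOut (2 * j + 3) = (if j \<in> K then 1 else 0)"
      "\<And>j. j < k \<Longrightarrow> snd \<tau> aOut (2 * j + 4) = (if j \<in> K then ci j + pc j else sum ps ({..j} - K))"
      using I by blast+
    have new': "fst ?\<tau> vAcc = (if k \<in> K then fst \<tau> vAcc else fst \<tau> vAcc + ps k)"
      "fst ?\<tau> vMax = (if k \<in> K then max (fst \<tau> vMax) (w k) else fst \<tau> vMax)"
      "snd ?\<tau> aOut = (snd \<tau> aOut)(2 * k + 3 := if k \<in> K then 1 else 0,
        2 * k + 4 := if k \<in> K then ci k + pc k else fst \<tau> vAcc + ps k)"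
      using new by blast+
    have acc: "fst ?\<tau> vAcc = sum ps ({..<Suc k} - K)"
      unfolding new' dif I'(1) by (cases "k \<in> K") simp_all
    have "?J (Suc k) (fst ?\<tau> vAcc) (fst ?\<tau> vMax) (snd ?\<tau> aOut)"
    proof (intro conjI ballI allI impI)
      show "fst ?\<tau> vAcc = sum ps ({..<Suc k} - K)" by (rule acc)
      show "w j \<le> fst ?\<tau> vMax" if "j \<in> K" "j < Suc k" for j
      proof (cases "j = k")
        case True
        then show ?thesis unfolding new' using that(1) by simp
      next
        case False
        then have "w j \<le> fst \<tau> vMax" using that I'(2) by simp
        also have "\<dots> \<le> fst ?\<tau> vMax" unfolding new' by (cases "k \<in> K") simp_all
        finally show ?thesis .
      qed
      show "fst ?\<tau> vMax = 0 \<or> (\<exists>j\<in>K. fst ?\<tau> vMax = w j)"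
      proof (cases "k \<in> K \<and> fst \<tau> vMax \<le> w k")
        case True
        then have "fst ?\<tau> vMax = w k" unfolding new' by simp
        then show ?thesis using True by blast
      next
        case False
        then have "fst ?\<tau> vMax = fst \<tau> vMax" unfolding new' by auto
        then show ?thesis using I'(3) by simp
      qed
      show "snd ?\<tau> aOut 1 = 0" "snd ?\<tau> aOut 2 = 0" unfolding new' using I'(4,5) by simp_all
      fix j assume j: "j < Suc k"
      show "snd ?\<tau> aOut (2 * j + 3) = (if j \<in> K then 1 else 0)"
      proof (cases "j = k")
        case True
        then show ?thesis unfolding new' using odd[of k k] by (simp only: fun_upd_apply if_False refl if_True)
      next
        case False
        then have ne: "2 * j + 3 \<noteq> 2 * k + 4" "2 * j + 3 \<noteq> 2 * k + 3" using odd by auto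
        show ?thesis unfolding new' fun_upd_other[OF ne(1)] fun_upd_other[OF ne(2)]
          using I'(6) False j by simp
      qed
      show "snd ?\<tau> aOut (2 * j + 4) = (if j \<in> K then ci j + pc j else sum ps ({..j} - K))"
      proof (cases "j = k")
        case True
        have "{..k} = {..<Suc k}" by auto
        then have "k \<notin> K \<Longrightarrow> fst \<tau> vAcc + ps k = sum ps ({..k} - K)" using acc new'(1) by simp
        then show ?thesis unfolding new' True by simp
      next
        case False
        then have ne: "2 * j + 4 \<noteq> 2 * k + 4" "2 * j + 4 \<noteq> 2 * k + 3" using odd[of k j] by auto
        show ?thesis unfolding new' fun_upd_other[OF ne(1)] fun_upd_other[OF ne(2)]
          using I'(7) False j by simp
      qed
    qed
    then show "?I (Suc k) ?\<tau>" using new by blast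
  qed
  moreover have "fst \<sigma>1 vN = n" using env1 by (simp add: env_def)
  moreover define \<sigma>2 where "\<sigma>2 = sem (For vI vN (emit_job cost)) \<sigma>1"
  ultimately have I: "?I n \<sigma>2" by simp
  have env2: "env \<sigma>2" unfolding \<sigma>2_def by (rule env_sem[OF env1]) simp_all
  define T where "T = max (fst \<sigma>2 vAcc) (fst \<sigma>2 vMax)"
  have "sem (emit cost) \<sigma> = sem (WriteA aOut vD vZero ;; AddV vD vD vOne ;; SubV vT vMax vAcc ;;
     AddV vT vT vAcc ;; WriteA aOut vD vT ;; WriteA aOut vZero vD) \<sigma>2"
    by (simp only: emit_def sem_apply(7) \<sigma>2_def \<sigma>1_def)
  then have out: "snd (sem (emit cost) \<sigma>) aOut =
      (snd \<sigma>2 aOut)(2 * n + 3 := 0, 2 * n + 4 := T, 0 := 2 * n + 4)"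
    using env2 I by (simp add: env_def T_def max[symmetric] add.commute)
  have I': "fst \<sigma>2 vAcc = sum ps ({..<n} - K)" "\<And>j. j \<in> K \<Longrightarrow> j < n \<Longrightarrow> w j \<le> fst \<sigma>2 vMax"
      "fst \<sigma>2 vMax = 0 \<or> (\<exists>j\<in>K. fst \<sigma>2 vMax = w j)" "snd \<sigma>2 aOut 1 = 0" "snd \<sigma>2 aOut 2 = 0"
      "\<And>j. j < n \<Longrightarrow> snd \<sigma>2 aOut (2 * j + 3) = (if j \<in> K then 1 else 0)"
      "\<And>j. j < n \<Longrightarrow> snd \<sigma>2 aOut (2 * j + 4) = (if j \<in> K then ci j + pc j else sum ps ({..j} - K))"
    using I by blast+
  have "makespan_of K T"
    unfolding makespan_of_def
  proof (intro conjI ballI)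
    show "sum ps ({..<n} - K) \<le> T" unfolding T_def I'(1) by simp
    show "w j \<le> T" if "j \<in> K" for j
    proof -
      have "w j \<le> fst \<sigma>2 vMax" using I'(2)[OF that] that assms(3) by blast
      then show ?thesis unfolding T_def by (rule max.coboundedI2)
    qed
    show "T = sum ps ({..<n} - K) \<or> (\<exists>j\<in>K. T = w j)"
    proof (cases "fst \<sigma>2 vMax \<le> fst \<sigma>2 vAcc")
      case True
      then show ?thesis using I'(1) by (simp add: T_def)
    next
      case False
      then have "T = fst \<sigma>2 vMax" "fst \<sigma>2 vMax \<noteq> 0" by (simp_all add: T_def)
      then show ?thesis using I'(3) by simp
    qed
  qed
  moreover have "schedule_out K T (snd (sem (emit cost) \<sigma>) aOut)"
    unfolding schedule_out_def out
  proof (intro conjI allI impI)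
    fix j assume j: "j < n"
    have ne: "2 * j + 3 \<noteq> 2 * n + 4" "2 * j + 3 \<noteq> 2 * n + 3" "2 * j + 3 \<noteq> 0"
      "2 * j + 4 \<noteq> 2 * n + 4" "2 * j + 4 \<noteq> 2 * n + 3" "2 * j + 4 \<noteq> 0"
      using odd[of j n] odd[of n j] j by auto
    show "((snd \<sigma>2 aOut)(2 * n + 3 := 0, 2 * n + 4 := T, 0 := 2 * n + 4)) (2 * j + 3) = (if j \<in> K then 1 else 0)"
      unfolding fun_upd_other[OF ne(1)] fun_upd_other[OF ne(2)] fun_upd_other[OF ne(3)]
      using I'(6)[OF j] .
    show "((snd \<sigma>2 aOut)(2 * n + 3 := 0, 2 * n + 4 := T, 0 := 2 * n + 4)) (2 * j + 4) =
        (if j \<in> K then ci j + pc j else sum ps ({..j} - K))"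
      unfolding fun_upd_other[OF ne(4)] fun_upd_other[OF ne(5)] fun_upd_other[OF ne(6)]
      using I'(7)[OF j] .
  qed (use I'(4,5) in simp_all)
  ultimately show thesis by (rule that)
qed

end

lemma tm_apply:
  "tm (SetC x c) \<sigma> = 1"
  "tm (AddV x y z) \<sigma> = 1"
  "tm (SubV x y z) \<sigma> = 1"
  "tm (DivS x y z) \<sigma> = 9 + 7 * (fst \<sigma> y div Suc (fst \<sigma> z))"
  "tm (ReadA x k y) \<sigma> = 8"
  "tm (c1 ;; c2) \<sigma> = tm c1 \<sigma> + tm c2 (sem c1 \<sigma>)"
  by simp_all

declare tm.simps [simp del]

text \<open>What follows after \<open>vR\<close> and \<open>vS\<close> have their final values, so
  that \<open>tm_bound\<close> applies with all three limits fixed.\<close>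

definition main :: "bool \<Rightarrow> com" where
  "main cost = prep cost ;; search ;; write_output cost"

lemmas program_defs = scale_loop_def scale_def dp_init_def dp_step_def dp_copy_def dp_def pick_def
  attempt_def search_def init_def sizes_def read_job_def prep_def decode_def on_server_def
  on_cloud_def emit_job_def emit_def write_output_def

lemma main_fixed_limits: "fixed_limits {vN, vR, vS} (main cost)"
  by (simp add: main_def program_defs)

lemma wf_prog: "wf_com 4 (prog cost)"
  by (simp add: prog_def program_defs)

context fp_run
begin

section \<open>The outcome of the whole program\<close>

definition thresholds :: "nat set" where
  "thresholds = {0} \<union> U ` {..<n} \<union> B ` {..<n}"

definition cloud :: "nat set \<Rightarrow> nat set" where
  "cloud X = (if cost then X else {..<n} - X)"

definition outcome :: "(nat \<Rightarrow> nat) \<Rightarrow> bool" where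
  "outcome out \<longleftrightarrow>
     (out 0 = 0 \<and> out 1 = 0 \<and> (\<forall>M\<in>thresholds. \<forall>Y. \<not> feasible M Y)) \<or>
     (\<exists>M X T. feasible M X \<and> makespan_of (cloud X) T \<and> schedule_out (cloud X) T out \<and>
        (\<forall>M'\<in>thresholds. \<forall>Y. feasible M' Y \<longrightarrow>
           N0 * max (sum U X) M \<le> N0 * max (sum U Y) M' + M'))"

lemma prog_sem: "outcome (snd (sem (prog cost) (s, input_arrays inp)) aOut)"
proof -
  define \<sigma>0 where "\<sigma>0 = (s, input_arrays inp)"
  define \<sigma>1 where "\<sigma>1 = sem init \<sigma>0"
  define \<sigma>2 where "\<sigma>2 = sem sizes \<sigma>1"
  define \<sigma>3 where "\<sigma>3 = sem (prep cost) \<sigma>2"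
  define \<sigma>4 where "\<sigma>4 = sem search \<sigma>3"
  have prog: "sem (prog cost) \<sigma>0 = sem (write_output cost) \<sigma>4"
    by (simp only: prog_def sem_apply(7) \<sigma>1_def \<sigma>2_def \<sigma>3_def \<sigma>4_def)
  have "input_ok \<sigma>0" by (simp add: \<sigma>0_def input_ok_def)
  note i = init_sem[OF this, folded \<sigma>1_def]
  note z = sizes_sem[OF i(4,6), folded \<sigma>2_def]
  have in2: "input_ok \<sigma>2" using \<open>input_ok \<sigma>0\<close> i(1) z(3) by (simp add: input_ok_def)
  have env3: "env \<sigma>3" unfolding \<sigma>3_def
    by (rule prep_sem[OF in2]) (use i z in simp_all)
  have in3: "input_ok \<sigma>3" using in2 unfolding \<sigma>3_def input_ok_def by (simp add: sem_frame)
  have searched: "searched thresholds \<sigma>4"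
    unfolding \<sigma>4_def thresholds_def by (rule search_sem[OF env3])
  have in4: "input_ok \<sigma>4" using in3 unfolding \<sigma>4_def input_ok_def by (simp add: sem_frame)
  have env4: "env \<sigma>4" and sound: "sound (fst \<sigma>4 vBest) (fst \<sigma>4 vSol)"
    and compl: "\<And>M Y. M \<in> thresholds \<Longrightarrow> feasible M Y \<Longrightarrow> fst \<sigma>4 vBest \<noteq> 0 \<and>
        N0 * (fst \<sigma>4 vBest - 1) \<le> N0 * max (sum U Y) M + M"
    using searched unfolding searched_def by blast+
  show ?thesis
  proof (cases "fst \<sigma>4 vBest = 0")
    case True
    have "snd (sem (write_output cost) \<sigma>4) aOut 0 = 0" "snd (sem (write_output cost) \<sigma>4) aOut 1 = 0"
      using True env4 by (simp_all add: write_output_def env_def)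
    moreover have "\<not> feasible M Y" if "M \<in> thresholds" for M Y using compl[OF that] True by blast
    ultimately show ?thesis
      unfolding outcome_def \<sigma>0_def[symmetric] prog by blast
  next
    case False
    from sound False obtain M X where X: "feasible M X" "fst \<sigma>4 vSol = (\<Sum>j\<in>X. 2 ^ j)"
      "fst \<sigma>4 vBest = Suc (max (sum U X) M)" unfolding sound_def by blast
    have XN: "X \<subseteq> {..<n}" using X(1) by (simp add: feasible_def)
    define \<sigma>5 where "\<sigma>5 = sem decode \<sigma>4"
    have env5: "env \<sigma>5" unfolding \<sigma>5_def by (rule env_sem[OF env4]) simp_all
    have in5: "input_ok \<sigma>5" using in4 unfolding \<sigma>5_def input_ok_def by (simp add: sem_frame)
    have sel: "snd \<sigma>5 aSel j = 0 \<longleftrightarrow> (j \<in> cloud X \<longleftrightarrow> \<not> cost)" if "j < n" for j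
      using decode_sem[OF env4 XN X(2), folded \<sigma>5_def] that by (auto simp: cloud_def)
    have KN: "cloud X \<subseteq> {..<n}" using XN by (auto simp: cloud_def)
    from emit_sem[OF env5 in5 KN sel] obtain T where
      T: "makespan_of (cloud X) T" "schedule_out (cloud X) T (snd (sem (emit cost) \<sigma>5) aOut)" .
    have "sem (write_output cost) \<sigma>4 = sem (emit cost) \<sigma>5"
      using False by (simp add: write_output_def \<sigma>5_def)
    moreover have "N0 * max (sum U X) M \<le> N0 * max (sum U Y) M' + M'"
      if "M' \<in> thresholds" "feasible M' Y" for M' Y
      using compl[OF that] X(3) by simp
    ultimately show ?thesis
      unfolding outcome_def \<sigma>0_def[symmetric] prog using X(1) T by metis
  qed
qed

text \<open>The threshold is the largest value that \<open>Y\<close> incurs, with 0 inserted so that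
  the maximum exists. For \<open>m\<close> the value of the compared schedule is taken later:
  \<open>M \<le> m\<close> is what makes the additive loss relative.\<close>

lemma feasible_threshold:
  assumes "Y \<subseteq> {..<n}" "\<And>j. j \<in> Y \<Longrightarrow> L j = 0" "sum V ({..<n} - Y) \<le> d"
    and "\<And>j. j \<in> Y \<Longrightarrow> U j \<le> m" "\<And>j. j \<in> {..<n} - Y \<Longrightarrow> B j \<le> m"
  shows "\<exists>M\<in>thresholds. feasible M Y \<and> M \<le> m"
proof (intro bexI conjI)
  let ?A = "insert 0 (U ` Y \<union> B ` ({..<n} - Y))"
  have fin: "finite ?A" using assms(1) finite_subset by auto
  show "Max ?A \<in> thresholds"
    using Max_in[OF fin] assms(1) unfolding thresholds_def by blast
  show "feasible (Max ?A) Y"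
    unfolding feasible_def using assms(1-3) Max_ge[OF fin] by auto
  show "Max ?A \<le> m" using fin assms(4,5) by (subst Max_le_iff) auto
qed

section \<open>Schedules\<close>

lemma fp_validD:
  assumes "fp_valid xs Js C"
  shows "0 \<in> Js" "Suc n \<in> Js"
    "i \<in> Js \<Longrightarrow> j \<in> Js \<Longrightarrow> i \<noteq> j \<Longrightarrow> C i + fp_ps xs j \<le> C j \<or> C j + fp_ps xs i \<le> C i"
    "(i, j) \<in> fp_edges xs \<Longrightarrow> i \<in> Js \<Longrightarrow> j \<in> Js \<Longrightarrow> C i + fp_ps xs j \<le> C j"
    "(i, j) \<in> fp_edges xs \<Longrightarrow> i \<in> Js \<Longrightarrow> j \<notin> Js \<Longrightarrow> C i + fp_c xs (i, j) + fp_pc xs j \<le> C j"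
    "(i, j) \<in> fp_edges xs \<Longrightarrow> i \<notin> Js \<Longrightarrow> j \<in> Js \<Longrightarrow> C i + fp_c xs (i, j) + fp_ps xs j \<le> C j"
proof -
  let ?p = "ptime (fp_ps xs) (fp_pc xs) Js"
  have v: "0 \<in> Js" "Suc n \<in> Js"
    "\<forall>i\<in>Js. \<forall>j\<in>Js. i \<noteq> j \<longrightarrow> int (C i) \<le> int (C j) - int (?p j) \<or> int (C i) - int (?p i) \<ge> int (C j)"
    "\<forall>(i, j)\<in>fp_edges xs. (i \<in> Js \<longleftrightarrow> j \<in> Js) \<longrightarrow> int (C i) \<le> int (C j) - int (?p j)"
    "\<forall>(i, j)\<in>fp_edges xs. \<not> (i \<in> Js \<longleftrightarrow> j \<in> Js) \<longrightarrow>
       int (C i) + int (fp_c xs (i, j)) \<le> int (C j) - int (?p j)"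
    using assms unfolding fp_valid_def valid_schedule_def by - (elim conjE, assumption)+
  show "0 \<in> Js" "Suc n \<in> Js" by fact+
  show "C i + fp_ps xs j \<le> C j \<or> C j + fp_ps xs i \<le> C i" if "i \<in> Js" "j \<in> Js" "i \<noteq> j"
    using v(3)[rule_format, OF that] that by (simp add: ptime_def) linarith
  show "C i + fp_ps xs j \<le> C j" if "(i, j) \<in> fp_edges xs" "i \<in> Js" "j \<in> Js"
    using bspec[OF v(4) that(1)] that(2,3) by (simp add: ptime_def)
  show "C i + fp_c xs (i, j) + fp_pc xs j \<le> C j" if "(i, j) \<in> fp_edges xs" "i \<in> Js" "j \<notin> Js"
    using bspec[OF v(5) that(1)] that(2,3) by (simp add: ptime_def)
  show "C i + fp_c xs (i, j) + fp_ps xs j \<le> C j" if "(i, j) \<in> fp_edges xs" "i \<notin> Js" "j \<in> Js"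
    using bspec[OF v(5) that(1)] that(2,3) by (simp add: ptime_def)
qed

lemma inner_edges:
  assumes "j < n"
  shows "(0, Suc j) \<in> fp_edges xs" "(Suc j, Suc n) \<in> fp_edges xs"
  using assms by (auto simp: fp_edges_def)

lemma valid_cloud_bound:
  assumes "fp_valid xs Js C" "j < n" "Suc j \<notin> Js"
  shows "w j \<le> C (Suc n)"
  using fp_validD(5)[OF assms(1) inner_edges(1)[OF assms(2)]]
    fp_validD(6)[OF assms(1) inner_edges(2)[OF assms(2)]] fp_validD(1,2)[OF assms(1)] assms(3)
  by simp

text \<open>The half-open execution intervals of the server jobs are disjoint and lie between 0 and
  the completion time of the sink; counting their integer points bounds the load.\<close>

lemma valid_server_bound:
  assumes "fp_valid xs Js C"
  shows "sum ps {j. j < n \<and> Suc j \<in> Js} \<le> C (Suc n)"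
proof -
  let ?A = "{j. j < n \<and> Suc j \<in> Js}"
  let ?I = "\<lambda>j. {C (Suc j) - ps j <.. C (Suc j)}"
  have le: "ps j \<le> C (Suc j)" "C (Suc j) \<le> C (Suc n)" if "j \<in> ?A" for j
    using that fp_validD(1,2)[OF assms] fp_validD(4)[OF assms inner_edges(1), of j]
      fp_validD(4)[OF assms inner_edges(2), of j] by simp_all
  have "?I i \<inter> ?I j = {}" if "i \<in> ?A" "j \<in> ?A" "i \<noteq> j" for i j
    using fp_validD(3)[OF assms, of "Suc i" "Suc j"] that by auto
  then have "card (\<Union>j\<in>?A. ?I j) = (\<Sum>j\<in>?A. card (?I j))"
    by (intro card_UN_disjoint) auto
  also have "\<dots> = sum ps ?A" using le by (intro sum.cong) auto
  finally have "sum ps ?A = card (\<Union>j\<in>?A. ?I j)" by simp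
  also have "\<dots> \<le> card {0<..C (Suc n)}"
  proof (rule card_mono)
    show "(\<Union>j\<in>?A. ?I j) \<subseteq> {0<..C (Suc n)}"
    proof
      fix y assume "y \<in> (\<Union>j\<in>?A. ?I j)"
      then obtain j where "j \<in> ?A" "y \<in> ?I j" by blast
      then show "y \<in> {0<..C (Suc n)}" using le(2)[of j] by simp
    qed
  qed simp
  finally show ?thesis by simp
qed

lemma cost_eq:
  assumes "0 \<in> Js" "Suc n \<in> Js"
  shows "fp_cost xs Js = sum pc {j. j < n \<and> Suc j \<notin> Js}"
proof -
  have "fp_jobs xs - Js = Suc ` {j. j < n \<and> Suc j \<notin> Js}"
  proof -
    have "i \<in> Suc ` {j. j < n \<and> Suc j \<notin> Js}" if "i \<in> fp_jobs xs - Js" for i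
      using that assms by (cases i) (auto simp: fp_jobs_def le_less)
    then show ?thesis by (auto simp: fp_jobs_def)
  qed
  then show ?thesis by (simp add: fp_cost_def sched_cost_def sum.reindex)
qed

lemma schedule_out_valid:
  assumes K: "K \<subseteq> {..<n}" and T: "makespan_of K T" and out: "schedule_out K T out"
  defines "ys \<equiv> map (\<lambda>i. out (Suc i)) [0..<out 0]"
  shows "dec_ok xs ys" "fp_valid xs (dec_server xs ys) (dec_compl ys)"
    "fp_makespan xs (dec_compl ys) = T" "fp_cost xs (dec_server xs ys) = sum pc K"
proof -
  have len: "out 0 = 2 * n + 4" and o: "out 1 = 0" "out 2 = 0" "out (2 * n + 3) = 0" "out (2 * n + 4) = T"
    and oj: "\<And>j. j < n \<Longrightarrow> out (2 * j + 3) = (if j \<in> K then 1 else 0)"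
      "\<And>j. j < n \<Longrightarrow> out (2 * j + 4) = (if j \<in> K then ci j + pc j else sum ps ({..j} - K))"
    using out unfolding schedule_out_def by blast+
  show "dec_ok xs ys" by (simp add: dec_ok_def ys_def len)
  have ys: "ys ! i = out (Suc i)" if "i < 2 * n + 4" for i using that by (simp add: ys_def len)
  define Js where "Js = dec_server xs ys"
  define C where "C = dec_compl ys"
  have Js0: "0 \<in> Js" using ys[of 0] o(1) by (simp add: Js_def dec_server_def)
  have Jst: "Suc n \<in> Js" using ys[of "2 * Suc n"] o(3)
    by (simp add: Js_def dec_server_def eval_nat_numeral)
  have Jsj: "Suc j \<in> Js \<longleftrightarrow> j \<notin> K" if "j < n" for j
    using ys[of "2 * Suc j"] oj(1)[OF that] that by (simp add: Js_def dec_server_def eval_nat_numeral)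
  have JsJ: "Js \<subseteq> {..Suc n}" by (auto simp: Js_def dec_server_def)
  have C0: "C 0 = 0" using ys[of 1] o(2) by (simp add: C_def dec_compl_def eval_nat_numeral)
  have Ct: "C (Suc n) = T" using ys[of "2 * Suc n + 1"] o(4)
    by (simp add: C_def dec_compl_def eval_nat_numeral)
  have Cj: "C (Suc j) = (if j \<in> K then ci j + pc j else sum ps ({..j} - K))" if "j < n" for j
    using ys[of "2 * Suc j + 1"] oj(2)[OF that] that by (simp add: C_def dec_compl_def eval_nat_numeral)
  have K': "K = {j. j < n \<and> Suc j \<notin> Js}" using K Jsj by auto
  show "fp_makespan xs (dec_compl ys) = T" using Ct by (simp add: fp_makespan_def makespan_def C_def)
  show "fp_cost xs (dec_server xs ys) = sum pc K"
    using cost_eq[OF Js0 Jst] K' by (simp add: Js_def)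
  let ?p = "ptime (fp_ps xs) (fp_pc xs) Js"
  have p0: "?p (Suc n) = 0" using Jst by (simp add: ptime_def fp_ps_def fp_inner_def)
  have pj: "?p (Suc j) = (if j \<in> K then pc j else ps j)" if "j < n" for j
    using Jsj[OF that] by (simp add: ptime_def)
  have T': "sum ps ({..<n} - K) \<le> T" "\<And>j. j \<in> K \<Longrightarrow> w j \<le> T"
    using T unfolding makespan_of_def by blast+
  have ge: "ps j \<le> sum ps ({..j} - K)" if "j \<notin> K" for j
    using that by (intro member_le_sum) auto
  have leT: "sum ps ({..j} - K) \<le> T" if "j < n" for j
  proof -
    have "sum ps ({..j} - K) \<le> sum ps ({..<n} - K)" using that by (intro sum_mono2) auto
    then show ?thesis using T'(1) by linarith
  qed
  \<comment> \<open>This one ordering fact yields both the exclusive use of the server and the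
    same-side edges: each edge touches the source or the sink, so both its ends are then on the
    server.\<close>
  have seq: "C i + ?p j \<le> C j" if ij: "i \<in> Js" "j \<in> Js" "i < j" for i j
  proof -
    obtain b where b: "j = Suc b" using ij(3) by (cases j) auto
    have "j \<le> Suc n" using ij(2) JsJ by auto
    then consider "b < n" | "b = n" using b by linarith
    then show ?thesis
    proof cases
      case 1
      then have bK: "b \<notin> K" using Jsj ij(2) b by simp
      show ?thesis
      proof (cases i)
        case 0
        then show ?thesis using C0 Cj[OF 1] pj[OF 1] ge[OF bK] bK b by simp
      next
        case (Suc a)
        then have a: "a < b" "a < n" "a \<notin> K" using ij b 1 Jsj[of a] by auto
        have "sum ps ({..a} - K) + ps b = sum ps (insert b ({..a} - K))" using a by simp
        also have "\<dots> \<le> sum ps ({..b} - K)" using a bK by (intro sum_mono2) auto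
        finally show ?thesis using Cj[OF 1] Cj[OF a(2)] pj[OF 1] a bK b Suc by simp
      qed
    next
      case 2
      show ?thesis
      proof (cases i)
        case 0
        then show ?thesis using C0 p0 b 2 by simp
      next
        case (Suc a)
        then have a: "a < n" "a \<notin> K" using ij b 2 Jsj[of a] by auto
        then show ?thesis using Cj[OF a(1)] leT[OF a(1)] p0 Ct b 2 Suc by simp
      qed
    qed
  qed
  have same: "int (C i) \<le> int (C j) - int (?p j)" if "(i, j) \<in> fp_edges xs" "(i \<in> Js) = (j \<in> Js)" for i j
  proof -
    have "i < j" "i = 0 \<or> j = Suc n" using that(1) by (auto simp: fp_edges_def)
    then have "i \<in> Js" "j \<in> Js" using that(2) Js0 Jst by auto
    then show ?thesis using seq[of i j] \<open>i < j\<close> by simp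
  qed
  have diff: "int (C i) + int (fp_c xs (i, j)) \<le> int (C j) - int (?p j)"
    if "(i, j) \<in> fp_edges xs" "(i \<in> Js) \<noteq> (j \<in> Js)" for i j
  proof -
    from that(1) consider "i = 0" "1 \<le> j" "j \<le> n" | "j = Suc n" "1 \<le> i" "i \<le> n"
      unfolding fp_edges_def by auto
    then show ?thesis
    proof cases
      case 1
      then obtain a where a: "j = Suc a" "a < n" by (cases j) auto
      then have "a \<in> K" using that(2) Js0 Jsj 1 by auto
      then show ?thesis using 1 a C0 Cj[of a] pj[of a] by simp
    next
      case 2
      then obtain a where a: "i = Suc a" "a < n" by (cases i) auto
      then have "a \<in> K" using that(2) Jst Jsj 2 by auto
      then show ?thesis using 2 a Ct Cj[of a] p0 T'(2)[of a] by simp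
    qed
  qed
  have par: "int (C i) \<le> int (C j) - int (?p j) \<or> int (C i) - int (?p i) \<ge> int (C j)"
    if "i \<in> Js" "j \<in> Js" "i \<noteq> j" for i j
    using seq[of i j] seq[of j i] that by (cases "i < j") auto
  have "Js \<subseteq> fp_jobs xs" using JsJ by (auto simp: fp_jobs_def)
  then have "fp_valid xs Js C"
    unfolding fp_valid_def valid_schedule_def using Js0 Jst par same diff by auto
  then show "fp_valid xs (dec_server xs ys) (dec_compl ys)" by (simp add: Js_def C_def)
qed

section \<open>Running time\<close>

lemma init_time:
  assumes "input_ok \<sigma>"
  shows "tm init \<sigma> \<le> 100 + 7 * (q div p)"
proof -
  note i = input_okD(1-4)[OF assms]
  have *: "n + n + (n + n) = 4 * n" by simp
  show ?thesis using i p by (simp add: init_def tm_apply * nat_offsets)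
qed

text \<open>Three stages: \<open>init\<close> contains the only division, \<open>sizes\<close> loops
  up to \<open>n\<close> only, and \<open>main\<close> loops up to \<open>n\<close>,
  \<open>R\<close> or \<open>S\<close>. With \<open>n\<close> and \<open>N0\<close> at most
  \<open>X\<close>, all of these are at most \<open>2 * X ^ 3 + 1\<close>.\<close>

lemma prog_time:
  defines "X \<equiv> input_size inp + q div p + 1"
  shows "tm (prog cost) (s, input_arrays inp) \<le> 100 + 7 * X +
    time_coeff sizes * Suc X ^ loop_depth sizes +
    time_coeff (main cost) * Suc (2 * X ^ 3 + 1) ^ loop_depth (main cost)"
proof -
  define \<sigma>0 where "\<sigma>0 = (s, input_arrays inp)"
  define \<sigma>1 where "\<sigma>1 = sem init \<sigma>0"
  define \<sigma>2 where "\<sigma>2 = sem sizes \<sigma>1"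
  have in0: "input_ok \<sigma>0" by (simp add: \<sigma>0_def input_ok_def)
  note i = init_sem[OF in0, folded \<sigma>1_def]
  note z = sizes_sem[OF i(4,6), folded \<sigma>2_def]
  have t: "tm (prog cost) \<sigma>0 = tm init \<sigma>0 + tm sizes \<sigma>1 + tm (main cost) \<sigma>2"
    by (simp add: prog_def main_def tm_apply \<sigma>1_def \<sigma>2_def)
  have nX: "n \<le> X" using length_le_input_size[of inp] by (simp add: X_def length_enc_fp)
  have N0X: "N0 \<le> X" by (simp add: N0_def X_def)
  have "tm init \<sigma>0 \<le> 100 + 7 * (q div p)" using init_time[OF in0] .
  then have 1: "tm init \<sigma>0 \<le> 100 + 7 * X" by (simp add: X_def)
  have 2: "tm sizes \<sigma>1 \<le> time_coeff sizes * Suc X ^ loop_depth sizes"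
    by (rule tm_bound[where L = "{vN}"]) (use i nX in \<open>auto simp: sizes_def\<close>)
  have RS: "n \<le> S" "R \<le> S"
  proof -
    have "n * 1 \<le> n * (2 * N0)" by (intro mult_le_mono2) (simp add: N0_def)
    then have nR: "n \<le> R" by (simp add: R_def mult.assoc mult.left_commute)
    show "R \<le> S"
    proof (cases "0 < n")
      case True
      then have "1 \<le> n" by linarith
      then have "1 * R \<le> n * R" by (rule mult_le_mono1)
      then show ?thesis unfolding S_def by linarith
    next
      case False
      then have "2 * n * N0 = 0" by simp
      then have "R = 0" by (simp only: R_def)
      then show ?thesis by linarith
    qed
    then show "n \<le> S" using nR by simp
  qed
  have "R \<le> 2 * X * X" unfolding R_def using nX N0X by (intro mult_le_mono) auto
  then have "n * R \<le> X * (2 * X * X)" using nX by (intro mult_le_mono)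
  then have SX: "S \<le> 2 * X ^ 3 + 1" by (simp add: S_def power3_eq_cube ac_simps)
  have 3: "tm (main cost) \<sigma>2 \<le>
      time_coeff (main cost) * Suc (2 * X ^ 3 + 1) ^ loop_depth (main cost)"
  proof (rule tm_bound[where L = "{vN, vR, vS}"])
    show "fixed_limits {vN, vR, vS} (main cost)" by (rule main_fixed_limits)
    fix x assume "x \<in> {vN, vR, vS}"
    then show "fst \<sigma>2 x \<le> 2 * X ^ 3 + 1" using z i(4) RS SX by auto
  qed
  show ?thesis using t 1 2 3 unfolding \<sigma>0_def by linarith
qed

end

text \<open>Coefficient and exponent coincide because the time bound in \<open>fptas_cost\<close>
  has a single parameter \<open>k\<close>; restricting to \<open>x \<ge> 1\<close> allows both to be
  enlarged freely.\<close>

definition poly_bounded :: "(nat \<Rightarrow> nat) \<Rightarrow> bool" where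
  "poly_bounded f \<longleftrightarrow> (\<exists>a. \<forall>x\<ge>1. f x \<le> a * x ^ a)"

lemma poly_boundedI:
  assumes "\<And>x. 1 \<le> x \<Longrightarrow> f x \<le> a * x ^ b"
  shows "poly_bounded f"
  unfolding poly_bounded_def
proof (intro exI[of _ "a + b"] allI impI)
  fix x :: nat assume x: "1 \<le> x"
  have "f x \<le> a * x ^ b" by (rule assms[OF x])
  also have "\<dots> \<le> (a + b) * x ^ (a + b)"
    using x by (intro mult_le_mono power_increasing) auto
  finally show "f x \<le> (a + b) * x ^ (a + b)" .
qed

lemma poly_bounded_const: "poly_bounded (\<lambda>x. c)"
  by (rule poly_boundedI[of _ c 0]) simp

lemma poly_bounded_id: "poly_bounded (\<lambda>x. x)"
  by (rule poly_boundedI[of _ 1 1]) simp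

lemma poly_bounded_add:
  assumes "poly_bounded f" "poly_bounded g"
  shows "poly_bounded (\<lambda>x. f x + g x)"
proof -
  obtain a b where f: "\<And>x. 1 \<le> x \<Longrightarrow> f x \<le> a * x ^ a" and g: "\<And>x. 1 \<le> x \<Longrightarrow> g x \<le> b * x ^ b"
    using assms unfolding poly_bounded_def by blast
  show ?thesis
  proof (rule poly_boundedI)
    fix x :: nat assume x: "1 \<le> x"
    have "a * x ^ a \<le> a * x ^ (a + b)" "b * x ^ b \<le> b * x ^ (a + b)"
      using x by (auto intro!: mult_le_mono2 power_increasing)
    then show "f x + g x \<le> (a + b) * x ^ (a + b)"
      using f[OF x] g[OF x] unfolding distrib_right by linarith
  qed
qed

lemma poly_bounded_mult:
  assumes "poly_bounded f" "poly_bounded g"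
  shows "poly_bounded (\<lambda>x. f x * g x)"
proof -
  obtain a b where f: "\<And>x. 1 \<le> x \<Longrightarrow> f x \<le> a * x ^ a" and g: "\<And>x. 1 \<le> x \<Longrightarrow> g x \<le> b * x ^ b"
    using assms unfolding poly_bounded_def by blast
  show ?thesis
  proof (rule poly_boundedI)
    fix x :: nat assume x: "1 \<le> x"
    have "f x * g x \<le> (a * x ^ a) * (b * x ^ b)" using f[OF x] g[OF x] by (rule mult_le_mono)
    then show "f x * g x \<le> (a * b) * x ^ (a + b)" by (simp add: power_add ac_simps)
  qed
qed

lemma poly_bounded_power: "poly_bounded f \<Longrightarrow> poly_bounded (\<lambda>x. f x ^ e)"
  by (induction e) (auto intro: poly_bounded_const poly_bounded_mult)

lemmas poly_bounded_intros =
  poly_bounded_const poly_bounded_id poly_bounded_add poly_bounded_mult poly_bounded_power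

text \<open>\<open>k\<close> has to be fixed before the instance. \<open>?s\<close> bounds the
  number of steps, relocation included, as a polynomial in \<open>X\<close>, and \<open>?f\<close>
  turns it into the cost bound of \<open>ram_computes_reach\<close>.\<close>

lemma machine_prog:
  obtains k where "\<And>xs d p q. 0 < p \<Longrightarrow> 0 < q \<Longrightarrow> \<exists>out T.
    ram_computes (machine (prog cost)) (enc_fp xs @ [d, p, q]) T (map (\<lambda>i. out (Suc i)) [0..<out 0]) \<and>
    T \<le> k * (input_size (enc_fp xs @ [d, p, q]) + q div p + 1) ^ k \<and> fp_run.outcome xs d p q cost out"
proof -
  obtain l where l: "operand_bound (machine (prog cost)) l" using operand_bound_ex by blast
  let ?s = "\<lambda>X. 100 + 7 * X + time_coeff sizes * (X + 1) ^ loop_depth sizes +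
    time_coeff (main cost) * (2 * X ^ 3 + 1 + 1) ^ loop_depth (main cost) + (210 + 1152 * X)"
  let ?f = "\<lambda>X. ?s X * (5 * (X + l + ?s X + 1))"
  have "poly_bounded ?f" by (intro poly_bounded_intros)
  then obtain k where k: "\<And>X. 1 \<le> X \<Longrightarrow> ?f X \<le> k * X ^ k" unfolding poly_bounded_def by blast
  show thesis
  proof (rule that[of k])
    fix xs :: fp_inst and d p q :: nat
    assume "0 < p" "0 < q"
    then interpret fp_run xs d p q cost by unfold_locales
    define X where "X = input_size inp + q div p + 1"
    have ne: "inp \<noteq> []" by simp
    obtain s where s: "\<And>\<sigma>. \<sigma> = sem (prog cost) (s, input_arrays inp) \<Longrightarrow>
      snd \<sigma> 14 0 < 64 * length inp \<Longrightarrow> snd \<sigma> 14 1 = 0 \<Longrightarrow>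
      \<exists>k cf. k \<le> tm (prog cost) (s, input_arrays inp) + (210 + 1152 * length inp) \<and>
        reach (machine (prog cost)) k (ram_init inp) cf \<and> ram_step (machine (prog cost)) cf = None \<and>
        ram_output cf = map (\<lambda>i. snd \<sigma> 14 (Suc i)) [0..<snd \<sigma> 14 0]"
      using machine_correct[OF wf_prog ne] by blast
    define out where "out = snd (sem (prog cost) (s, input_arrays inp)) aOut"
    have outc: "outcome out" unfolding out_def by (rule prog_sem)
    \<comment> \<open>The output length is 0 or \<open>2 * n + 4\<close>, while the input has
      \<open>4 * n + 4\<close> words.\<close>
    have o: "out 0 < 64 * length inp" "out 1 = 0"
      using outc unfolding outcome_def schedule_out_def by (auto simp: length_enc_fp)
    from s[OF refl, folded out_def, OF o] obtain j cf where
      j: "j \<le> tm (prog cost) (s, input_arrays inp) + (210 + 1152 * length inp)"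
      "reach (machine (prog cost)) j (ram_init inp) cf" "ram_step (machine (prog cost)) cf = None"
      "ram_output cf = map (\<lambda>i. out (Suc i)) [0..<out 0]" by blast
    have "length inp \<le> X" using length_le_input_size[of inp] unfolding X_def by linarith
    then have "j \<le> ?s X" using j(1) prog_time[of s, folded X_def] unfolding Suc_eq_plus1 by linarith
    then have "j * (5 * (input_size inp + l + j + 1)) \<le> ?f X"
      by (intro mult_le_mono add_mono) (auto simp: X_def)
    also have "\<dots> \<le> k * X ^ k" by (rule k) (simp add: X_def)
    finally have "j * (5 * (input_size inp + l + j + 1)) \<le> k * X ^ k" .
    moreover have "ram_computes (machine (prog cost)) inp (j * (5 * (input_size inp + l + j + 1)))
        (map (\<lambda>i. out (Suc i)) [0..<out 0])"
      using ram_computes_reach[OF l j(2,3)] j(4) by simp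
    ultimately show "\<exists>out T. ram_computes (machine (prog cost)) inp T (map (\<lambda>i. out (Suc i)) [0..<out 0]) \<and>
      T \<le> k * (input_size inp + q div p + 1) ^ k \<and> outcome out"
      using outc unfolding X_def by blast
  qed
qed

section \<open>Approximation guarantees\<close>

text \<open>From \<open>q < (q div p + 1) * p\<close> the loss \<open>m / (q div p + 1)\<close> is
  at most \<open>p / q\<close> times \<open>m\<close>, and \<open>m\<close> is at most
  \<open>opt\<close>.\<close>

lemma approximation_ratio:
  fixes p q v opt :: nat
  assumes "0 < p" "0 < q" "Suc (q div p) * v \<le> Suc (q div p) * opt + m" "m \<le> opt"
  shows "real v \<le> (1 + real p / real q) * real opt"
proof -
  define N where "N = real (Suc (q div p))"
  have N: "0 < N" by (simp add: N_def)
  have "q < Suc (q div p) * p" using assms(1) dividend_less_times_div[of p q] by (simp add: algebra_simps)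
  then have "real q < N * real p" unfolding N_def by (metis of_nat_less_iff of_nat_mult)
  then have pq: "1 / N \<le> real p / real q" using N assms(2) by (simp add: field_simps)
  have "Suc (q div p) * v \<le> Suc (q div p) * opt + opt" using assms(3,4) by linarith
  then have "N * real v \<le> N * real opt + real opt"
    unfolding N_def by (metis of_nat_add of_nat_le_iff of_nat_mult)
  then have "real v \<le> (1 + 1 / N) * real opt" using N by (simp add: field_simps)
  also have "\<dots> \<le> (1 + real p / real q) * real opt" using pq by (intro mult_right_mono) auto
  finally show ?thesis .
qed

theorem fptas_cost_ex: "\<exists>P k. fptas_cost P k"
proof -
  obtain k where k: "\<And>xs d p q. 0 < p \<Longrightarrow> 0 < q \<Longrightarrow> \<exists>out T.
    ram_computes (machine (prog True)) (enc_fp xs @ [d, p, q]) T (map (\<lambda>i. out (Suc i)) [0..<out 0]) \<and>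
    T \<le> k * (input_size (enc_fp xs @ [d, p, q]) + q div p + 1) ^ k \<and> fp_run.outcome xs d p q True out"
    using machine_prog[of True] by blast
  have "fptas_cost (machine (prog True)) k"
    unfolding fptas_cost_def Let_def
  proof (intro allI impI)
    fix xs :: fp_inst and d p q :: nat
    assume pq: "0 < p" "0 < q"
    then interpret fp_run xs d p q True by unfold_locales
    obtain out T where out: "ram_computes (machine (prog True)) inp T (map (\<lambda>i. out (Suc i)) [0..<out 0])"
      "T \<le> k * (input_size inp + q div p + 1) ^ k" "outcome out" using k[OF pq] by blast
    define ys where "ys = map (\<lambda>i. out (Suc i)) [0..<out 0]"
    have simps: "U j = pc j" "V j = ps j" "L j = w j - d" "B j = 0" for j
      by (simp_all add: U_def V_def L_def B_def)
    \<comment> \<open>The cloud set of any schedule meeting the deadline is feasible for a threshold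
      at most its cost. This both justifies the empty answer and provides the comparison for the
      ratio.\<close>
    have opt: "\<exists>M Y. M \<in> thresholds \<and> feasible M Y \<and> M \<le> fp_cost xs Js \<and> sum U Y = fp_cost xs Js"
      if v: "fp_valid xs Js C" "fp_makespan xs C \<le> d" for Js C
    proof -
      define Y where "Y = {j. j < n \<and> Suc j \<notin> Js}"
      have cost: "fp_cost xs Js = sum pc Y"
        unfolding Y_def by (rule cost_eq[OF fp_validD(1,2)[OF v(1)]])
      have Ct: "C (Suc n) \<le> d" using v(2) by (simp add: fp_makespan_def makespan_def)
      have "{..<n} - Y = {j. j < n \<and> Suc j \<in> Js}" by (auto simp: Y_def)
      then have "sum V ({..<n} - Y) \<le> d"
        using valid_server_bound[OF v(1)] Ct by (simp add: simps)
      moreover have "L j = 0" if "j \<in> Y" for j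
        using valid_cloud_bound[OF v(1), of j] that Ct by (simp add: simps Y_def)
      moreover have "U j \<le> sum pc Y" if "j \<in> Y" for j
        unfolding simps by (rule member_le_sum) (use that in \<open>auto simp: Y_def\<close>)
      moreover have "Y \<subseteq> {..<n}" by (auto simp: Y_def)
      ultimately have "\<exists>M\<in>thresholds. feasible M Y \<and> M \<le> sum pc Y"
        by (intro feasible_threshold) (auto simp: simps(4))
      then obtain M where "M \<in> thresholds" "feasible M Y" "M \<le> sum pc Y" by blast
      moreover have "sum U Y = sum pc Y" by (simp add: simps)
      ultimately show ?thesis using cost by auto
    qed
    show "\<exists>ys T. ram_computes (machine (prog True)) inp T ys \<and>
        T \<le> k * (input_size inp + q div p + 1) ^ k \<and>
        (if \<exists>Js C. fp_valid xs Js C \<and> fp_makespan xs C \<le> d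
         then dec_ok xs ys \<and> fp_valid xs (dec_server xs ys) (dec_compl ys) \<and>
              fp_makespan xs (dec_compl ys) \<le> d \<and>
              (\<forall>Js C. fp_valid xs Js C \<and> fp_makespan xs C \<le> d \<longrightarrow>
                 real (fp_cost xs (dec_server xs ys)) \<le> (1 + real p / real q) * real (fp_cost xs Js))
         else ys = [])"
    proof (intro exI[of _ ys] exI[of _ T] conjI)
      show "ram_computes (machine (prog True)) inp T ys" using out(1) by (simp add: ys_def)
      show "T \<le> k * (input_size inp + q div p + 1) ^ k" by (rule out(2))
      from out(3) consider
        (none) "out 0 = 0" "\<forall>M\<in>thresholds. \<forall>Y. \<not> feasible M Y"
        | (sol) M X T where "feasible M X" "makespan_of (cloud X) T" "schedule_out (cloud X) T out"
          "\<forall>M'\<in>thresholds. \<forall>Y. feasible M' Y \<longrightarrow>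
             N0 * max (sum U X) M \<le> N0 * max (sum U Y) M' + M'"
        unfolding outcome_def by - (elim disjE exE conjE; blast)
      then show "if \<exists>Js C. fp_valid xs Js C \<and> fp_makespan xs C \<le> d
         then dec_ok xs ys \<and> fp_valid xs (dec_server xs ys) (dec_compl ys) \<and>
              fp_makespan xs (dec_compl ys) \<le> d \<and>
              (\<forall>Js C. fp_valid xs Js C \<and> fp_makespan xs C \<le> d \<longrightarrow>
                 real (fp_cost xs (dec_server xs ys)) \<le> (1 + real p / real q) * real (fp_cost xs Js))
         else ys = []"
      proof cases
        case none
        then have "\<not> (\<exists>Js C. fp_valid xs Js C \<and> fp_makespan xs C \<le> d)" using opt by blast
        moreover have "ys = []" using none(1) by (simp add: ys_def)
        ultimately show ?thesis by (simp only: if_False)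
      next
        case (sol M X T')
        have K: "cloud X = X" "X \<subseteq> {..<n}" using sol(1) by (simp_all add: cloud_def feasible_def)
        note sched = schedule_out_valid[OF K(2) sol(2)[unfolded K(1)] sol(3)[unfolded K(1)], folded ys_def]
        have "T' \<le> d"
        proof -
          have "sum ps ({..<n} - X) \<le> d" using sol(1) by (simp add: feasible_def simps)
          moreover have "w j \<le> d" if "j \<in> X" for j
            using sol(1) that by (auto simp: feasible_def simps)
          ultimately show ?thesis using sol(2) unfolding makespan_of_def K(1) by blast
        qed
        moreover have "real (fp_cost xs (dec_server xs ys)) \<le> (1 + real p / real q) * real (fp_cost xs Js)"
          if v: "fp_valid xs Js C" "fp_makespan xs C \<le> d" for Js C
        proof -
          from opt[OF v] obtain M' Y where Y: "M' \<in> thresholds" "feasible M' Y" "M' \<le> fp_cost xs Js"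
            "sum U Y = fp_cost xs Js" by blast
          have "N0 * sum U X \<le> N0 * max (sum U X) M" by (intro mult_le_mono2) simp
          also have "\<dots> \<le> N0 * max (sum U Y) M' + M'" by (rule sol(4)[rule_format, OF Y(1,2)])
          \<comment> \<open>The maximum collapses to the cost of the compared schedule, as the
            threshold is at most that cost.\<close>
          finally have "N0 * sum U X \<le> N0 * fp_cost xs Js + M'" using Y(3,4) by (simp add: max_absorb1)
          moreover have "sum U X = fp_cost xs (dec_server xs ys)" by (simp add: sched(4) simps)
          ultimately show ?thesis using approximation_ratio[OF pq _ Y(3)] by (simp add: N0_def)
        qed
        ultimately have good: "dec_ok xs ys \<and> fp_valid xs (dec_server xs ys) (dec_compl ys) \<and>
              fp_makespan xs (dec_compl ys) \<le> d \<and>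
              (\<forall>Js C. fp_valid xs Js C \<and> fp_makespan xs C \<le> d \<longrightarrow>
                 real (fp_cost xs (dec_server xs ys)) \<le> (1 + real p / real q) * real (fp_cost xs Js))"
          using sched(1-3) by blast
        \<comment> \<open>The computed schedule itself witnesses the condition of the
          \<open>if\<close>.\<close>
        then have ex: "\<exists>Js C. fp_valid xs Js C \<and> fp_makespan xs C \<le> d" by blast
        show ?thesis unfolding if_P[OF ex] by (rule good)
      qed
    qed
  qed
  then show ?thesis by blast
qed

theorem fptas_makespan_ex: "\<exists>P k. fptas_makespan P k"
proof -
  obtain k where k: "\<And>xs d p q. 0 < p \<Longrightarrow> 0 < q \<Longrightarrow> \<exists>out T.
    ram_computes (machine (prog False)) (enc_fp xs @ [d, p, q]) T (map (\<lambda>i. out (Suc i)) [0..<out 0]) \<and>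
    T \<le> k * (input_size (enc_fp xs @ [d, p, q]) + q div p + 1) ^ k \<and> fp_run.outcome xs d p q False out"
    using machine_prog[of False] by blast
  have "fptas_makespan (machine (prog False)) k"
    unfolding fptas_makespan_def Let_def
  proof (intro allI impI)
    fix xs :: fp_inst and b p q :: nat
    assume pq: "0 < p" "0 < q"
    then interpret fp_run xs b p q False by unfold_locales
    obtain out T where out: "ram_computes (machine (prog False)) inp T (map (\<lambda>i. out (Suc i)) [0..<out 0])"
      "T \<le> k * (input_size inp + q div p + 1) ^ k" "outcome out" using k[OF pq] by blast
    define ys where "ys = map (\<lambda>i. out (Suc i)) [0..<out 0]"
    have simps: "U j = ps j" "V j = pc j" "L j = 0" "B j = w j" for j
      by (simp_all add: U_def V_def L_def B_def)
    \<comment> \<open>Running everything on the server costs nothing, so a feasible set always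
      exists and the empty outcome is ruled out.\<close>
    have "sum V ({..<n} - {..<n}) \<le> b" by simp
    moreover have "U j \<le> sum ps {..<n}" if "j \<in> {..<n}" for j
      unfolding simps by (rule member_le_sum) (use that in auto)
    ultimately have "\<exists>M\<in>thresholds. feasible M {..<n} \<and> M \<le> sum ps {..<n}"
      by (intro feasible_threshold) (auto simp: simps(3))
    then obtain M X T' where sol: "feasible M X" "makespan_of (cloud X) T'" "schedule_out (cloud X) T' out"
      "\<And>M' Y. M' \<in> thresholds \<Longrightarrow> feasible M' Y \<Longrightarrow>
         N0 * max (sum U X) M \<le> N0 * max (sum U Y) M' + M'"
      using out(3) unfolding outcome_def by blast
    have K: "cloud X = {..<n} - X" "X \<subseteq> {..<n}" "{..<n} - X \<subseteq> {..<n}" "{..<n} - ({..<n} - X) = X"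
      using sol(1) by (auto simp: cloud_def feasible_def)
    note sched = schedule_out_valid[OF K(3) sol(2)[unfolded K(1)] sol(3)[unfolded K(1)], folded ys_def]
    have cost: "fp_cost xs (dec_server xs ys) \<le> b"
      using sol(1) by (simp add: sched(4) feasible_def simps)
    \<comment> \<open>Cloud jobs satisfy \<open>w j \<le> M\<close> by feasibility, so the value
      minimised by the search really dominates the makespan of the emitted schedule.\<close>
    have T': "T' \<le> max (sum U X) M"
    proof -
      have "w j \<le> M" if "j \<in> {..<n} - X" for j
        using sol(1) that by (auto simp: feasible_def simps)
      then show ?thesis using sol(2) unfolding makespan_of_def K(1,4) simps
        by (metis max.coboundedI1 max.coboundedI2 order_refl)
    qed
    have "real (fp_makespan xs (dec_compl ys)) \<le> (1 + real p / real q) * real (fp_makespan xs C)"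
      if v: "fp_valid xs Js C" "fp_cost xs Js \<le> b" for Js C
    proof -
      define Y where "Y = {j. j < n \<and> Suc j \<in> Js}"
      have diff: "{..<n} - Y = {j. j < n \<and> Suc j \<notin> Js}" by (auto simp: Y_def)
      have U: "sum U Y \<le> C (Suc n)" using valid_server_bound[OF v(1)] by (simp add: simps Y_def)
      have "sum V ({..<n} - Y) \<le> b"
        using v(2) cost_eq[OF fp_validD(1,2)[OF v(1)]] by (simp add: simps diff)
      moreover have "U j \<le> C (Suc n)" if "j \<in> Y" for j
      proof -
        have "U j \<le> sum U Y" by (rule member_le_sum) (use that in \<open>auto simp: Y_def\<close>)
        then show ?thesis using U by linarith
      qed
      moreover have "B j \<le> C (Suc n)" if "j \<in> {..<n} - Y" for j
        unfolding simps by (rule valid_cloud_bound[OF v(1)]) (use that in \<open>auto simp: Y_def\<close>)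
      moreover have "Y \<subseteq> {..<n}" by (auto simp: Y_def)
      ultimately have "\<exists>M\<in>thresholds. feasible M Y \<and> M \<le> C (Suc n)"
        by (intro feasible_threshold) (auto simp: simps(3))
      then obtain M' where Y: "M' \<in> thresholds" "feasible M' Y" "M' \<le> C (Suc n)" by blast
      have "N0 * T' \<le> N0 * max (sum U X) M" using T' by (intro mult_le_mono2)
      also have "\<dots> \<le> N0 * max (sum U Y) M' + M'" by (rule sol(4)[OF Y(1,2)])
      also have "\<dots> \<le> N0 * C (Suc n) + M'" using U Y(3) by (intro add_mono mult_le_mono2) auto
      finally have "N0 * T' \<le> N0 * C (Suc n) + M'" .
      then show ?thesis using approximation_ratio[OF pq _ Y(3)] sched(3)
        by (simp add: N0_def fp_makespan_def makespan_def)
    qed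
    then show "\<exists>ys T. ram_computes (machine (prog False)) inp T ys \<and>
        T \<le> k * (input_size inp + q div p + 1) ^ k \<and>
        dec_ok xs ys \<and> fp_valid xs (dec_server xs ys) (dec_compl ys) \<and>
        fp_cost xs (dec_server xs ys) \<le> b \<and>
        (\<forall>Js C. fp_valid xs Js C \<and> fp_cost xs Js \<le> b \<longrightarrow>
           real (fp_makespan xs (dec_compl ys)) \<le> (1 + real p / real q) * real (fp_makespan xs C))"
      using out(1)[folded ys_def] out(2) sched(1,2) cost by blast
  qed
  then show ?thesis by blast
qed

theorem theorem3:
  shows "(\<exists>P k. fptas_cost P k) \<and> (\<exists>P k. fptas_makespan P k)"
  using fptas_cost_ex fptas_makespan_ex by blast

end
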